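(* Let $\Omega\subseteq M$ be a p-symmetric slice domain, $\Omega_0=\Omega\cap\mathbb{R}^{p+1}$, and $f:\Omega\to\mathbb{A}$ a (left) generalized partial-slice monogenic function of type $(p,q)$. Then, for odd $q\ge3$, $$D_{\mathbf{x}}\Delta_{\mathbf{x}}^{\frac{q-3}{2}}f(\mathbf{x})=\gamma_q\,HGCK\big[\Delta_{\mathbf{x}_p}^{\frac{q-3}{2}}D_{\mathbf{x}_p}f(\mathbf{x}_p),\ 0\big](\mathbf{x}),$$ and consequently $$\overline{D}_{\mathbf{x}}\big(D_{\mathbf{x}}\Delta_{\mathbf{x}}^{\frac{q-3}{2}}f\big)=\gamma_q\,GCK\big[\overline{D}_{\mathbf{x}_p}\Delta_{\mathbf{x}_p}^{\frac{q-3}{2}}D_{\mathbf{x}_p}f(\mathbf{x}_p)\big],$$ where $\gamma_q=(-1)^{\frac{q-1}{2}}\frac{(q-1)!!}{(q-2)!!}$, the functions of $\mathbf{x}_p$ in brackets are computed from $f|_{\Omega_0}$, and the identities hold where the right-hand sides are defined.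
   Context: Let $\mathbb{A}$ be a real alternative algebra (the associator $[a,b,c]=(ab)c-a(bc)$ is an alternating trilinear function) with unity $1$, of finite real dimension $d>1$, equipped with an anti-involution $a\mapsto a^c$ (real linear, $a^c=a$ for real $a$, $(a^c)^c=a$, $(ab)^c=b^ca^c$). Let $t(x)=x+x^c$, $n(x)=xx^c$, $\mathbb{S}_{\mathbb{A}}=\{x: t(x)=0,\ n(x)=1\}$ (assumed nonempty) and $Q_{\mathbb{A}}=\mathbb{R}\cup\{x: t(x)\in\mathbb{R},\ n(x)\in\mathbb{R},\ 4n(x)>t(x)^2\}$. Let $M$ be a real subspace with $\mathbb{R}\subsetneq M\subseteq Q_{\mathbb{A}}$ having a basis $(v_0,\dots,v_m)$, $m\ge1$, $v_0=1$, $v_s\in\mathbb{S}_{\mathbb{A}}$, $v_sv_t=-v_tv_s$ for distinct $s,t\ge1$; complete it to a basis of $\mathbb{A}$ with associated Euclidean norm. Identify $x=\sum x_sv_s\in M$ with $(x_0,\dots,x_m)\in\mathbb{R}^{m+1}$; differentiate componentwise. Fix $p\in\{0,\dots,m-1\}$, $q=m-p$; $\mathbf{x}=\mathbf{x}_p+\underline{\mathbf{x}}_q$ with $\mathbf{x}_p=\sum_{s=0}^px_sv_s\in\mathbb{R}^{p+1}$, $\underline{\mathbf{x}}_q=\sum_{s=p+1}^m x_sv_s$; $\mathbb{S}=\{\sum_{s=p+1}^m x_sv_s:\sum x_s^2=1\}$; $\underline{\mathbf{x}}_q=r\underline{\omega}$, $r=|\underline{\mathbf{x}}_q|$. $D_{\mathbf{x}_p}f=\sum_{s=0}^p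 v_s\partial_{x_s}f$, $\overline{D}_{\mathbf{x}_p}f=\partial_{x_0}f-\sum_{s=1}^pv_s\partial_{x_s}f$, $D_{\mathbf{x}}f=\sum_{s=0}^mv_s\partial_{x_s}f$, $\overline{D}_{\mathbf{x}}f=\partial_{x_0}f-\sum_{s=1}^mv_s\partial_{x_s}f$, $\Delta_{\mathbf{x}_p}=\sum_{s=0}^p\partial_{x_s}^2$, $\Delta_{\mathbf{x}}=\sum_{s=0}^m\partial_{x_s}^2$. $f$ is left generalized partial-slice monogenic of type $(p,q)$ if for every $\underline{\omega}\in\mathbb{S}$ its restriction to $\Omega_{\underline{\omega}}=\Omega\cap(\mathbb{R}^{p+1}\oplus\underline{\omega}\mathbb{R})$ is $C^1$ and $(D_{\mathbf{x}_p}+\underline{\omega}\partial_r)f(\mathbf{x}_p+r\underline{\omega})=0$. A domain is a slice domain if $\Omega\cap\mathbb{R}^{p+1}\ne\emptyset$ and each $\Omega_{\underline{\omega}}$ is a domain in $\mathbb{R}^{p+2}$; p-symmetric if $\mathbf{x}_p+r\underline{\omega}\in\Omega$, $r>0$, implies $\mathbf{x}_p+r\underline{\eta}\in\Omega$ for all $\underline{\eta}\in\mathbb{S}$. For real analytic $g,A_0,A_1$ on $\Omega_0$: $GCK[g](\mathbf{x})=\sum_{k\ge0}\frac{\Gamma(\frac q2)(-1)^kr^{2k}}{2^{2k}k!\Gamma(k+\frac q2)}\Delta_{\mathbf{x}_p}^kg(\mathbf{x}_p)+\underline{\mathbf{x}}_q\sum_{k\ge0}\frac{\Gamma(\frac q2)(-1)^kr^{2k}}{2^{2k+1}k!\Gamma(k+\frac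 q2+1)}\Delta_{\mathbf{x}_p}^k(D_{\mathbf{x}_p}g(\mathbf{x}_p))$, and $HGCK[A_0,A_1](\mathbf{x})=\sum_{k\ge0}\frac{\Gamma(\frac q2)(-1)^kr^{2k}}{2^{2k}k!\Gamma(k+\frac q2)}\Delta_{\mathbf{x}_p}^kA_0(\mathbf{x}_p)+\underline{\mathbf{x}}_q\sum_{k\ge0}\frac{\Gamma(\frac q2+1)(-1)^kr^{2k}}{2^{2k}k!\Gamma(k+\frac q2+1)}\Delta_{\mathbf{x}_p}^kA_1(\mathbf{x}_p)$. Double factorials: $0!!=(-1)!!=1$.
   Formalization: "Where the right-hand sides are defined" is taken to mean: the defining series converge at x and the whole segment from x_p to x lies in Ω; without the segment condition the identity can fail when Ω has slits between x_p and x. *)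

theory Defs
  imports "HOL-Analysis.Analysis"
begin

text \<open>The algebra A is modelled as a finite-dimensional real vector space (a type of class
euclidean_space, so DIM('a) is its real dimension d) with a bilinear multiplication mul,
a unit one and an anti-involution cj. Real numbers r are identified with r *R one.\<close>

definition associator :: "('a::real_vector \<Rightarrow> 'a \<Rightarrow> 'a) \<Rightarrow> 'a \<Rightarrow> 'a \<Rightarrow> 'a \<Rightarrow> 'a" where
  "associator mul a b c = mul (mul a b) c - mul a (mul b c)"

definition alt_algebra_invol ::
  "('a::euclidean_space \<Rightarrow> 'a \<Rightarrow> 'a) \<Rightarrow> 'a \<Rightarrow> ('a \<Rightarrow> 'a) \<Rightarrow> bool" where
  "alt_algebra_invol mul one cj \<longleftrightarrow>
     bilinear mul \<and>
     (\<forall>a. mul one a = a \<and> mul a one = a) \<and>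
     (\<forall>a b. associator mul a a b = 0 \<and> associator mul a b a = 0 \<and> associator mul b a a = 0) \<and>
     linear cj \<and>
     (\<forall>r. cj (r *\<^sub>R one) = r *\<^sub>R one) \<and>
     (\<forall>a. cj (cj a) = a) \<and>
     (\<forall>a b. cj (mul a b) = mul (cj b) (cj a)) \<and>
     DIM('a) > 1"

definition realsA :: "'a::real_vector \<Rightarrow> 'a set" where
  "realsA one = range (\<lambda>r::real. r *\<^sub>R one)"

definition trA :: "('a::real_vector \<Rightarrow> 'a) \<Rightarrow> 'a \<Rightarrow> 'a" where
  "trA cj x = x + cj x"

definition nmA :: "('a \<Rightarrow> 'a \<Rightarrow> 'a) \<Rightarrow> ('a \<Rightarrow> 'a) \<Rightarrow> 'a \<Rightarrow> 'a" where
  "nmA mul cj x = mul x (cj x)"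

definition SA :: "('a::real_vector \<Rightarrow> 'a \<Rightarrow> 'a) \<Rightarrow> 'a \<Rightarrow> ('a \<Rightarrow> 'a) \<Rightarrow> 'a set" where
  "SA mul one cj = {x. trA cj x = 0 \<and> nmA mul cj x = one}"

definition QA :: "('a::real_vector \<Rightarrow> 'a \<Rightarrow> 'a) \<Rightarrow> 'a \<Rightarrow> ('a \<Rightarrow> 'a) \<Rightarrow> 'a set" where
  "QA mul one cj = realsA one \<union>
     {x. \<exists>a b::real. trA cj x = b *\<^sub>R one \<and> nmA mul cj x = a *\<^sub>R one \<and> 4 * a > b\<^sup>2}"

definition adm_basis ::
  "('a::euclidean_space \<Rightarrow> 'a \<Rightarrow> 'a) \<Rightarrow> 'a \<Rightarrow> ('a \<Rightarrow> 'a) \<Rightarrow> (nat \<Rightarrow> 'a) \<Rightarrow> nat \<Rightarrow> bool" where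
  "adm_basis mul one cj v m \<longleftrightarrow>
     m \<ge> 1 \<and>
     v 0 = one \<and>
     (\<forall>s\<in>{1..m}. v s \<in> SA mul one cj) \<and>
     (\<forall>s\<in>{1..m}. \<forall>t\<in>{1..m}. s \<noteq> t \<longrightarrow> mul (v s) (v t) = - mul (v t) (v s)) \<and>
     inj_on v {0..m} \<and> independent (v ` {0..m}) \<and>
     span (v ` {0..m}) \<subseteq> QA mul one cj"

definition Mspace :: "(nat \<Rightarrow> 'a::real_vector) \<Rightarrow> nat \<Rightarrow> 'a set" where
  "Mspace v m = span (v ` {0..m})"

definition Rp1 :: "(nat \<Rightarrow> 'a::real_vector) \<Rightarrow> nat \<Rightarrow> 'a set" where
  "Rp1 v p = span (v ` {0..p})"

definition pt :: "(nat \<Rightarrow> 'a::real_vector) \<Rightarrow> nat \<Rightarrow> (nat \<Rightarrow> real) \<Rightarrow> 'a" where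
  "pt v m c = (\<Sum>s\<le>m. c s *\<^sub>R v s)"

definition xpart :: "(nat \<Rightarrow> 'a::real_vector) \<Rightarrow> nat \<Rightarrow> (nat \<Rightarrow> real) \<Rightarrow> 'a" where
  "xpart v p c = (\<Sum>s\<le>p. c s *\<^sub>R v s)"

definition xqpart :: "(nat \<Rightarrow> 'a::real_vector) \<Rightarrow> nat \<Rightarrow> nat \<Rightarrow> (nat \<Rightarrow> real) \<Rightarrow> 'a" where
  "xqpart v p m c = (\<Sum>s\<in>{p+1..m}. c s *\<^sub>R v s)"

definition rq :: "nat \<Rightarrow> nat \<Rightarrow> (nat \<Rightarrow> real) \<Rightarrow> real" where
  "rq p m c = sqrt (\<Sum>s\<in>{p+1..m}. (c s)\<^sup>2)"

definition Ssph :: "(nat \<Rightarrow> 'a::real_vector) \<Rightarrow> nat \<Rightarrow> nat \<Rightarrow> 'a set" where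
  "Ssph v p m = {(\<Sum>s\<in>{p+1..m}. c s *\<^sub>R v s) | c. (\<Sum>s\<in>{p+1..m}. (c s)\<^sup>2) = 1}"

definition Lslice :: "(nat \<Rightarrow> 'a::real_vector) \<Rightarrow> nat \<Rightarrow> 'a \<Rightarrow> 'a set" where
  "Lslice v p \<omega> = span (insert \<omega> (v ` {0..p}))"

definition Oslice :: "'a set \<Rightarrow> (nat \<Rightarrow> 'a::real_vector) \<Rightarrow> nat \<Rightarrow> 'a \<Rightarrow> 'a set" where
  "Oslice \<Omega> v p \<omega> = \<Omega> \<inter> Lslice v p \<omega>"

definition is_domain_in :: "'a::real_normed_vector set \<Rightarrow> 'a set \<Rightarrow> bool" where
  "is_domain_in L U \<longleftrightarrow> U \<noteq> {} \<and> U \<subseteq> L \<and> openin (top_of_set L) U \<and> connected U"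

definition slice_domain :: "(nat \<Rightarrow> 'a::real_normed_vector) \<Rightarrow> nat \<Rightarrow> nat \<Rightarrow> 'a set \<Rightarrow> bool" where
  "slice_domain v p m \<Omega> \<longleftrightarrow>
     is_domain_in (Mspace v m) \<Omega> \<and>
     \<Omega> \<inter> Rp1 v p \<noteq> {} \<and>
     (\<forall>\<omega>\<in>Ssph v p m. is_domain_in (Lslice v p \<omega>) (Oslice \<Omega> v p \<omega>))"

definition p_symmetric :: "(nat \<Rightarrow> 'a::real_normed_vector) \<Rightarrow> nat \<Rightarrow> nat \<Rightarrow> 'a set \<Rightarrow> bool" where
  "p_symmetric v p m \<Omega> \<longleftrightarrow>
     (\<forall>y\<in>Rp1 v p. \<forall>r>0. \<forall>\<omega>\<in>Ssph v p m. \<forall>\<eta>\<in>Ssph v p m.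
        y + r *\<^sub>R \<omega> \<in> \<Omega> \<longrightarrow> y + r *\<^sub>R \<eta> \<in> \<Omega>)"

definition pd :: "'a::real_normed_vector \<Rightarrow> ('a \<Rightarrow> 'b::real_normed_vector) \<Rightarrow> 'a \<Rightarrow> 'b" where
  "pd u f y = vector_derivative (\<lambda>t::real. f (y + t *\<^sub>R u)) (at 0)"

definition Dxp :: "('a \<Rightarrow> 'a \<Rightarrow> 'a) \<Rightarrow> (nat \<Rightarrow> 'a::real_normed_vector) \<Rightarrow> nat \<Rightarrow> ('a \<Rightarrow> 'a) \<Rightarrow> 'a \<Rightarrow> 'a" where
  "Dxp mul v p f y = (\<Sum>s\<le>p. mul (v s) (pd (v s) f y))"

definition Dxpbar :: "('a \<Rightarrow> 'a \<Rightarrow> 'a) \<Rightarrow> (nat \<Rightarrow> 'a::real_normed_vector) \<Rightarrow> nat \<Rightarrow> ('a \<Rightarrow> 'a) \<Rightarrow> 'a \<Rightarrow> 'a" where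
  "Dxpbar mul v p f y = pd (v 0) f y - (\<Sum>s\<in>{1..p}. mul (v s) (pd (v s) f y))"

definition Lapp :: "(nat \<Rightarrow> 'a::real_normed_vector) \<Rightarrow> nat \<Rightarrow> ('a \<Rightarrow> 'a) \<Rightarrow> 'a \<Rightarrow> 'a" where
  "Lapp v p f y = (\<Sum>s\<le>p. pd (v s) (pd (v s) f) y)"

text \<open>The full operators D_x, Dbar_x, Delta_x in x = (x_0..x_m) are Dxp, Dxpbar, Lapp with p := m.\<close>

definition C1_on :: "'a::real_normed_vector set \<Rightarrow> 'a set \<Rightarrow> ('a \<Rightarrow> 'b::real_normed_vector) \<Rightarrow> bool" where
  "C1_on L A f \<longleftrightarrow>
     (\<exists>f'. (\<forall>y\<in>A. (f has_derivative f' y) (at y within A)) \<and>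
           (\<forall>u\<in>L. continuous_on A (\<lambda>y. f' y u)))"

definition gen_ps_monogenic ::
  "('a \<Rightarrow> 'a \<Rightarrow> 'a) \<Rightarrow> (nat \<Rightarrow> 'a::real_normed_vector) \<Rightarrow> nat \<Rightarrow> nat \<Rightarrow> 'a set \<Rightarrow> ('a \<Rightarrow> 'a) \<Rightarrow> bool" where
  "gen_ps_monogenic mul v p m \<Omega> f \<longleftrightarrow>
     (\<forall>\<omega>\<in>Ssph v p m.
        C1_on (Lslice v p \<omega>) (Oslice \<Omega> v p \<omega>) f \<and>
        (\<forall>y\<in>Oslice \<Omega> v p \<omega>. Dxp mul v p f y + mul \<omega> (pd \<omega> f y) = 0))"

definition gck_c0 :: "nat \<Rightarrow> nat \<Rightarrow> real \<Rightarrow> nat \<Rightarrow> real" where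
  "gck_c0 p m r k = (let q = real (m - p) in
     Gamma (q/2) * (-1)^k * r^(2*k) / (2^(2*k) * fact k * Gamma (real k + q/2)))"

definition gck_c1 :: "nat \<Rightarrow> nat \<Rightarrow> real \<Rightarrow> nat \<Rightarrow> real" where
  "gck_c1 p m r k = (let q = real (m - p) in
     Gamma (q/2) * (-1)^k * r^(2*k) / (2^(2*k+1) * fact k * Gamma (real k + q/2 + 1)))"

definition hgck_c1 :: "nat \<Rightarrow> nat \<Rightarrow> real \<Rightarrow> nat \<Rightarrow> real" where
  "hgck_c1 p m r k = (let q = real (m - p) in
     Gamma (q/2 + 1) * (-1)^k * r^(2*k) / (2^(2*k) * fact k * Gamma (real k + q/2 + 1)))"

definition gck_t0 where
  "gck_t0 v p m g c k = gck_c0 p m (rq p m c) k *\<^sub>R ((Lapp v p ^^ k) g) (xpart v p c)"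
definition gck_t1 where
  "gck_t1 mul v p m g c k = gck_c1 p m (rq p m c) k *\<^sub>R ((Lapp v p ^^ k) (Dxp mul v p g)) (xpart v p c)"
definition hgck_t1 where
  "hgck_t1 v p m A1 c k = hgck_c1 p m (rq p m c) k *\<^sub>R ((Lapp v p ^^ k) A1) (xpart v p c)"

definition GCK ::
  "('a \<Rightarrow> 'a \<Rightarrow> 'a) \<Rightarrow> (nat \<Rightarrow> 'a::real_normed_vector) \<Rightarrow> nat \<Rightarrow> nat \<Rightarrow> ('a \<Rightarrow> 'a) \<Rightarrow> (nat \<Rightarrow> real) \<Rightarrow> 'a" where
  "GCK mul v p m g c =
     (\<Sum>k. gck_t0 v p m g c k) + mul (xqpart v p m c) (\<Sum>k. gck_t1 mul v p m g c k)"

definition HGCK ::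
  "('a \<Rightarrow> 'a \<Rightarrow> 'a) \<Rightarrow> (nat \<Rightarrow> 'a::real_normed_vector) \<Rightarrow> nat \<Rightarrow> nat \<Rightarrow> ('a \<Rightarrow> 'a) \<Rightarrow> ('a \<Rightarrow> 'a) \<Rightarrow> (nat \<Rightarrow> real) \<Rightarrow> 'a" where
  "HGCK mul v p m A0 A1 c =
     (\<Sum>k. gck_t0 v p m A0 c k) + mul (xqpart v p m c) (\<Sum>k. hgck_t1 v p m A1 c k)"

text \<open>"Defined at c": the point lies in \<Omega>, the segment from x_p to x lies in \<Omega>
(so x_p \<in> \<Omega>_0 and the slice-wise extension is connected to \<Omega>_0), and the series converge.\<close>
definition GCK_defined where
  "GCK_defined mul v p m \<Omega> g c \<longleftrightarrow>
     (\<forall>t\<in>{0..1::real}. xpart v p c + t *\<^sub>R xqpart v p m c \<in> \<Omega>) \<and>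
     summable (gck_t0 v p m g c) \<and> summable (gck_t1 mul v p m g c)"

definition HGCK_defined where
  "HGCK_defined v p m \<Omega> A0 A1 c \<longleftrightarrow>
     (\<forall>t\<in>{0..1::real}. xpart v p c + t *\<^sub>R xqpart v p m c \<in> \<Omega>) \<and>
     summable (gck_t0 v p m A0 c) \<and> summable (hgck_t1 v p m A1 c)"

fun dfact :: "nat \<Rightarrow> nat" where
  "dfact 0 = 1"
| "dfact (Suc 0) = 1"
| "dfact (Suc (Suc n)) = Suc (Suc n) * dfact n"

definition gamma_q :: "nat \<Rightarrow> real" where
  "gamma_q q = (-1) ^ ((q - 1) div 2) * real (dfact (q - 1)) / real (dfact (q - 2))"

end

theory Submission
  imports Defs "HOL-Real_Asymp.Real_Asymp"
begin

text \<open>On a slice the function f is a \<open>C\<^sup>1\<close> solution of a Dirac system with constant coefficients.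
Averaging over segments makes such a solution twice differentiable, hence harmonic, and the maximum
principle (a reflection and a quadratic barrier on a cube) bounds its gradient by its supremum. Applied
to difference quotients and iterated, the bound shows that f is smooth with k-th derivatives of order
\<open>C L^k k!\<close>, so f is analytic along every ray and \<open>f = \<alpha>(y, r) + \<omega> \<beta>(y, r)\<close> by
unique continuation from \<open>r = 0\<close>.

Let \<open>\<delta> = (1/r) d/dr\<close>, \<open>A\<^sub>i = \<delta>^i \<alpha>\<close> and \<open>E\<^sub>i = \<delta>^i (\<beta>/r)\<close>. The Cauchy-Riemann
system gives \<open>D A\<^sub>i = (2i+1) E\<^sub>i + r\<^sup>2 E\<^sub>i\<^sub>+\<^sub>1\<close> and \<open>D' E\<^sub>i = - A\<^sub>i\<^sub>+\<^sub>1\<close>, where D and D' are the operators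
\<open>D\<^sub>x\<^sub>p\<close> and its conjugate. These relations make the Laplacian of M send
\<open>A\<^sub>i + x\<^sub>q E\<^sub>i\<close> to \<open>(q-2i-1) (A\<^sub>i\<^sub>+\<^sub>1 + x\<^sub>q E\<^sub>i\<^sub>+\<^sub>1)\<close>, so with \<open>j = (q-3)/2\<close> both left-hand sides of
the theorem are multiples of \<open>E\<^sub>j\<close> and \<open>A\<^sub>j\<^sub>+\<^sub>1 + x\<^sub>q E\<^sub>j\<^sub>+\<^sub>1\<close>. At \<open>r = 0\<close> they express the
coefficients of HGCK and GCK as Taylor coefficients of the same functions in the variable \<open>r\<^sup>2\<close>;
analyticity along the ray and Abel's theorem at its end point identify the sums.\<close>

section \<open>Partial derivatives along lines\<close>

text \<open>Three obstacles shape the proof. The algebra is not associative, so products are kept as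
  left multiplication operators, and the alternative law controls the double products
  \<open>mul a (mul b w)\<close> that occur. The hypothesis on f concerns each slice separately,
  whereas \<open>Lapp v m\<close> differentiates across slices; the pair \<alpha>, \<beta> is common
  to all slices and supplies the transversal derivatives, and the evenness of \<alpha> and oddness
  of \<beta> in r make the divisions by r smooth across r = 0. Finally, a bound
  \<open>C * L ^ k * fact k\<close> on derivatives guarantees convergence of the Taylor series at r
  = 0 only up to a radius governed by 1/L, possibly smaller than |x_q|; the series is merely assumed
  to converge, perhaps conditionally, at the point itself, so identities must be continued along the
  segment. The space R^(p+1) is modelled on p + 1 of the basis vectors of \<open>'a\<close>.
  Functions of (y, r) thus live on subsets of \<open>'a \<times> real\<close> and have zero
  derivative in the surplus directions, so that cubes and the Laplacian refer to a Euclidean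
  type.\<close>

definition haspd :: "'e::real_normed_vector \<Rightarrow> ('e \<Rightarrow> 'b::real_normed_vector) \<Rightarrow> 'b \<Rightarrow> 'e \<Rightarrow> bool" where
  "haspd b u d x \<longleftrightarrow> ((\<lambda>t::real. u (x + t *\<^sub>R b)) has_vector_derivative d) (at 0)"

lemma haspd_pd: "haspd b u d x \<Longrightarrow> pd b u x = d"
  unfolding haspd_def pd_def by (rule vector_derivative_at)

lemma haspd_shift:
  assumes "haspd b u d (x + t *\<^sub>R b)"
  shows "((\<lambda>s. u (x + s *\<^sub>R b)) has_vector_derivative d) (at t)"
proof -
  have "((\<lambda>s. u (x + t *\<^sub>R b + s *\<^sub>R b)) \<circ> (\<lambda>s. s - t) has_vector_derivative (1 *\<^sub>R d)) (at t)"
    using assms unfolding haspd_def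
    by (intro vector_diff_chain_at) (auto intro!: derivative_eq_intros)
  moreover have "(\<lambda>s. u (x + t *\<^sub>R b + s *\<^sub>R b)) \<circ> (\<lambda>s. s - t) = (\<lambda>s. u (x + s *\<^sub>R b))"
    by (auto simp: fun_eq_iff algebra_simps)
  ultimately show ?thesis by simp
qed

lemma haspd_transform:
  assumes "haspd b u d x" "\<forall>\<^sub>F t in at (0::real). u (x + t *\<^sub>R b) = w (x + t *\<^sub>R b)" "u x = w x"
  shows "haspd b w d x"
  using assms unfolding haspd_def has_vector_derivative_def
  by (auto intro: has_derivative_transform_eventually)

lemma eventually_line_open:
  fixes x :: "'e::real_normed_vector"
  assumes "open S" "x \<in> S"
  shows "\<forall>\<^sub>F t in nhds (0::real). x + t *\<^sub>R b \<in> S"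
proof -
  have "((\<lambda>t::real. x + t *\<^sub>R b) \<longlongrightarrow> x + 0 *\<^sub>R b) (at 0)"
    by (intro tendsto_intros)
  then have "\<forall>\<^sub>F t in at (0::real). x + t *\<^sub>R b \<in> S"
    using assms by (intro topological_tendstoD) auto
  then show ?thesis using assms by (simp add: eventually_nhds_conv_at)
qed

lemma haspd_cong_open:
  assumes "open S" "x \<in> S" "\<And>y. y \<in> S \<Longrightarrow> u y = w y" "haspd b u d x"
  shows "haspd b w d x"
proof (rule haspd_transform[OF assms(4)])
  show "\<forall>\<^sub>F t in at 0. u (x + t *\<^sub>R b) = w (x + t *\<^sub>R b)"
    using eventually_line_open[OF assms(1,2), of b] assms(3)
    by (auto simp: eventually_nhds_conv_at elim: eventually_mono)
qed (use assms in auto)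

lemma haspd_add: "haspd b u d x \<Longrightarrow> haspd b w e x \<Longrightarrow> haspd b (\<lambda>x. u x + w x) (d + e) x"
  unfolding haspd_def by (rule has_vector_derivative_add)

lemma haspd_diff: "haspd b u d x \<Longrightarrow> haspd b w e x \<Longrightarrow> haspd b (\<lambda>x. u x - w x) (d - e) x"
  unfolding haspd_def by (rule has_vector_derivative_diff)

lemma haspd_linear: "bounded_linear L \<Longrightarrow> haspd b u d x \<Longrightarrow> haspd b (\<lambda>x. L (u x)) (L d) x"
  unfolding haspd_def by (rule bounded_linear.has_vector_derivative)

lemma haspd_translate: "haspd b u d (x + a) \<Longrightarrow> haspd b (\<lambda>x. u (x + a)) d x"
  unfolding haspd_def by (simp add: algebra_simps)

lemma haspd_quotient:
  assumes "haspd b u d x"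
  shows "((\<lambda>h. (1 / h) *\<^sub>R (u (x + h *\<^sub>R b) - u x)) \<longlongrightarrow> d) (at 0)"
proof (rule LIM_zero_cancel, rule tendsto_norm_zero_cancel)
  have lim: "((\<lambda>h. norm (u (x + h *\<^sub>R b) - u x - h *\<^sub>R d) / norm h) \<longlongrightarrow> 0) (at (0::real))"
    using assms unfolding haspd_def has_vector_derivative_def has_derivative_at by simp
  have eq: "norm (u (x + h *\<^sub>R b) - u x - h *\<^sub>R d) / norm h =
      norm ((1 / h) *\<^sub>R (u (x + h *\<^sub>R b) - u x) - d)" if "h \<noteq> 0" for h
  proof -
    have "(1 / h) *\<^sub>R (u (x + h *\<^sub>R b) - u x) - d = (1 / h) *\<^sub>R (u (x + h *\<^sub>R b) - u x - h *\<^sub>R d)"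
      using that by (simp add: algebra_simps)
    then show ?thesis by simp
  qed
  show "((\<lambda>h. norm ((1 / h) *\<^sub>R (u (x + h *\<^sub>R b) - u x) - d)) \<longlongrightarrow> 0) (at 0)"
    by (rule Lim_transform_eventually[OF lim]) (use eq in \<open>simp add: eventually_at_filter\<close>)
qed

section \<open>Interior estimates for harmonic functions\<close>

lemma second_derivative_local_max:
  fixes \<phi> :: "real \<Rightarrow> real"
  assumes "\<delta> > 0"
    and \<phi>: "\<And>t. \<bar>t\<bar> < \<delta> \<Longrightarrow> (\<phi> has_real_derivative \<phi>1 t) (at t)"
    and \<phi>1: "(\<phi>1 has_real_derivative d) (at 0)"
    and mx: "\<And>t. \<bar>t\<bar> < \<delta> \<Longrightarrow> \<phi> t \<le> \<phi> 0"
  shows "d \<le> 0"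
proof (rule ccontr)
  assume "\<not> d \<le> 0"
  then have "d > 0" by simp
  have "\<phi>1 0 = 0"
    using DERIV_local_max[of \<phi> "\<phi>1 0" 0 \<delta>] \<phi>[of 0] \<open>\<delta> > 0\<close> mx by auto
  then obtain e where e: "e > 0" "\<And>h. 0 < h \<Longrightarrow> h < e \<Longrightarrow> \<phi>1 h > 0"
    using DERIV_pos_inc_right[OF \<phi>1 \<open>d > 0\<close>] by auto
  define h where "h = min e \<delta> / 2"
  have h: "0 < h" "h < e" "h < \<delta>" using e(1) \<open>\<delta> > 0\<close> by (auto simp: h_def)
  obtain z where z: "0 < z" "z < h" "\<phi> h - \<phi> 0 = (h - 0) * \<phi>1 z"
    using MVT2[of 0 h \<phi> \<phi>1] h \<phi> by force
  then have "\<phi> h > \<phi> 0" using e(2)[of z] h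
    by (smt (verit) mult_pos_pos)
  with mx[of h] h show False by simp
qed

lemma haspd_norm_sq: "haspd b (\<lambda>x. x \<bullet> x) (2 * (x \<bullet> b)) x"
  unfolding haspd_def has_vector_derivative_def
  by (auto intro!: derivative_eq_intros simp: inner_commute)

lemma haspd_inner: "haspd b (\<lambda>x. x \<bullet> c) (b \<bullet> c) x"
  unfolding haspd_def has_vector_derivative_def
  by (auto intro!: derivative_eq_intros)

text \<open>Weak maximum principle for subharmonic functions. A small multiple of the squared norm
  is added to make the Laplacian strictly positive, which is incompatible with nonpositive second
  derivatives at an interior maximum.\<close>

lemma max_principle:
  fixes w :: "'e::euclidean_space \<Rightarrow> real"
  assumes cont: "continuous_on (cbox l h) w"
    and d1: "\<And>x b. x \<in> box l h \<Longrightarrow> b \<in> Basis \<Longrightarrow> haspd b w (w1 b x) x"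
    and d2: "\<And>x b. x \<in> box l h \<Longrightarrow> b \<in> Basis \<Longrightarrow> haspd b (w1 b) (w2 b x) x"
    and lap: "\<And>x. x \<in> box l h \<Longrightarrow> (\<Sum>b\<in>Basis. w2 b x) \<ge> 0"
    and bdry: "\<And>x. x \<in> cbox l h \<Longrightarrow> x \<notin> box l h \<Longrightarrow> w x \<le> 0"
    and x: "x \<in> cbox l h"
  shows "w x \<le> 0"
proof (rule ccontr)
  assume "\<not> w x \<le> 0"
  then have wx: "w x > 0" by simp
  obtain K where K: "\<And>y. y \<in> cbox l h \<Longrightarrow> norm y \<le> K"
    using bounded_cbox[of l h] bounded_iff by blast
  have K0: "K \<ge> 0" using K[OF x] norm_ge_zero order_trans by blast
  \<comment> \<open>Small enough that subtracting \<open>\<epsilon> * K\<^sup>2\<close> keeps the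
    value at x positive; the summand 1 covers K = 0.\<close>
  define \<epsilon> where "\<epsilon> = w x / (2 * (K\<^sup>2 + 1))"
  have K1: "K\<^sup>2 + 1 > 0" by (simp add: add_nonneg_pos)
  have eps: "\<epsilon> > 0" "\<epsilon> * K\<^sup>2 < w x"
  proof -
    show "\<epsilon> > 0" using wx K1 by (simp add: \<epsilon>_def)
    have "\<epsilon> * K\<^sup>2 < \<epsilon> * (2 * (K\<^sup>2 + 1))" using \<open>\<epsilon> > 0\<close>
      by (intro mult_strict_left_mono) (auto simp: add_strict_increasing2)
    also have "\<dots> = w x" using K1 by (simp add: \<epsilon>_def)
    finally show "\<epsilon> * K\<^sup>2 < w x" .
  qed
  \<comment> \<open>The shift by \<open>K\<^sup>2\<close> puts v below w on the cube, so v is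
    nonpositive on the boundary and its positive maximum is interior.\<close>
  define v where "v = (\<lambda>y. w y + \<epsilon> * (y \<bullet> y - K\<^sup>2))"
  have vw: "v y \<le> w y" if "y \<in> cbox l h" for y
  proof -
    have "y \<bullet> y \<le> K\<^sup>2" using K[OF that] by (simp add: power2_norm_eq_inner[symmetric] power_mono)
    then show ?thesis using eps(1) by (simp add: v_def mult_le_0_iff)
  qed
  have "continuous_on (cbox l h) v"
    unfolding v_def by (intro continuous_intros cont)
  then obtain z where z: "z \<in> cbox l h" "\<And>y. y \<in> cbox l h \<Longrightarrow> v y \<le> v z"
    using continuous_attains_sup[of "cbox l h" v] compact_cbox x by blast
  have "v x \<ge> w x - \<epsilon> * K\<^sup>2"
    using eps(1) by (simp add: v_def algebra_simps)
  then have "v z > 0" using z(2)[OF x] eps(2) by linarith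
  then have zb: "z \<in> box l h" using bdry[of z] vw[of z] z(1) by fastforce
  have "w2 b z + 2 * \<epsilon> \<le> 0" if b: "b \<in> Basis" for b
  proof -
    from eventually_line_open[OF open_box zb, of b]
    obtain \<delta> where \<delta>: "\<delta> > 0" "\<And>t. \<bar>t\<bar> < \<delta> \<Longrightarrow> z + t *\<^sub>R b \<in> box l h"
      by (auto simp: eventually_nhds_metric dist_real_def)
    have 1: "haspd b v (w1 b y + 2 * \<epsilon> * (y \<bullet> b)) y" if "y \<in> box l h" for y
      unfolding v_def
      using d1[OF that b] haspd_norm_sq[of b y] unfolding haspd_def
      by (auto intro!: derivative_eq_intros)
    have 2: "haspd b (\<lambda>y. w1 b y + 2 * \<epsilon> * (y \<bullet> b)) (w2 b z + 2 * \<epsilon>) z"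
      using d2[OF zb b] haspd_inner[of b b z] b unfolding haspd_def
      by (auto intro!: derivative_eq_intros)
    show ?thesis
    proof (rule second_derivative_local_max[OF \<delta>(1)])
      show "((\<lambda>t. v (z + t *\<^sub>R b)) has_real_derivative
         (w1 b (z + t *\<^sub>R b) + 2 * \<epsilon> * ((z + t *\<^sub>R b) \<bullet> b))) (at t)" if "\<bar>t\<bar> < \<delta>" for t
        using haspd_shift[OF 1[OF \<delta>(2)[OF that]]]
        by (simp add: has_real_derivative_iff_has_vector_derivative)
      show "((\<lambda>t. w1 b (z + t *\<^sub>R b) + 2 * \<epsilon> * ((z + t *\<^sub>R b) \<bullet> b)) has_real_derivative
         w2 b z + 2 * \<epsilon>) (at 0)"
        using 2 by (simp add: has_real_derivative_iff_has_vector_derivative haspd_def)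
      show "v (z + t *\<^sub>R b) \<le> v (z + 0 *\<^sub>R b)" if "\<bar>t\<bar> < \<delta>" for t
        using z(2) \<delta>(2)[OF that] box_subset_cbox by auto
    qed
  qed
  then have "(\<Sum>b\<in>(Basis::'e set). w2 b z + 2 * \<epsilon>) \<le> 0" by (rule sum_nonpos)
  then have "(\<Sum>b\<in>(Basis::'e set). w2 b z) + 2 * \<epsilon> * DIM('e) \<le> 0"
    by (simp add: sum.distrib mult.commute)
  moreover have "2 * \<epsilon> * DIM('e) > 0" using eps(1) by simp
  ultimately show False using lap[OF zb] by linarith
qed

text \<open>The reflection and barrier argument of Gilbarg--Trudinger, Section 3.4: the odd part of u is
  compared with the harmonic quadratic polynomial \<open>\<psi>\<close> on half of the cube.\<close>
lemma reflection_bound_aux: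
  fixes u :: "'e::euclidean_space \<Rightarrow> real"
  assumes d: "d > 0" and e: "e \<in> Basis"
    and cont: "continuous_on (cbox (- d *\<^sub>R One) (d *\<^sub>R One)) u"
    and d1: "\<And>x b. x \<in> box (- d *\<^sub>R One) (d *\<^sub>R One) \<Longrightarrow> b \<in> Basis \<Longrightarrow> haspd b u (u1 b x) x"
    and d2: "\<And>x b. x \<in> box (- d *\<^sub>R One) (d *\<^sub>R One) \<Longrightarrow> b \<in> Basis \<Longrightarrow> haspd b (u1 b) (u2 b x) x"
    and lap: "\<And>x. x \<in> box (- d *\<^sub>R One) (d *\<^sub>R One) \<Longrightarrow> (\<Sum>b\<in>Basis. u2 b x) = 0"
    and M: "\<And>x. x \<in> cbox (- d *\<^sub>R One) (d *\<^sub>R One) \<Longrightarrow> \<bar>u x\<bar> \<le> M"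
    and t: "0 \<le> t" "t \<le> d"
  shows "u (t *\<^sub>R e) - u (- t *\<^sub>R e) \<le> 2 * t * DIM('e) * M / d"
proof -
  define n where "n = real DIM('e)"
  define \<rho> where "\<rho> = (\<lambda>x::'e. x - (2 * (x \<bullet> e)) *\<^sub>R e)"
  \<comment> \<open>Corners of the half cube in which the coordinate along e runs from 0 to
    d.\<close>
  define l where "l = (- d) *\<^sub>R (One - e)"
  define h where "h = d *\<^sub>R (One::'e)"
  \<comment> \<open>Up to the factor \<open>M / d\<^sup>2\<close> the second derivatives are 2 in
    each of the n - 1 other directions and -2(n - 1) along e, so they cancel. On the outer faces the
    barrier is at least M; on the mirror plane it is nonnegative, and there the odd part of u
    vanishes.\<close>
  define \<psi> where "\<psi> = (\<lambda>x. (M / d\<^sup>2) * ((\<Sum>b\<in>Basis - {e}. (x \<bullet> b)\<^sup>2) +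
      (x \<bullet> e) * (n * d - (n - 1) * (x \<bullet> e))))"
  define w where "w = (\<lambda>x. (u x - u (\<rho> x)) / 2 - \<psi> x)"
  define \<psi>1 where "\<psi>1 = (\<lambda>b x. (M / d\<^sup>2) * (if b = e then n * d - 2 * (n - 1) * (x \<bullet> e) else 2 * (x \<bullet> b)))"
  define \<psi>2 where "\<psi>2 = (\<lambda>b::'e. (M / d\<^sup>2) * (if b = e then - 2 * (n - 1) else 2))"
  \<comment> \<open>Chain rule sign of the reflection. Its square is 1, so the reflected function is
    again harmonic.\<close>
  define \<sigma> where "\<sigma> = (\<lambda>b. if b = e then -1 else 1 :: real)"
  define w1 where "w1 = (\<lambda>b x. (u1 b x - \<sigma> b * u1 b (\<rho> x)) / 2 - \<psi>1 b x)"
  define w2 where "w2 = (\<lambda>b x. (u2 b x - u2 b (\<rho> x)) / 2 - \<psi>2 b)"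
  have ee: "e \<bullet> e = 1" and eb: "\<And>b. b \<in> Basis \<Longrightarrow> b \<noteq> e \<Longrightarrow> e \<bullet> b = 0 \<and> b \<bullet> e = 0"
    using e inner_not_same_Basis by (auto)
  have n1: "n \<ge> 1" unfolding n_def using DIM_positive[where 'a='e] by linarith
  have M0: "M \<ge> 0" using M[of 0] d by (force simp: mem_box)
  have \<rho>b: "\<rho> x \<bullet> b = \<sigma> b * (x \<bullet> b)" if "b \<in> Basis" for x b
    using that ee eb by (auto simp: \<rho>_def \<sigma>_def inner_diff_left)
  have \<rho>add: "\<rho> (x + t *\<^sub>R b) = \<rho> x + (\<sigma> b * t) *\<^sub>R b" if "b \<in> Basis" for x b t
    using that ee eb scaleR_left_distrib[of t t e]
    by (auto simp: \<rho>_def \<sigma>_def algebra_simps inner_add_left)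
  have lb: "l \<bullet> b = (if b = e then 0 else - d)" if "b \<in> Basis" for b
    using that ee eb by (auto simp: l_def inner_diff_left)
  have hb: "h \<bullet> b = d" if "b \<in> Basis" for b using that by (simp add: h_def)
  let ?Q = "cbox (- d *\<^sub>R One) (d *\<^sub>R One) :: 'e set"
  let ?B = "box (- d *\<^sub>R One) (d *\<^sub>R One) :: 'e set"
  have sub: "cbox l h \<subseteq> ?Q" 
  proof
    fix x assume x: "x \<in> cbox l h"
    have "- d \<le> x \<bullet> b \<and> x \<bullet> b \<le> d" if "b \<in> Basis" for b
      using x that lb[OF that] hb[OF that] d unfolding mem_box by (smt (verit))
    then show "x \<in> ?Q" by (simp add: mem_box)
  qed
  have subB: "box l h \<subseteq> ?B" 
  proof
    fix x assume x: "x \<in> box l h"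
    have "- d < x \<bullet> b \<and> x \<bullet> b < d" if "b \<in> Basis" for b
      using x that lb[OF that] hb[OF that] d unfolding mem_box by (smt (verit))
    then show "x \<in> ?B" by (simp add: mem_box)
  qed
  have \<rho>Q: "\<rho> x \<in> ?Q" if "x \<in> ?Q" for x
  proof -
    have "- d \<le> \<rho> x \<bullet> b \<and> \<rho> x \<bullet> b \<le> d" if "b \<in> Basis" for b
    proof -
      have "- d \<le> x \<bullet> b \<and> x \<bullet> b \<le> d" using \<open>x \<in> ?Q\<close> that by (simp add: mem_box)
      then show ?thesis by (auto simp: \<rho>b[OF that] \<sigma>_def)
    qed
    then show ?thesis by (simp add: mem_box)
  qed
  have \<rho>B: "\<rho> x \<in> ?B" if "x \<in> ?B" for x
  proof -
    have "- d < \<rho> x \<bullet> b \<and> \<rho> x \<bullet> b < d" if "b \<in> Basis" for b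
    proof -
      have "- d < x \<bullet> b \<and> x \<bullet> b < d" using \<open>x \<in> ?B\<close> that by (simp add: mem_box)
      then show ?thesis by (auto simp: \<rho>b[OF that] \<sigma>_def) 
    qed
    then show ?thesis by (simp add: mem_box)
  qed
  have cont\<rho>: "continuous_on A \<rho>" for A unfolding \<rho>_def by (intro continuous_intros)
  have \<psi>p1: "haspd b \<psi> (\<psi>1 b x) x" if b: "b \<in> Basis" for b x
  proof (cases "b = e")
    case True
    have eq: "\<psi> (x + t *\<^sub>R e) = (M / d\<^sup>2) * ((\<Sum>b\<in>Basis - {e}. (x \<bullet> b)\<^sup>2) +
      (x \<bullet> e + t) * (n * d - (n - 1) * (x \<bullet> e + t)))" for t
      using ee eb by (simp add: \<psi>_def inner_add_left)
    show ?thesis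
      unfolding True haspd_def \<psi>1_def eq has_real_derivative_iff_has_vector_derivative[symmetric]
      by (intro DERIV_cmult) (auto simp: algebra_simps intro!: derivative_eq_intros)
  next
    case False
    have eq: "\<psi> (x + t *\<^sub>R b) = (M / d\<^sup>2) * ((\<Sum>c\<in>Basis - {e,b}. (x \<bullet> c)\<^sup>2) + (x \<bullet> b + t)\<^sup>2 +
      (x \<bullet> e) * (n * d - (n - 1) * (x \<bullet> e)))" for t
    proof -
      have "(\<Sum>c\<in>Basis - {e}. ((x + t *\<^sub>R b) \<bullet> c)\<^sup>2) =
        ((x + t *\<^sub>R b) \<bullet> b)\<^sup>2 + (\<Sum>c\<in>Basis - {e} - {b}. ((x + t *\<^sub>R b) \<bullet> c)\<^sup>2)"
        using b False by (intro sum.remove) auto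
      also have "Basis - {e} - {b} = Basis - {e,b}" by auto
      also have "(\<Sum>c\<in>Basis - {e,b}. ((x + t *\<^sub>R b) \<bullet> c)\<^sup>2) = (\<Sum>c\<in>Basis - {e,b}. (x \<bullet> c)\<^sup>2)"
        using b by (intro sum.cong refl) (auto simp: inner_add_left inner_not_same_Basis)
      finally show ?thesis using b False eb by (simp add: \<psi>_def inner_add_left)
    qed
    show ?thesis
      using False unfolding haspd_def \<psi>1_def eq has_real_derivative_iff_has_vector_derivative[symmetric]
      by (intro DERIV_cmult) (auto simp: algebra_simps intro!: derivative_eq_intros)
  qed
  have \<psi>p2: "haspd b (\<psi>1 b) (\<psi>2 b) x" if b: "b \<in> Basis" for b x
    using b e unfolding haspd_def \<psi>1_def \<psi>2_def has_real_derivative_iff_has_vector_derivative[symmetric]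
    by (intro DERIV_cmult) (auto simp: algebra_simps inner_add_left intro!: derivative_eq_intros)
  have refl1: "haspd b (\<lambda>x. g (\<rho> x)) (\<sigma> b * g') x" if "b \<in> Basis" "haspd b g g' (\<rho> x)" for b g g' x
  proof -
    have "((\<lambda>t. g (\<rho> x + t *\<^sub>R b)) \<circ> (\<lambda>t. \<sigma> b * t) has_vector_derivative (\<sigma> b *\<^sub>R g')) (at 0)"
      using that(2) unfolding haspd_def
      by (intro vector_diff_chain_at) (auto intro!: derivative_eq_intros simp: has_real_derivative_iff_has_vector_derivative[symmetric])
    then show ?thesis unfolding haspd_def using \<rho>add[OF that(1), of x] by (simp add: o_def)
  qed
  have \<sigma>2: "\<sigma> b * \<sigma> b = 1" for b by (simp add: \<sigma>_def)
  have "w (t *\<^sub>R e) \<le> 0"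
  proof (rule max_principle[of l h w w1 w2])
    show "continuous_on (cbox l h) w"
      unfolding w_def \<psi>_def using d
      by (intro continuous_intros continuous_on_subset[OF cont sub]
            continuous_on_compose2[OF cont cont\<rho>]) (use sub \<rho>Q in auto)
    show "haspd b w (w1 b x) x" if "x \<in> box l h" "b \<in> Basis" for x b
      using d1[of x b] refl1[OF that(2) d1[of "\<rho> x" b]] \<psi>p1[OF that(2), of x] that subB \<rho>B
      unfolding haspd_def w_def w1_def
      by (auto intro!: derivative_eq_intros simp: diff_divide_distrib)
    show "haspd b (w1 b) (w2 b x) x" if "x \<in> box l h" "b \<in> Basis" for x b
      using d2[of x b] refl1[OF that(2) d2[of "\<rho> x" b]] \<psi>p2[OF that(2), of x] that subB \<rho>B \<sigma>2[of b]
      unfolding haspd_def w1_def w2_def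
      by (auto intro!: derivative_eq_intros simp: diff_divide_distrib mult.assoc[symmetric])
    show "0 \<le> (\<Sum>b\<in>Basis. w2 b x)" if "x \<in> box l h" for x
    proof -
      have "(\<Sum>b\<in>Basis. \<psi>2 b) = \<psi>2 e + (\<Sum>b\<in>Basis - {e}. \<psi>2 b)"
        using e by (intro sum.remove) auto
      also have "(\<Sum>b\<in>Basis - {e}. \<psi>2 b) = (\<Sum>b\<in>Basis - {e}. (M / d\<^sup>2) * 2)"
        by (intro sum.cong) (auto simp: \<psi>2_def)
      also have "\<dots> = (n - 1) * ((M / d\<^sup>2) * 2)"
        using e by (simp add: n_def card_Diff_singleton of_nat_diff DIM_positive Suc_leI)
      also have "\<psi>2 e + (n - 1) * ((M / d\<^sup>2) * 2) = 0"
        using d by (simp add: \<psi>2_def field_simps)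
      finally have "(\<Sum>b\<in>Basis. \<psi>2 b) = 0" .
      moreover have "x \<in> ?B" using that subB by auto
      ultimately show ?thesis
        using lap[of x] lap[of "\<rho> x"] \<rho>B
        by (simp add: w2_def sum_subtractf diff_divide_distrib sum_divide_distrib[symmetric])
    qed
    show "t *\<^sub>R e \<in> cbox l h"
      using t d ee eb e by (auto simp: mem_box lb hb)
    show "w x \<le> 0" if x: "x \<in> cbox l h" "x \<notin> box l h" for x
    proof -
      define s where "s = x \<bullet> e"
      have s: "0 \<le> s" "s \<le> d" using x(1) e lb hb by (auto simp: mem_box s_def)
      have sm: "(n - 1) * s \<le> (n - 1) * d" using s n1 by (intro mult_left_mono) auto
      then have s2: "n * d - (n - 1) * s \<ge> d" by (simp add: algebra_simps)
      have s3: "s * (n * d - (n - 1) * s) \<ge> s * d" using s2 s by (intro mult_left_mono) auto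
      have sq: "(\<Sum>b\<in>Basis - {e}. (x \<bullet> b)\<^sup>2) \<ge> 0" by (intro sum_nonneg) auto
      have Q: "x \<in> ?Q" using x sub by auto
      from x obtain b where b: "b \<in> Basis" "\<not> (l \<bullet> b < x \<bullet> b \<and> x \<bullet> b < h \<bullet> b)"
        "l \<bullet> b \<le> x \<bullet> b" "x \<bullet> b \<le> h \<bullet> b"
        by (auto simp: mem_box)
      have big: "w x \<le> 0" if "(\<Sum>b\<in>Basis - {e}. (x \<bullet> b)\<^sup>2) + s * (n * d - (n - 1) * s) \<ge> d\<^sup>2"
      proof -
        have "M / d\<^sup>2 * d\<^sup>2 \<le> \<psi> x" unfolding \<psi>_def s_def[symmetric]
          using that M0 by (intro mult_left_mono) auto
        then have "M \<le> \<psi> x" using d by simp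
        then show ?thesis using M[OF Q] M[OF \<rho>Q[OF Q]] by (simp add: w_def)
      qed
      have "b \<noteq> e \<or> s = 0 \<or> s = d"
        using b lb[OF b(1)] hb[OF b(1)] by (auto simp: s_def)
      then consider "b \<noteq> e" | "b = e" "s = 0" | "b = e" "s = d"
        by blast
      then show ?thesis
      proof cases
        case 1
        then have "\<bar>x \<bullet> b\<bar> = d" using b lb hb d by auto
        then have "d\<^sup>2 = (x \<bullet> b)\<^sup>2" by (metis power2_abs)
        also have "\<dots> \<le> (\<Sum>b\<in>Basis - {e}. (x \<bullet> b)\<^sup>2)"
          using 1 b by (intro member_le_sum) auto
        finally show ?thesis using s3 s d by (intro big) (smt (verit) mult_nonneg_nonneg)
      next
        case 2
        then have "\<rho> x = x" by (simp add: \<rho>_def s_def)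
        moreover have "\<psi> x \<ge> 0" unfolding \<psi>_def s_def[symmetric] using 2 M0 sq by simp
        ultimately show ?thesis by (simp add: w_def)
      next
        case 3
        then show ?thesis using s3 sq by (intro big) (simp add: power2_eq_square)
      qed
    qed
  qed
  moreover have "\<rho> (t *\<^sub>R e) = - t *\<^sub>R e"
    using ee by (simp add: \<rho>_def algebra_simps) (simp add: scaleR_left_distrib[symmetric])
  ultimately have "u (t *\<^sub>R e) - u (- t *\<^sub>R e) \<le> 2 * \<psi> (t *\<^sub>R e)"
    by (simp add: w_def)
  also have "\<psi> (t *\<^sub>R e) = (M / d\<^sup>2) * (t * (n * d - (n - 1) * t))"
    using ee eb by (simp add: \<psi>_def)
  also have "\<dots> \<le> (M / d\<^sup>2) * (t * (n * d))"
    using M0 t n1 by (intro mult_left_mono) (auto)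
  also have "2 * \<dots> = 2 * t * DIM('e) * M / d"
    using d by (simp add: n_def power2_eq_square field_simps)
  finally show ?thesis by simp
qed

text \<open>The vector-valued case follows from the scalar one by testing with the difference y
  itself: the inner product with y turns the left side into the squared norm of y and the bound M
  into M times the norm of y, so no constant is lost.\<close>

lemma harmonic_difference_bound:
  fixes u :: "'e::euclidean_space \<Rightarrow> 'b::real_inner"
  assumes d: "d > 0" and e: "e \<in> Basis"
    and Q: "Q = cbox (x0 - d *\<^sub>R One) (x0 + d *\<^sub>R One)"
    and cont: "continuous_on Q u"
    and d1: "\<And>x b. x \<in> Q \<Longrightarrow> b \<in> Basis \<Longrightarrow> haspd b u (u1 b x) x"
    and d2: "\<And>x b. x \<in> Q \<Longrightarrow> b \<in> Basis \<Longrightarrow> haspd b (u1 b) (u2 b x) x"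
    and lap: "\<And>x. x \<in> Q \<Longrightarrow> (\<Sum>b\<in>Basis. u2 b x) = 0"
    and M: "\<And>x. x \<in> Q \<Longrightarrow> norm (u x) \<le> M"
    and t: "0 \<le> t" "t \<le> d"
  shows "norm (u (x0 + t *\<^sub>R e) - u (x0 - t *\<^sub>R e)) \<le> 2 * t * DIM('e) * M / d"
proof -
  define y where "y = u (x0 + t *\<^sub>R e) - u (x0 - t *\<^sub>R e)"
  have QI: "x + x0 \<in> Q" if "x \<in> cbox (- d *\<^sub>R One) (d *\<^sub>R One)" for x
    using that by (simp add: Q mem_box inner_add_left inner_diff_left)
  have QI': "x + x0 \<in> Q" if "x \<in> box (- d *\<^sub>R One) (d *\<^sub>R One)" for x
    using QI that box_subset_cbox by blast
  have bl: "bounded_linear (\<lambda>z. z \<bullet> y)" by (rule bounded_linear_inner_left)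
  have "(u (t *\<^sub>R e + x0) \<bullet> y) - (u (- t *\<^sub>R e + x0) \<bullet> y) \<le> 2 * t * DIM('e) * (M * norm y) / d"
  proof (rule reflection_bound_aux[OF d e, where u="\<lambda>x. u (x + x0) \<bullet> y"
        and ?u1.0="\<lambda>b x. u1 b (x + x0) \<bullet> y" and ?u2.0="\<lambda>b x. u2 b (x + x0) \<bullet> y"])
    show "continuous_on (cbox (- d *\<^sub>R One) (d *\<^sub>R One)) (\<lambda>x. u (x + x0) \<bullet> y)"
      by (intro continuous_intros continuous_on_compose2[OF cont]) (use QI in auto)
    show "haspd b (\<lambda>x. u (x + x0) \<bullet> y) (u1 b (x + x0) \<bullet> y) x"
      if "x \<in> box (- d *\<^sub>R One) (d *\<^sub>R One)" "b \<in> Basis" for x b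
      by (rule haspd_linear[OF bl haspd_translate[OF d1[OF QI'[OF that(1)] that(2)]]])
    show "haspd b (\<lambda>x. u1 b (x + x0) \<bullet> y) (u2 b (x + x0) \<bullet> y) x"
      if "x \<in> box (- d *\<^sub>R One) (d *\<^sub>R One)" "b \<in> Basis" for x b
      by (rule haspd_linear[OF bl haspd_translate[OF d2[OF QI'[OF that(1)] that(2)]]])
    show "(\<Sum>b\<in>Basis. u2 b (x + x0) \<bullet> y) = 0" if "x \<in> box (- d *\<^sub>R One) (d *\<^sub>R One)" for x
      using lap[OF QI'[OF that]] by (simp add: inner_sum_left[symmetric])
    show "\<bar>u (x + x0) \<bullet> y\<bar> \<le> M * norm y" if "x \<in> cbox (- d *\<^sub>R One) (d *\<^sub>R One)" for x
      using Cauchy_Schwarz_ineq2[of "u (x + x0)" y] M[OF QI[OF that]]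
      by (meson mult_right_mono norm_ge_zero order_trans)
  qed (use t in auto)
  moreover have "(u (t *\<^sub>R e + x0) \<bullet> y) - (u (- t *\<^sub>R e + x0) \<bullet> y) = norm y * norm y"
    by (simp add: y_def inner_diff_left[symmetric] add.commute norm_eq_sqrt_inner)
  ultimately have "norm y * norm y \<le> (2 * t * DIM('e) * M / d) * norm y"
    by (simp add: mult_ac)
  then show ?thesis
  proof (cases "norm y = 0")
    case True
    have "M \<ge> 0" using M[of x0] d by (force simp: Q mem_box inner_add_left inner_diff_left intro: order_trans[OF norm_ge_zero])
    then show ?thesis using True d t by (simp add: y_def)
  next
    case False
    then have "norm y > 0" by simp
    with \<open>norm y * norm y \<le> _\<close> have "norm y \<le> 2 * t * DIM('e) * M / d"
      by (rule mult_right_le_imp_le)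
    then show ?thesis by (simp add: y_def)
  qed
qed

section \<open>Functions with continuous partial derivatives\<close>

definition C1 :: "'e::euclidean_space set \<Rightarrow> ('e \<Rightarrow> 'b::euclidean_space) \<Rightarrow> bool" where
  "C1 S u \<longleftrightarrow> open S \<and> continuous_on S u \<and>
     (\<forall>b\<in>Basis. (\<forall>x\<in>S. haspd b u (pd b u x) x) \<and> continuous_on S (pd b u))"

lemma C1D:
  assumes "C1 S u"
  shows "open S" "continuous_on S u"
    "\<And>b x. b \<in> Basis \<Longrightarrow> x \<in> S \<Longrightarrow> haspd b u (pd b u x) x"
    "\<And>b. b \<in> Basis \<Longrightarrow> continuous_on S (pd b u)"
  using assms by (auto simp: C1_def)

lemma C1I:
  assumes "open S" "continuous_on S u"
    and d: "\<And>b x. b \<in> Basis \<Longrightarrow> x \<in> S \<Longrightarrow> haspd b u (u' b x) x"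
    and c: "\<And>b. b \<in> Basis \<Longrightarrow> continuous_on S (u' b)"
  shows "C1 S u"
proof -
  have pd: "pd b u x = u' b x" if "b \<in> Basis" "x \<in> S" for b x
    using haspd_pd[OF d[OF that]] .
  show ?thesis unfolding C1_def
    using assms pd by (metis (no_types, lifting) continuous_on_cong)
qed

text \<open>True even where no derivative exists: both functions have the same derivatives along the
  line, so the choice inside \<open>vector_derivative\<close> returns the same vector.\<close>

lemma pd_cong_open:
  assumes "open S" "x \<in> S" "\<And>y. y \<in> S \<Longrightarrow> u y = w y"
  shows "pd b u x = pd b w x"
proof -
  have "haspd b u d x \<longleftrightarrow> haspd b w d x" for d
    using haspd_cong_open[OF assms(1,2), of u w] haspd_cong_open[OF assms(1,2), of w u] assms(3)
    by metis
  then show ?thesis unfolding pd_def vector_derivative_def haspd_def by simp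
qed

lemma C1_cong:
  assumes "C1 S u" "\<And>y. y \<in> S \<Longrightarrow> u y = w y"
  shows "C1 S w"
proof (rule C1I[where u'="\<lambda>b. pd b u"])
  show "continuous_on S w" using C1D(2)[OF assms(1)] assms(2) by (metis continuous_on_cong)
  show "haspd b w (pd b u x) x" if "b \<in> Basis" "x \<in> S" for b x
    using haspd_cong_open[OF C1D(1)[OF assms(1)] that(2) assms(2) C1D(3)[OF assms(1) that]] by simp
qed (use C1D[OF assms(1)] in auto)

lemma C1_subset: "C1 S u \<Longrightarrow> open T \<Longrightarrow> T \<subseteq> S \<Longrightarrow> C1 T u"
  unfolding C1_def by (meson continuous_on_subset subsetD)

lemma C1_add:
  assumes "C1 S u" "C1 S w"
  shows "C1 S (\<lambda>x. u x + w x)"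
  by (rule C1I[where u'="\<lambda>b x. pd b u x + pd b w x"])
     (use C1D[OF assms(1)] C1D[OF assms(2)] in \<open>auto intro: continuous_on_add haspd_add\<close>)

lemma C1_linear:
  assumes "bounded_linear L" "C1 S u"
  shows "C1 S (\<lambda>x. L (u x))"
  by (rule C1I[where u'="\<lambda>b x. L (pd b u x)"])
     (use C1D[OF assms(2)] assms(1) in \<open>auto intro: bounded_linear.continuous_on haspd_linear\<close>)

lemma pd_add: "C1 S u \<Longrightarrow> C1 S w \<Longrightarrow> b \<in> Basis \<Longrightarrow> x \<in> S \<Longrightarrow>
    pd b (\<lambda>x. u x + w x) x = pd b u x + pd b w x"
  by (rule haspd_pd) (auto intro: haspd_add C1D)

lemma pd_linear: "bounded_linear L \<Longrightarrow> C1 S u \<Longrightarrow> b \<in> Basis \<Longrightarrow> x \<in> S \<Longrightarrow>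
    pd b (\<lambda>x. L (u x)) x = L (pd b u x)"
  by (rule haspd_pd) (auto intro: haspd_linear C1D)

lemma C1_translate:
  assumes "C1 S u" "open T" "\<And>x. x \<in> T \<Longrightarrow> x + a \<in> S"
  shows "C1 T (\<lambda>x. u (x + a))"
proof (rule C1I[where u'="\<lambda>b x. pd b u (x + a)"])
  show "continuous_on T (\<lambda>x. u (x + a))"
    by (intro continuous_on_compose2[OF C1D(2)[OF assms(1)]] continuous_intros) (use assms in auto)
  show "continuous_on T (\<lambda>x. pd b u (x + a))" if "b \<in> Basis" for b
    by (intro continuous_on_compose2[OF C1D(4)[OF assms(1)]] continuous_intros) (use assms that in auto)
qed (use assms in \<open>auto intro!: haspd_translate C1D\<close>)

lemma pd_translate: "C1 S u \<Longrightarrow> b \<in> Basis \<Longrightarrow> x + a \<in> S \<Longrightarrow>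
    pd b (\<lambda>x. u (x + a)) x = pd b u (x + a)"
  by (rule haspd_pd) (auto intro: haspd_translate C1D)

lemma pd_const [simp]: "pd b (\<lambda>_. c) x = 0"
  by (rule haspd_pd) (simp add: haspd_def)

lemma haspd_integral:
  fixes f :: "'e::euclidean_space \<Rightarrow> real \<Rightarrow> 'b::euclidean_space"
  assumes T: "open T" and x: "x \<in> T"
    and d: "\<And>x t. x \<in> T \<Longrightarrow> t \<in> {0..1} \<Longrightarrow> haspd b (\<lambda>x. f x t) (f' x t) x"
    and c: "continuous_on (T \<times> {0..1}) (\<lambda>(x, t). f x t)"
    and c': "continuous_on (T \<times> {0..1}) (\<lambda>(x, t). f' x t)"
  shows "haspd b (\<lambda>x. integral (cbox 0 1) (f x)) (integral (cbox 0 1) (f' x)) x"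
proof -
  from eventually_line_open[OF T x, of b]
  obtain \<delta> where \<delta>: "\<delta> > 0" "\<And>s. \<bar>s\<bar> < \<delta> \<Longrightarrow> x + s *\<^sub>R b \<in> T"
    by (auto simp: eventually_nhds_metric dist_real_def)
  let ?U = "ball (0::real) \<delta>"
  have inT: "x + s *\<^sub>R b \<in> T" if "s \<in> ?U" for s
    using that \<delta>(2)[of s] by (auto simp: dist_real_def)
  have "((\<lambda>s. integral (cbox 0 1) (f (x + s *\<^sub>R b))) has_vector_derivative
        integral (cbox 0 1) (f' (x + 0 *\<^sub>R b))) (at 0 within ?U)"
  proof (rule leibniz_rule_vector_derivative)
    fix s t assume st: "s \<in> ?U" "t \<in> cbox (0::real) 1"
    from haspd_shift[OF d[OF inT[OF st(1)]], of t] st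
    show "((\<lambda>s. f (x + s *\<^sub>R b) t) has_vector_derivative f' (x + s *\<^sub>R b) t) (at s within ?U)"
      by (simp add: has_vector_derivative_at_within)
  next
    fix s assume "s \<in> ?U"
    then show "f (x + s *\<^sub>R b) integrable_on cbox 0 1"
      using inT
      by (intro integrable_continuous continuous_on_compose2[OF c, where f="\<lambda>t. (x + s *\<^sub>R b, t)", simplified] continuous_intros) auto
  next
    have "continuous_on (?U \<times> cbox 0 1) (\<lambda>z. case (x + fst z *\<^sub>R b, snd z) of (x, t) \<Rightarrow> f' x t)"
      by (intro continuous_on_compose2[OF c'] continuous_intros) (use inT in auto)
    then show "continuous_on (?U \<times> cbox 0 1) (\<lambda>(s, t). f' (x + s *\<^sub>R b) t)"
      by (simp add: split_beta)
  qed (use \<delta> in auto)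
  then show ?thesis unfolding haspd_def using \<delta>(1)
    by (simp add: at_within_open[of 0 ?U])
qed

subsection \<open>Averages over segments\<close>

text \<open>Mean over the segment from x to x + a. Along a coordinate axis it commutes with
  constant-coefficient operators and gains one derivative in the direction of that axis.\<close>

definition avg :: "'e::euclidean_space \<Rightarrow> ('e \<Rightarrow> 'b::euclidean_space) \<Rightarrow> 'e \<Rightarrow> 'b" where
  "avg a u x = integral (cbox 0 1) (\<lambda>t::real. u (x + t *\<^sub>R a))"

lemma avg_integrable:
  fixes u :: "'e::euclidean_space \<Rightarrow> 'b::euclidean_space"
  assumes "continuous_on S u" "\<And>t. t \<in> {0..1} \<Longrightarrow> x + t *\<^sub>R a \<in> S"
  shows "(\<lambda>t::real. u (x + t *\<^sub>R a)) integrable_on cbox 0 1"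
  by (intro integrable_continuous continuous_on_compose2[OF assms(1)] continuous_intros)
     (use assms(2) in auto)

lemma avg_continuous_on:
  assumes "continuous_on S u" "\<And>x t. x \<in> T \<Longrightarrow> t \<in> {0..1} \<Longrightarrow> x + t *\<^sub>R a \<in> S"
  shows "continuous_on T (avg a u)"
  unfolding avg_def
  by (rule integral_continuous_on_param)
     (auto simp: split_beta intro!: continuous_on_compose2[OF assms(1)] continuous_intros assms(2))

lemma avg_haspd:
  assumes u: "C1 S u" and T: "open T" "\<And>x t. x \<in> T \<Longrightarrow> t \<in> {0..1} \<Longrightarrow> x + t *\<^sub>R a \<in> S"
    and b: "b \<in> Basis" and x: "x \<in> T"
  shows "haspd b (avg a u) (avg a (pd b u) x) x"
  unfolding avg_def
proof (rule haspd_integral[OF T(1) x])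
  show "haspd b (\<lambda>x. u (x + t *\<^sub>R a)) (pd b u (x + t *\<^sub>R a)) x" if "x \<in> T" "t \<in> {0..1}" for x t
    by (intro haspd_translate C1D(3)[OF u b] T(2) that)
  have "continuous_on (T \<times> {0..1}) (\<lambda>(x, t). g (x + t *\<^sub>R a))" if "continuous_on S g" for g :: "'a \<Rightarrow> 'b"
    unfolding split_beta by (intro continuous_on_compose2[OF that] continuous_intros) (use T(2) in auto)
  from this[OF C1D(2)[OF u]] this[OF C1D(4)[OF u b]]
  show "continuous_on (T \<times> {0..1}) (\<lambda>(x, t). u (x + t *\<^sub>R a))"
    "continuous_on (T \<times> {0..1}) (\<lambda>(x, t). pd b u (x + t *\<^sub>R a))" .
qed

lemma avg_C1:
  assumes u: "C1 S u" and T: "open T" "\<And>x t. x \<in> T \<Longrightarrow> t \<in> {0..1} \<Longrightarrow> x + t *\<^sub>R a \<in> S"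
  shows "C1 T (avg a u)"
proof (rule C1I[where u'="\<lambda>b. avg a (pd b u)"])
  show "continuous_on T (avg a u)" by (rule avg_continuous_on[OF C1D(2)[OF u] T(2)])
  show "continuous_on T (avg a (pd b u))" if "b \<in> Basis" for b
    by (rule avg_continuous_on[OF C1D(4)[OF u that] T(2)])
qed (rule T(1), rule avg_haspd[OF assms])

lemma avg_pd:
  assumes u: "C1 S u" and T: "open T" "\<And>x t. x \<in> T \<Longrightarrow> t \<in> {0..1} \<Longrightarrow> x + t *\<^sub>R a \<in> S"
    and b: "b \<in> Basis" and x: "x \<in> T"
  shows "pd b (avg a u) x = avg a (pd b u) x"
  by (rule haspd_pd[OF avg_haspd[OF assms]])

text \<open>The source of the gained derivative: by the fundamental theorem of calculus, averaging a
  derivative along its own axis gives a difference quotient, which is as regular as u.\<close>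

lemma avg_same_direction:
  assumes u: "C1 S u" and b: "b \<in> Basis" and h: "h \<noteq> 0"
    and seg: "\<And>t. t \<in> {0..1} \<Longrightarrow> x + t *\<^sub>R (h *\<^sub>R b) \<in> S"
  shows "avg (h *\<^sub>R b) (pd b u) x = (1 / h) *\<^sub>R (u (x + h *\<^sub>R b) - u x)"
proof -
  have "((\<lambda>t. h *\<^sub>R pd b u (x + t *\<^sub>R (h *\<^sub>R b))) has_integral
      (u (x + 1 *\<^sub>R (h *\<^sub>R b)) - u (x + 0 *\<^sub>R (h *\<^sub>R b)))) {0..1}"
  proof (rule fundamental_theorem_of_calculus)
    fix t :: real assume t: "t \<in> {0..1}"
    have "haspd b u (pd b u (x + (t * h) *\<^sub>R b)) (x + (t * h) *\<^sub>R b)"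
      using seg[OF t] by (intro C1D(3)[OF u b]) simp
    from haspd_shift[OF this]
    have "((\<lambda>s. u (x + s *\<^sub>R b)) \<circ> (\<lambda>t. t * h) has_vector_derivative h *\<^sub>R pd b u (x + (t * h) *\<^sub>R b)) (at t)"
      by (intro vector_diff_chain_at) (auto intro!: derivative_eq_intros)
    then show "((\<lambda>t. u (x + t *\<^sub>R (h *\<^sub>R b))) has_vector_derivative h *\<^sub>R pd b u (x + t *\<^sub>R (h *\<^sub>R b))) (at t within {0..1})"
      by (simp add: o_def has_vector_derivative_at_within)
  qed simp
  then have "((\<lambda>t. (1/h) *\<^sub>R (h *\<^sub>R pd b u (x + t *\<^sub>R (h *\<^sub>R b)))) has_integral
      (1/h) *\<^sub>R (u (x + 1 *\<^sub>R (h *\<^sub>R b)) - u (x + 0 *\<^sub>R (h *\<^sub>R b)))) {0..1}"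
    by (rule has_integral_cmul)
  then show ?thesis unfolding avg_def using h by (simp add: integral_unique)
qed

lemma avg_close:
  assumes "continuous_on S u" and seg: "\<And>t. t \<in> {0..1} \<Longrightarrow> x + t *\<^sub>R a \<in> S"
    and cl: "\<And>t. t \<in> {0..1} \<Longrightarrow> norm (u (x + t *\<^sub>R a) - u x) \<le> \<epsilon>"
  shows "norm (avg a u x - u x) \<le> \<epsilon>"
proof -
  have "((\<lambda>t. u (x + t *\<^sub>R a)) has_integral avg a u x) (cbox 0 1)"
    unfolding avg_def using avg_integrable[OF assms(1) seg] by (simp add: integrable_integral)
  then have "((\<lambda>t. u (x + t *\<^sub>R a) - u x) has_integral (avg a u x - u x)) (cbox 0 1)"
    using has_integral_const_real[of "u x" 0 1] by (intro has_integral_diff) auto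
  then have "norm (avg a u x - u x) \<le> \<epsilon> * measure lborel (cbox 0 (1::real))"
    by (rule has_integral_bound[rotated]) (use cl cl[of 0] in \<open>auto intro: order_trans[OF norm_ge_zero]\<close>)
  then show ?thesis by simp
qed

text \<open>Uniform continuity in which the second point may leave K. It comes from the compact sum
  of K and a small closed ball.\<close>

lemma continuous_on_compact_nbhd:
  fixes u :: "'e::euclidean_space \<Rightarrow> 'b::metric_space"
  assumes "compact K" "open S" "K \<subseteq> S" "continuous_on S u" "\<epsilon> > 0"
  obtains \<delta> where "\<delta> > 0" "\<And>x y. x \<in> K \<Longrightarrow> dist y x < \<delta> \<Longrightarrow> y \<in> S"
    "\<And>x y. x \<in> K \<Longrightarrow> dist y x < \<delta> \<Longrightarrow> dist (u y) (u x) < \<epsilon>"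
proof -
  obtain e where e: "e > 0" "(\<Union>x\<in>K. cball x e) \<subseteq> S"
    using compact_subset_open_imp_cball_epsilon_subset[OF assms(1-3)] by blast
  define K' where "K' = {x + y |x y. x \<in> K \<and> y \<in> cball 0 e}"
  have eq: "(\<Union>x\<in>K. cball x e) = K'"
  proof (intro equalityI subsetI)
    fix y assume "y \<in> (\<Union>x\<in>K. cball x e)"
    then obtain x where "x \<in> K" "y \<in> cball x e" by blast
    then show "y \<in> K'" unfolding K'_def
      by (intro CollectI exI[of _ x] exI[of _ "y - x"]) (auto simp: dist_norm norm_minus_commute)
  next
    fix y assume "y \<in> K'"
    then obtain a b where "y = a + b" "a \<in> K" "b \<in> cball 0 e" unfolding K'_def by blast
    then show "y \<in> (\<Union>x\<in>K. cball x e)" by (intro UN_I[of a]) (auto simp: dist_norm)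
  qed
  have "compact K'" unfolding K'_def using assms(1) by (intro compact_sums compact_cball)
  moreover have K': "K' \<subseteq> S" using e(2) eq by simp
  ultimately have "uniformly_continuous_on K' u"
    using compact_uniformly_continuous continuous_on_subset[OF assms(4)] by blast
  from uniformly_continuous_onE[OF this \<open>\<epsilon> > 0\<close>]
  obtain d where d: "d > 0" "\<And>x y. x \<in> K' \<Longrightarrow> y \<in> K' \<Longrightarrow> dist y x < d \<Longrightarrow> dist (u y) (u x) < \<epsilon>"
    by metis
  show ?thesis
  proof (rule that[of "min d e"])
    have in': "y \<in> K'" if "x \<in> K" "dist y x < min d e" for x y
      unfolding eq[symmetric] using that by (auto simp: dist_commute intro!: bexI[of _ x])
    show "y \<in> S" if "x \<in> K" "dist y x < min d e" for x y using in'[OF that] K' by auto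
    show "dist (u y) (u x) < \<epsilon>" if "x \<in> K" "dist y x < min d e" for x y
      using that in'[OF that] in'[OF that(1), of x] d(1) e(1) by (intro d(2)) auto
  qed (use d(1) e(1) in auto)
qed

text \<open>The difference quotient of \<open>pd a u\<close> along b is the average of
  \<open>pd a (pd b u)\<close> over a short segment. By continuity it tends to the value at x, and
  by definition to \<open>pd b (pd a u) x\<close>.\<close>

lemma pd_commute:
  assumes u: "C1 S u" and ua: "C1 S (pd a u)" and ub: "C1 S (pd b u)"
    and a: "a \<in> Basis" and b: "b \<in> Basis" and x: "x \<in> S"
  shows "pd a (pd b u) x = pd b (pd a u) x"
proof -
  let ?w = "pd a (pd b u)"
  have "((\<lambda>h. (1 / h) *\<^sub>R (pd a u (x + h *\<^sub>R b) - pd a u x)) \<longlongrightarrow> ?w x) (at 0)"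
  proof (rule tendstoI)
    fix \<epsilon> :: real assume "\<epsilon> > 0"
    then have "\<epsilon> / 2 > 0" by simp
    obtain \<delta> where \<delta>: "\<delta> > 0" "\<And>y. dist y x < \<delta> \<Longrightarrow> y \<in> S" "\<And>y. dist y x < \<delta> \<Longrightarrow> dist (?w y) (?w x) < \<epsilon>/2"
      by (rule continuous_on_compact_nbhd[of "{x}", OF _ C1D(1)[OF u] _ C1D(4)[OF ub a] \<open>\<epsilon> / 2 > 0\<close>])
         (use x in simp_all)
    define T where "T = ball x (\<delta>/2)"
    have "dist ((1 / h) *\<^sub>R (pd a u (x + h *\<^sub>R b) - pd a u x)) (?w x) < \<epsilon>"
      if h: "h \<noteq> 0" "\<bar>h\<bar> < \<delta>/2" for h
    proof -
      have st: "dist (y + t *\<^sub>R (h *\<^sub>R b)) x < \<delta>" if "y \<in> T" "t \<in> {0..1}" for y t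
      proof -
        have "dist (y + t *\<^sub>R (h *\<^sub>R b)) x \<le> dist y x + norm (t *\<^sub>R (h *\<^sub>R b))"
          using norm_triangle_ineq[of "y - x" "t *\<^sub>R (h *\<^sub>R b)"] by (simp add: dist_norm algebra_simps)
        also have "norm (t *\<^sub>R (h *\<^sub>R b)) \<le> 1 * \<bar>h\<bar>" using that b by (auto simp: mult_left_le_one_le abs_mult)
        also have "dist y x < \<delta>/2" using that by (simp add: T_def dist_commute)
        finally show ?thesis using h by simp
      qed
      have TS: "y + t *\<^sub>R (h *\<^sub>R b) \<in> S" if "y \<in> T" "t \<in> {0..1}" for y t
        using st[OF that] \<delta>(2) by auto
      have TS': "y + h *\<^sub>R b \<in> S" if "y \<in> T" for y using TS[OF that, of 1] by simp
      have T: "open T" "x \<in> T" using \<delta>(1) by (auto simp: T_def)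
      have TsS: "T \<subseteq> S" using TS[of _ 0] by auto
      have "haspd a (\<lambda>y. (1 / h) *\<^sub>R (u (y + h *\<^sub>R b) - u y)) ((1/h) *\<^sub>R (pd a u (x + h *\<^sub>R b) - pd a u x)) x"
        by (intro haspd_linear[OF bounded_linear_scaleR_right] haspd_diff haspd_translate C1D(3)[OF u a] x TS' T)
      then have "haspd a (avg (h *\<^sub>R b) (pd b u)) ((1/h) *\<^sub>R (pd a u (x + h *\<^sub>R b) - pd a u x)) x"
        by (rule haspd_cong_open[OF T, rotated]) (use avg_same_direction[OF u b h(1)] TS in auto)
      then have "(1/h) *\<^sub>R (pd a u (x + h *\<^sub>R b) - pd a u x) = avg (h *\<^sub>R b) ?w x"
        using haspd_pd avg_pd[OF ub T(1) TS a T(2)] by metis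
      moreover have "norm (avg (h *\<^sub>R b) ?w x - ?w x) \<le> \<epsilon>/2"
      proof (rule avg_close[OF C1D(4)[OF ub a]])
        show "norm (?w (x + t *\<^sub>R (h *\<^sub>R b)) - ?w x) \<le> \<epsilon>/2" if "t \<in> {0..1}" for t
          using \<delta>(3)[OF st[OF T(2) that]] by (simp add: dist_norm)
      qed (use TS T in auto)
      ultimately show ?thesis using \<open>\<epsilon> > 0\<close> by (simp add: dist_norm)
    qed
    then show "\<forall>\<^sub>F h in at 0. dist ((1 / h) *\<^sub>R (pd a u (x + h *\<^sub>R b) - pd a u x)) (?w x) < \<epsilon>"
      unfolding eventually_at using \<delta>(1) by (intro exI[of _ "\<delta>/2"]) auto
  qed
  moreover have "((\<lambda>h. (1 / h) *\<^sub>R (pd a u (x + h *\<^sub>R b) - pd a u x)) \<longlongrightarrow> pd b (pd a u) x) (at 0)"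
    by (rule haspd_quotient[OF C1D(3)[OF ua b x]])
  ultimately show ?thesis using tendsto_unique[OF trivial_limit_at] by blast
qed

section \<open>Regularity for Dirac systems\<close>

lemma mem_cube:
  fixes x :: "'e::euclidean_space"
  shows "y \<in> cbox (x - d *\<^sub>R One) (x + d *\<^sub>R One) \<longleftrightarrow> (\<forall>b\<in>Basis. \<bar>(y - x) \<bullet> b\<bar> \<le> d)"
  by (auto simp: mem_box inner_diff_left inner_add_left abs_le_iff algebra_simps)

lemma mem_open_cube:
  fixes x :: "'e::euclidean_space"
  shows "y \<in> box (x - d *\<^sub>R One) (x + d *\<^sub>R One) \<longleftrightarrow> (\<forall>b\<in>Basis. \<bar>(y - x) \<bullet> b\<bar> < d)"
  by (auto simp: mem_box inner_diff_left inner_add_left abs_less_iff algebra_simps)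

lemma open_contains_cube:
  fixes x :: "'e::euclidean_space"
  assumes "open S" "x \<in> S"
  obtains d where "d > 0" "cbox (x - d *\<^sub>R One) (x + d *\<^sub>R One) \<subseteq> S"
proof -
  obtain e where e: "e > 0" "ball x e \<subseteq> S" using assms open_contains_ball by blast
  define d where "d = e / (2 * DIM('e))"
  have d: "d > 0" using e(1) by (simp add: d_def)
  have "y \<in> ball x e" if "\<forall>b\<in>Basis. \<bar>(y - x) \<bullet> b\<bar> \<le> d" for y
  proof -
    have "norm (y - x) \<le> (\<Sum>b\<in>Basis. \<bar>(y - x) \<bullet> b\<bar>)" by (rule norm_le_l1)
    also have "\<dots> \<le> (\<Sum>b\<in>(Basis::'e set). d)" using that by (intro sum_mono) auto
    also have "\<dots> < e" using e(1) by (simp add: d_def)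
    finally show ?thesis by (simp add: dist_norm norm_minus_commute)
  qed
  then show ?thesis using that[of d] d e(2) mem_cube[of _ x d] by blast
qed

lemma haspd_sum:
  "(\<And>i. i \<in> I \<Longrightarrow> haspd b (u i) (d i) x) \<Longrightarrow> haspd b (\<lambda>x. \<Sum>i\<in>I. u i x) (\<Sum>i\<in>I. d i) x"
  unfolding haspd_def by (rule has_vector_derivative_sum)

text \<open>Twice the double sum is a sum of anticommutators, and symmetry of H makes the mixed ones
  cancel. Every factorization of a Laplacian or a square below is an instance of this.\<close>

lemma clifford_sum:
  fixes H :: "nat \<Rightarrow> nat \<Rightarrow> 'b::real_vector"
  assumes same: "\<And>i. i \<in> I \<Longrightarrow> P i i (H i i) = H i i"
    and anti: "\<And>i j. i \<in> I \<Longrightarrow> j \<in> I \<Longrightarrow> i \<noteq> j \<Longrightarrow> P i j (H i j) + P j i (H i j) = 0"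
    and sym: "\<And>i j. i \<in> I \<Longrightarrow> j \<in> I \<Longrightarrow> H i j = H j i"
    and fin: "finite I"
  shows "(\<Sum>i\<in>I. \<Sum>j\<in>I. P i j (H i j)) = (\<Sum>i\<in>I. H i i)"
proof -
  have "2 *\<^sub>R (\<Sum>i\<in>I. \<Sum>j\<in>I. P i j (H i j)) =
      (\<Sum>i\<in>I. \<Sum>j\<in>I. P i j (H i j)) + (\<Sum>i\<in>I. \<Sum>j\<in>I. P j i (H j i))"
    using sum.swap[of "\<lambda>i j. P i j (H i j)" I I] by (simp add: scaleR_2)
  also have "\<dots> = (\<Sum>i\<in>I. \<Sum>j\<in>I. P i j (H i j) + P j i (H j i))"
    by (simp add: sum.distrib)
  also have "\<dots> = (\<Sum>i\<in>I. \<Sum>j\<in>I. if i = j then 2 *\<^sub>R H i i else 0)"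
  proof (intro sum.cong refl)
    fix i j assume ij: "i \<in> I" "j \<in> I"
    show "P i j (H i j) + P j i (H j i) = (if i = j then 2 *\<^sub>R H i i else 0)"
      using same[OF ij(1)] anti[OF ij] sym[OF ij] by (auto simp: scaleR_2)
  qed
  also have "\<dots> = 2 *\<^sub>R (\<Sum>i\<in>I. H i i)" using fin by (simp add: scaleR_right.sum)
  finally show ?thesis by simp
qed

text \<open>Coefficients are linear operators rather than algebra elements, so that associativity
  plays no part. The maps \<open>Eb\<close> are the coefficients of the conjugate system; the last
  two assumptions say that conjugate times original is the Laplacian in the directions
  \<open>e i\<close>.\<close>

locale dirac =
  fixes n :: nat and e :: "nat \<Rightarrow> 'e::euclidean_space"
    and E Eb :: "nat \<Rightarrow> 'b::euclidean_space \<Rightarrow> 'b"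
  assumes inj: "inj_on e {..<n}" and eB: "\<And>i. i < n \<Longrightarrow> e i \<in> Basis"
    and linE: "\<And>i. linear (E i)" and linEb: "\<And>i. linear (Eb i)"
    and cl_same: "\<And>i w. i < n \<Longrightarrow> Eb i (E i w) = w"
    and cl_anti: "\<And>i j w. i < n \<Longrightarrow> j < n \<Longrightarrow> i \<noteq> j \<Longrightarrow> Eb i (E j w) + Eb j (E i w) = 0"
begin

text \<open>The last clause removes the surplus axes, so that the sum of second derivatives over the
  whole basis equals the sum over the directions \<open>e i\<close>.\<close>

definition mono_on :: "'e set \<Rightarrow> ('e \<Rightarrow> 'b) \<Rightarrow> bool" where
  "mono_on S u \<longleftrightarrow> C1 S u \<and> (\<forall>x\<in>S. (\<Sum>i<n. E i (pd (e i) u x)) = 0) \<and>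
     (\<forall>x\<in>S. \<forall>b\<in>Basis - e ` {..<n}. pd b u x = 0)"

lemma blE: "bounded_linear (E i)" and blEb: "bounded_linear (Eb i)"
  using linE linEb linear_conv_bounded_linear by blast+

lemma mono_onD:
  assumes "mono_on S u"
  shows "C1 S u" "\<And>x. x \<in> S \<Longrightarrow> (\<Sum>i<n. E i (pd (e i) u x)) = 0"
    "\<And>x b. x \<in> S \<Longrightarrow> b \<in> Basis \<Longrightarrow> b \<notin> e ` {..<n} \<Longrightarrow> pd b u x = 0"
  using assms by (auto simp: mono_on_def)

text \<open>Differentiate the equation along \<open>e j\<close>, apply \<open>Eb j\<close> and sum
  over j. The required regularity of the first partials is not known for a general solution; it is
  obtained by smoothing.\<close>

lemma mono_on_harmonic:
  assumes u: "mono_on S u" and u2: "\<And>b. b \<in> Basis \<Longrightarrow> C1 S (pd b u)" and x: "x \<in> S"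
  shows "(\<Sum>b\<in>Basis. pd b (pd b u) x) = 0"
proof -
  note C = mono_onD(1)[OF u]
  define H where "H = (\<lambda>i j. pd (e i) (pd (e j) u) x)"
  have sym: "H i j = H j i" if "i < n" "j < n" for i j
    unfolding H_def by (rule pd_commute[OF C u2 u2 _ _ x]) (use eB that in auto)
  have z: "(\<Sum>i<n. E i (H j i)) = 0" if j: "j < n" for j
  proof -
    have "haspd (e j) (\<lambda>x. \<Sum>i<n. E i (pd (e i) u x)) (\<Sum>i<n. E i (H j i)) x"
      unfolding H_def using eB j x
      by (intro haspd_sum haspd_linear[OF blE] C1D(3)[OF u2]) auto
    then have "haspd (e j) (\<lambda>x. 0) (\<Sum>i<n. E i (H j i)) x"
      by (rule haspd_cong_open[OF C1D(1)[OF C] x, rotated]) (use mono_onD(2)[OF u] in auto)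
    from haspd_pd[OF this] show ?thesis by simp
  qed
  have "0 = (\<Sum>j<n. Eb j (\<Sum>i<n. E i (H j i)))"
    using z linear_0[OF linEb] by simp
  also have "\<dots> = (\<Sum>j<n. \<Sum>i<n. Eb j (E i (H j i)))"
    by (simp add: linear_sum[OF linEb])
  also have "\<dots> = (\<Sum>j<n. H j j)"
    by (rule clifford_sum[where P="\<lambda>j i w. Eb j (E i w)"]) (use cl_same cl_anti sym in auto)
  finally have "(\<Sum>j<n. H j j) = 0" by simp
  moreover have "(\<Sum>b\<in>Basis. pd b (pd b u) x) = (\<Sum>b\<in>e ` {..<n}. pd b (pd b u) x)"
  proof (rule sum.mono_neutral_right)
    show "\<forall>b\<in>Basis - e ` {..<n}. pd b (pd b u) x = 0"
    proof
      fix b assume b: "b \<in> Basis - e ` {..<n}"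
      have "pd b (pd b u) x = pd b (\<lambda>_. 0) x"
        by (rule pd_cong_open[OF C1D(1)[OF C] x]) (use mono_onD(3)[OF u] b in auto)
      then show "pd b (pd b u) x = 0" by simp
    qed
  qed (use eB in auto)
  moreover have "(\<Sum>b\<in>e ` {..<n}. pd b (pd b u) x) = (\<Sum>j<n. H j j)"
    by (simp add: sum.reindex[OF inj] H_def)
  ultimately show ?thesis by simp
qed

section \<open>Smoothing solutions by averages\<close>

lemma mono_on_avg:
  assumes u: "mono_on S u" and T: "open T" "\<And>x t. x \<in> T \<Longrightarrow> t \<in> {0..1} \<Longrightarrow> x + t *\<^sub>R a \<in> S"
  shows "mono_on T (avg a u)"
proof -
  note C = mono_onD(1)[OF u]
  have 1: "(\<Sum>i<n. E i (pd (e i) (avg a u) x)) = 0" if x: "x \<in> T" for x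
  proof -
    have int: "(\<lambda>t. pd (e i) u (x + t *\<^sub>R a)) integrable_on cbox 0 1" if "i < n" for i
      using T(2)[OF x] eB[OF that] by (intro avg_integrable[OF C1D(4)[OF C]]) auto
    have "E i (pd (e i) (avg a u) x) = integral (cbox 0 1) (\<lambda>t. E i (pd (e i) u (x + t *\<^sub>R a)))"
      if "i < n" for i
      using avg_pd[OF C T eB[OF that] x] integral_linear[OF int[OF that] blE[of i]]
      by (simp add: avg_def o_def)
    then have "(\<Sum>i<n. E i (pd (e i) (avg a u) x)) =
        (\<Sum>i<n. integral (cbox 0 1) (\<lambda>t. E i (pd (e i) u (x + t *\<^sub>R a))))" by simp
    also have "\<dots> = integral (cbox 0 1) (\<lambda>t. \<Sum>i<n. E i (pd (e i) u (x + t *\<^sub>R a)))"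
      using integrable_linear[OF int blE] by (intro integral_sum[symmetric]) (auto simp: o_def)
    also have "\<dots> = integral (cbox 0 1) (\<lambda>t::real. 0)"
      by (rule integral_cong) (use mono_onD(2)[OF u T(2)[OF x]] in auto)
    finally show ?thesis by simp
  qed
  have 2: "pd b (avg a u) x = 0" if x: "x \<in> T" and b: "b \<in> Basis - e ` {..<n}" for x b
  proof -
    have "pd b (avg a u) x = integral (cbox 0 1) (\<lambda>t. pd b u (x + t *\<^sub>R a))"
      using avg_pd[OF C T _ x] b by (simp add: avg_def)
    also have "\<dots> = integral (cbox 0 1) (\<lambda>t::real. 0)"
      by (rule integral_cong) (use mono_onD(3)[OF u T(2)[OF x]] b in auto)
    finally show ?thesis by simp
  qed
  show ?thesis unfolding mono_on_def using 1 2 avg_C1[OF C T] by blast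
qed

text \<open>One short average per axis in B. With B the full basis, the approximation has
  continuously differentiable first partials, hence is harmonic, while its distance to u on K stays
  controlled.\<close>

lemma mono_on_approx:
  assumes "finite B" "B \<subseteq> Basis" "compact K" "K \<subseteq> S" "mono_on S u" "\<epsilon> > 0"
  shows "\<exists>S' u'. K \<subseteq> S' \<and> mono_on S' u' \<and> (\<forall>b\<in>B. C1 S' (pd b u')) \<and> (\<forall>x\<in>K. norm (u' x - u x) \<le> \<epsilon>)"
  using assms(1,2,6)
proof (induction B arbitrary: \<epsilon> rule: finite_induct)
  case empty
  then show ?case using assms(4,5) by (intro exI[of _ S] exI[of _ u]) auto
next
  case (insert b B)
  then obtain S' u' where IH: "K \<subseteq> S'" "mono_on S' u'" "\<And>b. b \<in> B \<Longrightarrow> C1 S' (pd b u')"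
      "\<And>x. x \<in> K \<Longrightarrow> norm (u' x - u x) \<le> \<epsilon>/2"
    using insert.IH[of "\<epsilon>/2"] by auto
  have bB: "b \<in> Basis" and BB: "B \<subseteq> Basis" using insert.prems by auto
  note C = mono_onD(1)[OF IH(2)]
  have "\<epsilon> / 2 > 0" using insert.prems by simp
  then obtain \<delta> where \<delta>: "\<delta> > 0" "\<And>x y. x \<in> K \<Longrightarrow> dist y x < \<delta> \<Longrightarrow> y \<in> S'"
    "\<And>x y. x \<in> K \<Longrightarrow> dist y x < \<delta> \<Longrightarrow> dist (u' y) (u' x) < \<epsilon>/2"
    using continuous_on_compact_nbhd[OF assms(3) C1D(1)[OF C] IH(1) C1D(2)[OF C]] by metis
  define T where "T = (\<Union>x\<in>K. ball x (\<delta>/2))"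
  \<comment> \<open>Points of T are within \<delta>/2 of K, so segments of length \<delta>/4
    starting there remain in the \<delta>-neighbourhood where u' is controlled.\<close>
  define h where "h = \<delta> / 4"
  define w where "w = avg (h *\<^sub>R b) u'"
  have T: "open T" by (auto simp: T_def)
  have KT: "K \<subseteq> T" using \<delta>(1) by (auto simp: T_def)
  have seg: "\<exists>z\<in>K. dist (x + t *\<^sub>R (h *\<^sub>R b)) z < \<delta>" if xT: "x \<in> T" and t: "t \<in> {0..1}" for x t
  proof -
    obtain z where z: "z \<in> K" "x \<in> ball z (\<delta>/2)" using xT unfolding T_def by blast
    then have z: "z \<in> K" "dist x z < \<delta>/2" by (auto simp: dist_commute)
    have "dist (x + t *\<^sub>R (h *\<^sub>R b)) z \<le> dist x z + norm (t *\<^sub>R (h *\<^sub>R b))"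
      using norm_triangle_ineq[of "x - z" "t *\<^sub>R (h *\<^sub>R b)"] by (simp add: dist_norm algebra_simps)
    also have "norm (t *\<^sub>R (h *\<^sub>R b)) = t * h" using t bB \<delta>(1) by (simp add: h_def)
    also have "\<dots> \<le> h" using t \<delta>(1) by (auto simp: h_def mult_left_le_one_le)
    finally show ?thesis using z \<delta>(1) by (intro bexI[of _ z]) (auto simp: h_def)
  qed
  then have TS: "x + t *\<^sub>R (h *\<^sub>R b) \<in> S'" if "x \<in> T" "t \<in> {0..1}" for x t
    using \<delta>(2) that by meson
  have TsS: "T \<subseteq> S'" using TS[of _ 0] by auto
  have m: "mono_on T w" unfolding w_def by (rule mono_on_avg[OF IH(2) T TS])
  \<comment> \<open>In the new direction the derivative of w is a difference quotient of u'; in an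
    earlier direction averaging preserves the regularity already gained.\<close>
  have "C1 T (pd c w)" if c: "c \<in> insert b B" for c
  proof (cases "c = b")
    case True
    have "C1 T (\<lambda>x. (1/h) *\<^sub>R (u' (x + h *\<^sub>R b) + (- 1) *\<^sub>R u' x))"
      by (intro C1_linear[OF bounded_linear_scaleR_right] C1_add C1_translate[OF C T]
          C1_subset[OF C T TsS]) (use TS[of _ 1] in auto)
    moreover have "(1/h) *\<^sub>R (u' (x + h *\<^sub>R b) + (- 1) *\<^sub>R u' x) = pd b w x" if "x \<in> T" for x
    proof -
      have "pd b w x = avg (h *\<^sub>R b) (pd b u') x"
        unfolding w_def by (rule avg_pd[OF C T TS bB that])
      moreover have "h \<noteq> 0" using \<delta>(1) by (simp add: h_def)
      ultimately show ?thesis using avg_same_direction[OF C bB _ TS[OF that]] by simp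
    qed
    ultimately show ?thesis unfolding True by (rule C1_cong)
  next
    case False
    then have "c \<in> B" "c \<in> Basis" using c BB by auto
    then have "C1 T (avg (h *\<^sub>R b) (pd c u'))"
      by (intro avg_C1[OF IH(3) T TS])
    moreover have "avg (h *\<^sub>R b) (pd c u') x = pd c w x" if "x \<in> T" for x
      unfolding w_def using avg_pd[OF C T TS \<open>c \<in> Basis\<close> that] by simp
    ultimately show ?thesis by (rule C1_cong)
  qed
  moreover have "norm (w x - u x) \<le> \<epsilon>" if x: "x \<in> K" for x
  proof -
    have "norm (w x - u' x) \<le> \<epsilon>/2" unfolding w_def
    proof (rule avg_close[OF C1D(2)[OF C]])
      fix t :: real assume t: "t \<in> {0..1}"
      show "x + t *\<^sub>R (h *\<^sub>R b) \<in> S'" using TS[OF _ t] KT x by auto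
      have "norm (t *\<^sub>R (h *\<^sub>R b)) = t * h" using t bB \<delta>(1) by (simp add: h_def)
      also have "\<dots> \<le> h" using t \<delta>(1) by (auto simp: h_def mult_left_le_one_le)
      also have "\<dots> < \<delta>" using \<delta>(1) by (simp add: h_def)
      finally have "dist (x + t *\<^sub>R (h *\<^sub>R b)) x < \<delta>" by (simp add: dist_norm)
      from \<delta>(3)[OF x this] show "norm (u' (x + t *\<^sub>R (h *\<^sub>R b)) - u' x) \<le> \<epsilon>/2"
        by (simp add: dist_norm)
    qed
    then show ?thesis using IH(4)[OF x] norm_triangle_ineq[of "w x - u' x" "u' x - u x"] by simp
  qed
  ultimately show ?case using KT m by blast
qed

section \<open>A priori bounds for solutions\<close>

lemma mono_on_difference_bound:
  fixes M :: real
  assumes u: "mono_on S u" and d: "d > 0" and a: "a \<in> Basis"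
    and Q: "cbox (x - d *\<^sub>R One) (x + d *\<^sub>R One) \<subseteq> S"
    and M: "\<And>y. y \<in> cbox (x - d *\<^sub>R One) (x + d *\<^sub>R One) \<Longrightarrow> norm (u y) \<le> M"
    and t: "0 \<le> t" "t \<le> d"
  shows "norm (u (x + t *\<^sub>R a) - u (x - t *\<^sub>R a)) \<le> 2 * t * DIM('e) * M / d"
proof (rule field_le_epsilon)
  fix \<epsilon>' :: real assume e': "\<epsilon>' > 0"
  let ?Q = "cbox (x - d *\<^sub>R One) (x + d *\<^sub>R One)"
  \<comment> \<open>The bound for the harmonic approximation contains no derivatives, so it survives
    the limit. Replacing u by u' costs at most 2n\<epsilon> through the supremum, as t is at most d,
    and 2\<epsilon> through the two values, with n the dimension.\<close>
  define \<epsilon> where "\<epsilon> = \<epsilon>' / (2 + 2 * DIM('e))"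
  have e: "\<epsilon> > 0" using e' by (simp add: \<epsilon>_def add_pos_nonneg)
  obtain S' u' where *: "?Q \<subseteq> S'" "mono_on S' u'" "\<And>b. b \<in> Basis \<Longrightarrow> C1 S' (pd b u')"
      "\<And>x. x \<in> ?Q \<Longrightarrow> norm (u' x - u x) \<le> \<epsilon>"
    using mono_on_approx[OF finite_Basis order_refl compact_cbox Q u e] by blast
  note C = mono_onD(1)[OF *(2)]
  have "norm (u' (x + t *\<^sub>R a) - u' (x - t *\<^sub>R a)) \<le> 2 * t * DIM('e) * (M + \<epsilon>) / d"
  proof (rule harmonic_difference_bound[OF d a refl _ _ _ _ _ t,
        where ?u1.0="\<lambda>b. pd b u'" and ?u2.0="\<lambda>b. pd b (pd b u')"])
    show "continuous_on ?Q u'" using C1D(2)[OF C] *(1) continuous_on_subset by blast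
    show "norm (u' y) \<le> M + \<epsilon>" if "y \<in> ?Q" for y
      using *(4)[OF that] M[OF that] norm_triangle_ineq[of "u' y - u y" "u y"] by simp
    show "(\<Sum>b\<in>Basis. pd b (pd b u') y) = 0" if "y \<in> ?Q" for y
      using mono_on_harmonic[OF *(2,3)] that *(1) by auto
  qed (use C1D(3)[OF C] C1D(3)[OF *(3)] *(1) in auto)
  moreover have in_Q: "x + t *\<^sub>R a \<in> ?Q" "x - t *\<^sub>R a \<in> ?Q"
    using t a by (auto simp: mem_cube inner_Basis)
  ultimately have "norm (u (x + t *\<^sub>R a) - u (x - t *\<^sub>R a)) \<le> 2 * t * DIM('e) * (M + \<epsilon>) / d + 2 * \<epsilon>"
    using *(4)[OF in_Q(1)] *(4)[OF in_Q(2)]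
      norm_triangle_ineq[of "u' (x + t *\<^sub>R a) - u' (x - t *\<^sub>R a)" "(u' (x - t *\<^sub>R a) - u (x - t *\<^sub>R a)) - (u' (x + t *\<^sub>R a) - u (x + t *\<^sub>R a))"]
      norm_triangle_ineq4[of "u' (x - t *\<^sub>R a) - u (x - t *\<^sub>R a)" "u' (x + t *\<^sub>R a) - u (x + t *\<^sub>R a)"]
    by simp
  also have "\<dots> = 2 * t * DIM('e) * M / d + (t / d) * (2 * DIM('e) * \<epsilon>) + 2 * \<epsilon>"
    by (simp add: ring_distribs add_divide_distrib)
  also have "(t / d) * (2 * DIM('e) * \<epsilon>) \<le> 1 * (2 * DIM('e) * \<epsilon>)"
    using t d e by (intro mult_right_mono) auto
  also have "2 * t * DIM('e) * M / d + 1 * (2 * DIM('e) * \<epsilon>) + 2 * \<epsilon> = 2 * t * DIM('e) * M / d + \<epsilon> * (2 + 2 * DIM('e))"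
    by (simp add: algebra_simps)
  also have "\<epsilon> * (2 + 2 * DIM('e)) = \<epsilon>'" by (simp add: \<epsilon>_def add_pos_nonneg)
  finally show "norm (u (x + t *\<^sub>R a) - u (x - t *\<^sub>R a)) \<le> 2 * t * DIM('e) * M / d + \<epsilon>'" by simp
qed

text \<open>The symmetric difference quotient is the mean of the two one-sided ones, so it converges
  to the partial derivative; the difference bound controls it uniformly in h.\<close>

lemma mono_on_gradient_bound:
  fixes M :: real
  assumes u: "mono_on S u" and d: "d > 0" and a: "a \<in> Basis"
    and Q: "cbox (x - d *\<^sub>R One) (x + d *\<^sub>R One) \<subseteq> S"
    and M: "\<And>y. y \<in> cbox (x - d *\<^sub>R One) (x + d *\<^sub>R One) \<Longrightarrow> norm (u y) \<le> M"
  shows "norm (pd a u x) \<le> DIM('e) * M / d"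
proof -
  note C = mono_onD(1)[OF u]
  have xS: "x \<in> S" using Q d mem_cube[of x x d] by auto
  have q: "((\<lambda>h. (1 / h) *\<^sub>R (u (x + h *\<^sub>R a) - u x)) \<longlongrightarrow> pd a u x) (at 0)"
    by (rule haspd_quotient[OF C1D(3)[OF C a xS]])
  have "((\<lambda>h. (1 / (- h)) *\<^sub>R (u (x + (- h) *\<^sub>R a) - u x)) \<longlongrightarrow> pd a u x) (at 0)"
    by (rule filterlim_compose[OF q]) (auto simp: filterlim_at intro!: tendsto_eq_intros eventually_neq_at_within)
  then have "((\<lambda>h. (1/2) *\<^sub>R ((1 / h) *\<^sub>R (u (x + h *\<^sub>R a) - u x) + (1 / (- h)) *\<^sub>R (u (x + (- h) *\<^sub>R a) - u x)))
      \<longlongrightarrow> (1/2) *\<^sub>R (pd a u x + pd a u x)) (at 0)"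
    using q by (intro tendsto_intros)
  then have "((\<lambda>h. (1 / (2 * h)) *\<^sub>R (u (x + h *\<^sub>R a) - u (x - h *\<^sub>R a))) \<longlongrightarrow> pd a u x) (at 0)"
    by (simp add: algebra_simps scaleR_2[symmetric])
  then have "((\<lambda>h. (1 / (2 * h)) *\<^sub>R (u (x + h *\<^sub>R a) - u (x - h *\<^sub>R a))) \<longlongrightarrow> pd a u x) (at_right 0)"
    by (rule tendsto_within_subset) auto
  then have "((\<lambda>h. norm ((1 / (2 * h)) *\<^sub>R (u (x + h *\<^sub>R a) - u (x - h *\<^sub>R a)))) \<longlongrightarrow> norm (pd a u x)) (at_right 0)"
    by (rule tendsto_norm)
  moreover have "\<forall>\<^sub>F h in at_right 0. norm ((1 / (2 * h)) *\<^sub>R (u (x + h *\<^sub>R a) - u (x - h *\<^sub>R a))) \<le> DIM('e) * M / d"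
    unfolding eventually_at_right_field
  proof (intro exI[of _ d] conjI allI impI)
    fix h :: real assume h: "0 < h" "h < d"
    have "norm ((1 / (2 * h)) *\<^sub>R (u (x + h *\<^sub>R a) - u (x - h *\<^sub>R a))) \<le> (1 / (2*h)) * (2 * h * DIM('e) * M / d)"
      using mono_on_difference_bound[OF u d a Q M, of h] h by (simp add: mult_left_mono del: times_divide_eq_left times_divide_eq_right)
    also have "\<dots> = DIM('e) * M / d" using h by simp
    finally show "norm ((1 / (2 * h)) *\<^sub>R (u (x + h *\<^sub>R a) - u (x - h *\<^sub>R a))) \<le> DIM('e) * M / d" .
  qed (use d in auto)
  ultimately show ?thesis by (rule tendsto_upperbound) simp
qed

section \<open>Derivatives of solutions are solutions\<close>

lemma mono_on_subset: "mono_on S u \<Longrightarrow> open T \<Longrightarrow> T \<subseteq> S \<Longrightarrow> mono_on T u"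
  unfolding mono_on_def using C1_subset by blast

lemma mono_on_local:
  assumes "open S" and loc: "\<And>x. x \<in> S \<Longrightarrow> \<exists>T. x \<in> T \<and> mono_on T u"
  shows "mono_on S u"
proof -
  have T: "\<exists>T. x \<in> T \<and> open T \<and> C1 T u \<and> mono_on T u" if "x \<in> S" for x
    using loc[OF that] mono_onD(1) C1D(1) by blast
  have cont: "continuous_on S g" if "\<And>T. C1 T u \<Longrightarrow> continuous_on T g" for g :: "'e \<Rightarrow> 'b"
  proof -
    have "isCont g x" if "x \<in> S" for x
      using T[OF that] \<open>\<And>T. C1 T u \<Longrightarrow> continuous_on T g\<close> continuous_on_eq_continuous_at by blast
    then show ?thesis by (simp add: continuous_at_imp_continuous_on)
  qed
  have "C1 S u"
  proof (rule C1I[where u'="\<lambda>b. pd b u"])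
    show "haspd b u (pd b u x) x" if "b \<in> Basis" "x \<in> S" for b x
      using T[OF that(2)] C1D(3) that(1) by blast
  qed (use assms(1) C1D in \<open>auto intro!: cont\<close>)
  then show ?thesis unfolding mono_on_def using T unfolding mono_on_def by blast
qed

lemma mono_on_linear_comb:
  assumes "mono_on S u" "mono_on S w"
  shows "mono_on S (\<lambda>x. c *\<^sub>R (u x - w x))"
proof -
  note C = mono_onD(1)[OF assms(1)] mono_onD(1)[OF assms(2)]
  have pd: "haspd b (\<lambda>x. c *\<^sub>R (u x - w x)) (c *\<^sub>R (pd b u x - pd b w x)) x" if "b \<in> Basis" "x \<in> S" for b x
    by (intro haspd_linear[OF bounded_linear_scaleR_right] haspd_diff C1D(3)[OF C(1)] C1D(3)[OF C(2)] that)
  have "C1 S (\<lambda>x. c *\<^sub>R (u x - w x))"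
    by (rule C1I[OF C1D(1)[OF C(1)] _ pd]) (use C1D[OF C(1)] C1D[OF C(2)] in \<open>auto intro!: continuous_intros\<close>)
  moreover have "(\<Sum>i<n. E i (c *\<^sub>R (pd (e i) u x - pd (e i) w x))) = 0" if "x \<in> S" for x
    using mono_onD(2)[OF assms(1) that] mono_onD(2)[OF assms(2) that]
    by (simp add: linear_cmul[OF linE] linear_diff[OF linE] sum_subtractf scaleR_right.sum[symmetric])
  ultimately show ?thesis
    unfolding mono_on_def using haspd_pd[OF pd] eB
      mono_onD(3)[OF assms(1)] mono_onD(3)[OF assms(2)] by simp
qed

lemma mono_on_translate:
  assumes u: "mono_on S u" and T: "open T" "\<And>x. x \<in> T \<Longrightarrow> x + a \<in> S"
  shows "mono_on T (\<lambda>x. u (x + a))"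
  unfolding mono_on_def
  using C1_translate[OF mono_onD(1)[OF u] T] pd_translate[OF mono_onD(1)[OF u] _ T(2)]
    mono_onD(2)[OF u T(2)] mono_onD(3)[OF u T(2)] eB by simp

text \<open>Difference quotients of a solution are solutions and converge uniformly to
  \<open>pd a u\<close>. The gradient bound applied to the difference of two of them makes their
  derivatives uniformly Cauchy, so differentiability, continuity of the partials and the equation
  all pass to the limit.\<close>

lemma mono_on_pd:
  assumes u: "mono_on S u" and a: "a \<in> Basis"
  shows "mono_on S (pd a u)"
proof (rule mono_on_local)
  note C = mono_onD(1)[OF u]
  show "open S" by (rule C1D(1)[OF C])
  fix x0 assume x0: "x0 \<in> S"
  obtain d0 where d0: "d0 > 0" "cbox (x0 - d0 *\<^sub>R One) (x0 + d0 *\<^sub>R One) \<subseteq> S"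
    using open_contains_cube[OF C1D(1)[OF C] x0] by blast
  \<comment> \<open>Nested cubes of half-sides d, 5d/2 and 2d for B, T and K. A cube of half-side d
    about a point of B lies in K, and steps of at most d/2 from T stay within d0 = 3d of the
    centre.\<close>
  define d where "d = d0 / 3"
  have d: "d > 0" using d0 by (simp add: d_def)
  define K where "K = cbox (x0 - (2 * d) *\<^sub>R One) (x0 + (2 * d) *\<^sub>R One)"
  define T where "T = box (x0 - (5/2 * d) *\<^sub>R One) (x0 + (5/2 * d) *\<^sub>R One)"
  define B where "B = box (x0 - d *\<^sub>R One) (x0 + d *\<^sub>R One)"
  define h where "h = (\<lambda>k::nat. d / (2 * (real k + 1)))"
  define g where "g = (\<lambda>k x. (1 / h k) *\<^sub>R (u (x + h k *\<^sub>R a) - u x))"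
  have hpos: "h k > 0" for k using d by (simp add: h_def)
  have hle: "h k \<le> d / 2" for k using d by (simp add: h_def field_simps)
  have hlim: "h \<longlonglongrightarrow> 0" unfolding h_def by real_asymp
  have TS: "x + t *\<^sub>R (h k *\<^sub>R a) \<in> S" if "x \<in> T" "t \<in> {0..1}" for x t k
  proof -
    have "\<bar>(x + t *\<^sub>R (h k *\<^sub>R a) - x0) \<bullet> b\<bar> \<le> d0" if b: "b \<in> Basis" for b
    proof -
      have "\<bar>(x - x0) \<bullet> b\<bar> < 5/2 * d" using \<open>x \<in> T\<close> b by (simp add: T_def mem_open_cube)
      moreover have "\<bar>t * h k * (a \<bullet> b)\<bar> \<le> 1 * (d/2) * 1"
        unfolding abs_mult using that hle[of k] hpos[of k] \<open>t \<in> {0..1}\<close> a b d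
        by (intro mult_mono) (auto simp: inner_Basis)
      moreover have "(x + t *\<^sub>R (h k *\<^sub>R a) - x0) \<bullet> b = (x - x0) \<bullet> b + t * h k * (a \<bullet> b)"
        by (simp add: inner_diff_left inner_add_left)
      ultimately show ?thesis using d0(1) by (simp add: d_def)
    qed
    then show ?thesis using d0(2) mem_cube by blast
  qed
  have T: "open T" and KT: "K \<subseteq> T" and BT: "B \<subseteq> T" and B: "open B" "x0 \<in> B"
    using d by (auto simp: T_def K_def B_def mem_open_cube mem_cube open_box) force+
  have TsS: "T \<subseteq> S" using TS[of _ 0] by auto
  have gm: "mono_on T (g k)" for k
    unfolding g_def using TS[of _ 1]
    by (intro mono_on_linear_comb mono_on_translate[OF u T] mono_on_subset[OF u T TsS]) auto
  note gC = mono_onD(1)[OF gm]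
  have close: "\<forall>\<^sub>F k in sequentially. \<forall>x\<in>K. norm (g k x - pd a u x) \<le> \<epsilon>" if \<epsilon>: "\<epsilon> > 0" for \<epsilon>
  proof -
    have "compact K" "K \<subseteq> S" using KT TsS by (auto simp: K_def)
    then obtain \<delta> where \<delta>: "\<delta> > 0" "\<And>x y. x \<in> K \<Longrightarrow> dist y x < \<delta> \<Longrightarrow> dist (pd a u y) (pd a u x) < \<epsilon>"
      using continuous_on_compact_nbhd[OF _ C1D(1)[OF C] _ C1D(4)[OF C a] \<epsilon>] by metis
    have "\<forall>\<^sub>F k in sequentially. h k < \<delta>"
      using hlim \<delta>(1) by (rule order_tendstoD)
    then show ?thesis
    proof eventually_elim
      case (elim k)
      show ?case
      proof
        fix x assume x: "x \<in> K"
        then have xT: "x \<in> T" using KT by auto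
        have "g k x = avg (h k *\<^sub>R a) (pd a u) x"
          unfolding g_def using avg_same_direction[OF C a _ TS[OF xT]] hpos[of k] by simp
        moreover have "norm (avg (h k *\<^sub>R a) (pd a u) x - pd a u x) \<le> \<epsilon>"
        proof (rule avg_close[OF C1D(4)[OF C a] TS[OF xT]])
          fix t :: real assume t: "t \<in> {0..1}"
          have "norm (t *\<^sub>R (h k *\<^sub>R a)) = t * h k" using t a hpos[of k] by simp
          also have "\<dots> \<le> h k" using t hpos[of k] by (auto simp: mult_left_le_one_le)
          finally have "dist (x + t *\<^sub>R (h k *\<^sub>R a)) x < \<delta>" using elim by (simp add: dist_norm)
          then show "norm (pd a u (x + t *\<^sub>R (h k *\<^sub>R a)) - pd a u x) \<le> \<epsilon>"
            using \<delta>(2)[OF x] unfolding dist_norm by (meson less_imp_le)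
        qed
        ultimately show "norm (g k x - pd a u x) \<le> \<epsilon>" by simp
      qed
    qed
  qed
  have cauchy: "uniformly_Cauchy_on B (\<lambda>k. pd b (g k))" if b: "b \<in> Basis" for b
    unfolding uniformly_Cauchy_on_def
  proof (intro allI impI)
    fix \<epsilon> :: real assume \<epsilon>: "\<epsilon> > 0"
    \<comment> \<open>Chosen so that the gradient bound with supremum 2\<eta> on cubes of half-side
      d gives \<epsilon>/2.\<close>
    define \<eta> where "\<eta> = \<epsilon> * d / (4 * DIM('e))"
    have \<eta>: "\<eta> > 0" using \<epsilon> d by (simp add: \<eta>_def)
    obtain N where N: "\<And>k x. k \<ge> N \<Longrightarrow> x \<in> K \<Longrightarrow> norm (g k x - pd a u x) \<le> \<eta>"
      using close[OF \<eta>] by (auto simp: eventually_sequentially)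
    have "dist (pd b (g k) x) (pd b (g l) x) < \<epsilon>" if x: "x \<in> B" and kl: "k \<ge> N" "l \<ge> N" for k l x
    proof -
      have xK: "cbox (x - d *\<^sub>R One) (x + d *\<^sub>R One) \<subseteq> K"
      proof
        fix y assume y: "y \<in> cbox (x - d *\<^sub>R One) (x + d *\<^sub>R One)"
        have "\<bar>(y - x0) \<bullet> c\<bar> \<le> 2 * d" if c: "c \<in> Basis" for c
        proof -
          have "\<bar>(y - x) \<bullet> c\<bar> \<le> d" "\<bar>(x - x0) \<bullet> c\<bar> < d"
            using y x c by (auto simp: mem_cube B_def mem_open_cube)
          moreover have "(y - x0) \<bullet> c = (y - x) \<bullet> c + (x - x0) \<bullet> c" by (simp add: inner_diff_left)
          ultimately show ?thesis by linarith
        qed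
        then show "y \<in> K" by (simp add: K_def mem_cube)
      qed
      have "norm (pd b (\<lambda>x. 1 *\<^sub>R (g k x - g l x)) x) \<le> DIM('e) * (2 * \<eta>) / d"
      proof (rule mono_on_gradient_bound[OF mono_on_linear_comb[OF gm gm] d b])
        fix y assume "y \<in> cbox (x - d *\<^sub>R One) (x + d *\<^sub>R One)"
        then have "y \<in> K" using xK by auto
        then show "norm (1 *\<^sub>R (g k y - g l y)) \<le> 2 * \<eta>"
          using N[OF kl(1), of y] N[OF kl(2), of y] norm_triangle_ineq4[of "g k y - pd a u y" "g l y - pd a u y"]
          by simp
      qed (use xK KT in auto)
      also have "\<dots> = \<epsilon> / 2" using d by (simp add: \<eta>_def)
      also have "pd b (\<lambda>x. 1 *\<^sub>R (g k x - g l x)) x = pd b (g k) x - pd b (g l) x"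
        using x BT by (intro haspd_pd) (auto intro!: haspd_diff C1D(3)[OF gC] b)
      finally show ?thesis using \<epsilon> by (simp add: dist_norm)
    qed
    then show "\<exists>M. \<forall>x\<in>B. \<forall>m\<ge>M. \<forall>n\<ge>M. dist (pd b (g m) x) (pd b (g n) x) < \<epsilon>" by blast
  qed
  have "\<exists>G. uniform_limit B (\<lambda>k. pd b (g k)) G sequentially" if "b \<in> Basis" for b
    using Cauchy_uniformly_convergent[OF cauchy[OF that]] by (simp add: uniformly_convergent_on_def)
  then obtain G where G: "\<And>b. b \<in> Basis \<Longrightarrow> uniform_limit B (\<lambda>k. pd b (g k)) (G b) sequentially"
    by metis
  have BK: "B \<subseteq> K" using d by (force simp: B_def K_def mem_cube mem_open_cube)
  have glim: "(\<lambda>k. g k x) \<longlonglongrightarrow> pd a u x" if "x \<in> B" for x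
  proof (rule tendstoI)
    fix \<epsilon> :: real assume "\<epsilon> > 0"
    then have "\<epsilon> / 2 > 0" by simp
    from close[OF this] show "\<forall>\<^sub>F k in sequentially. dist (g k x) (pd a u x) < \<epsilon>"
      by eventually_elim (use that BK \<open>\<epsilon> > 0\<close> in \<open>force simp: dist_norm\<close>)
  qed
  have haspd: "haspd b (pd a u) (G b x) x" if b: "b \<in> Basis" and x: "x \<in> B" for b x
  proof -
    from eventually_line_open[OF B(1) x, of b]
    obtain \<delta> where \<delta>: "\<delta> > 0" "\<And>s. \<bar>s\<bar> < \<delta> \<Longrightarrow> x + s *\<^sub>R b \<in> B"
      by (auto simp: eventually_nhds_metric dist_real_def)
    let ?U = "ball (0::real) \<delta>"
    have inB: "x + s *\<^sub>R b \<in> B" if "s \<in> ?U" for s using \<delta>(2)[of s] that by (simp add: dist_real_def)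
    have "\<exists>f. \<forall>s\<in>?U. (\<lambda>k. g k (x + s *\<^sub>R b)) \<longlonglongrightarrow> f s \<and>
        (f has_derivative (\<lambda>t. t *\<^sub>R G b (x + s *\<^sub>R b))) (at s within ?U)"
    proof (rule has_derivative_sequence[where f'="\<lambda>k s t. t *\<^sub>R pd b (g k) (x + s *\<^sub>R b)"])
      fix k s assume s: "s \<in> ?U"
      have "haspd b (g k) (pd b (g k) (x + s *\<^sub>R b)) (x + s *\<^sub>R b)"
        by (rule C1D(3)[OF gC b]) (use inB[OF s] BT in auto)
      from haspd_shift[OF this]
      show "((\<lambda>s. g k (x + s *\<^sub>R b)) has_derivative (\<lambda>t. t *\<^sub>R pd b (g k) (x + s *\<^sub>R b))) (at s within ?U)"
        unfolding has_vector_derivative_def by (rule has_derivative_at_withinI)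
    next
      fix \<epsilon> :: real assume \<epsilon>: "\<epsilon> > 0"
      from uniform_limitD[OF G[OF b] \<epsilon>]
      show "\<forall>\<^sub>F k in sequentially. \<forall>s\<in>?U. \<forall>t. norm (t *\<^sub>R pd b (g k) (x + s *\<^sub>R b) - t *\<^sub>R G b (x + s *\<^sub>R b)) \<le> \<epsilon> * norm t"
      proof eventually_elim
        case (elim k)
        show ?case
        proof (intro ballI allI)
          fix s t assume "s \<in> ?U"
          then have "norm (pd b (g k) (x + s *\<^sub>R b) - G b (x + s *\<^sub>R b)) \<le> \<epsilon>"
            using elim inB by (force simp: dist_norm)
          then have "\<bar>t\<bar> * norm (pd b (g k) (x + s *\<^sub>R b) - G b (x + s *\<^sub>R b)) \<le> \<bar>t\<bar> * \<epsilon>"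
            by (intro mult_left_mono) auto
          then show "norm (t *\<^sub>R pd b (g k) (x + s *\<^sub>R b) - t *\<^sub>R G b (x + s *\<^sub>R b)) \<le> \<epsilon> * norm t"
            by (simp add: scaleR_diff_right[symmetric] mult.commute)
        qed
      qed
    next
      show "(0::real) \<in> ?U" using \<delta>(1) by simp
      show "(\<lambda>k. g k (x + 0 *\<^sub>R b)) \<longlonglongrightarrow> pd a u x" using glim[OF x] by simp
    qed simp
    then obtain f where f: "\<And>s. s \<in> ?U \<Longrightarrow> (\<lambda>k. g k (x + s *\<^sub>R b)) \<longlonglongrightarrow> f s"
      "\<And>s. s \<in> ?U \<Longrightarrow> (f has_derivative (\<lambda>t. t *\<^sub>R G b (x + s *\<^sub>R b))) (at s within ?U)" by blast
    have fe: "f s = pd a u (x + s *\<^sub>R b)" if "s \<in> ?U" for s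
      using LIMSEQ_unique[OF f(1)[OF that] glim[OF inB[OF that]]] .
    have "0 \<in> ?U" using \<delta>(1) by simp
    from f(2)[OF this] have "(f has_derivative (\<lambda>t. t *\<^sub>R G b x)) (at 0)"
      using \<open>0 \<in> ?U\<close> by (simp add: at_within_open[of 0 ?U])
    then have "((\<lambda>s. pd a u (x + s *\<^sub>R b)) has_derivative (\<lambda>t. t *\<^sub>R G b x)) (at 0)"
      by (rule has_derivative_transform_within_open[OF _ open_ball \<open>0 \<in> ?U\<close> fe])
    then show ?thesis by (simp add: haspd_def has_vector_derivative_def)
  qed
  have Gc: "continuous_on B (G b)" if "b \<in> Basis" for b
    using uniform_limit_theorem[OF _ G[OF that]] C1D(4)[OF gC that] BT
    by (meson always_eventually continuous_on_subset trivial_limit_sequentially)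
  have Glim: "(\<lambda>k. pd b (g k) x) \<longlonglongrightarrow> G b x" if "b \<in> Basis" "x \<in> B" for b x
    using tendsto_uniform_limitI[OF G[OF that(1)] that(2)] .
  have "C1 B (pd a u)"
    using haspd Gc by (intro C1I[OF B(1)] continuous_on_subset[OF C1D(4)[OF C a]]) (use BT TsS in auto)
  moreover have "(\<Sum>i<n. E i (pd (e i) (pd a u) x)) = 0" if x: "x \<in> B" for x
  proof -
    have "(\<lambda>k. \<Sum>i<n. E i (pd (e i) (g k) x)) \<longlonglongrightarrow> (\<Sum>i<n. E i (G (e i) x))"
      using Glim[OF eB x] by (intro tendsto_sum bounded_linear.tendsto[OF blE]) auto
    moreover have "(\<Sum>i<n. E i (pd (e i) (g k) x)) = 0" for k
      using mono_onD(2)[OF gm] x BT by auto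
    ultimately have "(\<Sum>i<n. E i (G (e i) x)) = 0" by (simp add: LIMSEQ_const_iff)
    then show ?thesis using haspd_pd[OF haspd[OF eB x]] by simp
  qed
  moreover have "pd b (pd a u) x = 0" if "x \<in> B" "b \<in> Basis - e ` {..<n}" for x b
  proof -
    have "pd b (g k) x = 0" for k using mono_onD(3)[OF gm] that BT by auto
    then have "G b x = 0" using Glim[of b x] that by (simp add: LIMSEQ_const_iff)
    then show ?thesis using haspd_pd[OF haspd, of b x] that by simp
  qed
  ultimately show "\<exists>T. x0 \<in> T \<and> mono_on T (pd a u)"
    using B(2) unfolding mono_on_def by blast
qed

section \<open>Factorial growth of iterated derivatives\<close>

lemma mono_on_iter: "mono_on S u \<Longrightarrow> a \<in> Basis \<Longrightarrow> mono_on S ((pd a ^^ k) u)"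
  by (induction k) (auto intro: mono_on_pd)

text \<open>The half-side d is spent in k equal portions, one for each derivative. Each costs a
  factor n k / d, with n the dimension, and k^k is at most e^k k!.\<close>

lemma mono_on_iter_bound:
  fixes M :: real
  assumes u: "mono_on S u" and d: "d > 0" and a: "a \<in> Basis"
    and Q: "cbox (x - d *\<^sub>R One) (x + d *\<^sub>R One) \<subseteq> S"
    and M: "\<And>y. y \<in> cbox (x - d *\<^sub>R One) (x + d *\<^sub>R One) \<Longrightarrow> norm (u y) \<le> M"
  shows "norm ((pd a ^^ k) u x) \<le> M * (DIM('e) * exp 1 / d) ^ k * fact k"
proof (cases "k = 0")
  case True
  then show ?thesis using M[of x] d by (simp add: mem_cube)
next
  case False
  define \<rho> where "\<rho> = d / k"
  have \<rho>: "\<rho> > 0" "k * \<rho> = d" using False d by (simp_all add: \<rho>_def)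
  have M0: "M \<ge> 0" using M[of x] d by (simp add: mem_cube) (meson norm_ge_zero order_trans)
  have step: "norm ((pd a ^^ j) u y) \<le> M * (DIM('e) / \<rho>) ^ j"
    if "j \<le> k" "y \<in> cbox (x - (d - j * \<rho>) *\<^sub>R One) (x + (d - j * \<rho>) *\<^sub>R One)" for j y
    using that
  proof (induction j arbitrary: y)
    case 0
    then show ?case using M by simp
  next
    case (Suc j)
    have sub: "cbox (y - \<rho> *\<^sub>R One) (y + \<rho> *\<^sub>R One) \<subseteq> cbox (x - (d - j * \<rho>) *\<^sub>R One) (x + (d - j * \<rho>) *\<^sub>R One)"
    proof
      fix z assume z: "z \<in> cbox (y - \<rho> *\<^sub>R One) (y + \<rho> *\<^sub>R One)"
      have "\<bar>(z - x) \<bullet> c\<bar> \<le> d - j * \<rho>" if c: "c \<in> Basis" for c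
      proof -
        have "\<bar>(z - y) \<bullet> c\<bar> \<le> \<rho>" "\<bar>(y - x) \<bullet> c\<bar> \<le> d - Suc j * \<rho>"
          using z Suc.prems(2) c unfolding mem_cube by auto
        moreover have "(z - x) \<bullet> c = (z - y) \<bullet> c + (y - x) \<bullet> c" by (simp add: inner_diff_left)
        ultimately show ?thesis by (simp add: algebra_simps)
      qed
      then show "z \<in> cbox (x - (d - j * \<rho>) *\<^sub>R One) (x + (d - j * \<rho>) *\<^sub>R One)" by (simp add: mem_cube)
    qed
    have "cbox (x - (d - j * \<rho>) *\<^sub>R One) (x + (d - j * \<rho>) *\<^sub>R One) \<subseteq> cbox (x - d *\<^sub>R One) (x + d *\<^sub>R One)"
    proof
      fix z assume z: "z \<in> cbox (x - (d - j * \<rho>) *\<^sub>R One) (x + (d - j * \<rho>) *\<^sub>R One)"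
      have "d - j * \<rho> \<le> d" using \<rho>(1) by simp
      then show "z \<in> cbox (x - d *\<^sub>R One) (x + d *\<^sub>R One)"
        using z unfolding mem_cube by (meson order_trans)
    qed
    with sub have sub': "cbox (y - \<rho> *\<^sub>R One) (y + \<rho> *\<^sub>R One) \<subseteq> S" using Q by blast
    have "norm (pd a ((pd a ^^ j) u) y) \<le> DIM('e) * (M * (DIM('e) / \<rho>) ^ j) / \<rho>"
      by (rule mono_on_gradient_bound[OF mono_on_iter[OF u a] \<rho>(1) a sub']) (use Suc sub in auto)
    then show ?case by (simp add: mult_ac)
  qed
  have "x \<in> cbox (x - (d - k * \<rho>) *\<^sub>R One) (x + (d - k * \<rho>) *\<^sub>R One)"
    using \<rho> by (simp add: mem_cube)
  from step[OF order_refl this] have "norm ((pd a ^^ k) u x) \<le> M * (DIM('e) / \<rho>) ^ k" .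
  also have "(DIM('e) / \<rho>) ^ k = (DIM('e) / d) ^ k * real k ^ k"
    using d False by (simp add: \<rho>_def power_mult_distrib[symmetric])
  also have "real k ^ k \<le> exp 1 ^ k * fact k"
  \<comment> \<open>The quotient k^k / k! is a single term of the exponential series at k.\<close>
  proof -
    have s: "(\<lambda>i. real k ^ i /\<^sub>R fact i) sums exp (real k)" by (rule exp_converges)
    have "(\<Sum>i\<in>{k}. real k ^ i /\<^sub>R fact i) \<le> exp (real k)"
      unfolding sums_unique[OF s] by (rule sum_le_suminf[OF sums_summable[OF s]]) auto
    then have "real k ^ k / fact k \<le> exp 1 ^ k"
      by (simp add: exp_of_nat_mult[symmetric] divide_inverse mult.commute)
    then show ?thesis by (simp add: divide_le_eq)
  qed
  also have "M * ((DIM('e) / d) ^ k * (exp 1 ^ k * fact k)) = M * (DIM('e) * exp 1 / d) ^ k * fact k"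
    by (simp add: power_mult_distrib power_divide)
  finally show ?thesis using M0 d by (simp add: mult_left_mono)
qed

end

section \<open>One-dimensional analyticity\<close>

text \<open>Integrating n times from a, where all w k vanish, bounds \<open>w k x\<close> by the
  Taylor remainder. The factorials contribute at most k! 2^(k+n) and the step length at most 4^(-n),
  so a factor 2^(-n) remains.\<close>

lemma analytic_bound_step:
  fixes w :: "nat \<Rightarrow> real \<Rightarrow> 'b::real_normed_vector"
  assumes cont: "\<And>k. continuous_on {0..b} (w k)"
    and der: "\<And>k x. 0 < x \<Longrightarrow> x < b \<Longrightarrow> (w k has_vector_derivative w (Suc k) x) (at x)"
    and bnd: "\<And>k x. 0 \<le> x \<Longrightarrow> x \<le> b \<Longrightarrow> norm (w k x) \<le> C * L ^ k * fact k"
    and a: "0 \<le> a" "\<And>k. w k a = 0"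
    and x: "a \<le> x" "x \<le> b" "L * (x - a) \<le> 1/4" and L: "L > 0"
  shows "w k x = 0"
proof -
  have C0: "C \<ge> 0" using bnd[of a 0] a x by (simp) 
  have est: "norm (w k x) \<le> C * L ^ (k + n) * fact (k + n) / fact n * (x - a) ^ n"
    if "a \<le> x" "x \<le> b" for n k x
    using that
  proof (induction n arbitrary: k x)
    case 0
    then show ?case using bnd[of x k] a by simp
  next
    case (Suc n)
    show ?case
    proof (cases "x = a")
      case True
      then show ?thesis using a by simp
    next
      case False
      define c where "c = C * L ^ (k + Suc n) * fact (k + Suc n)"
      have "norm (w k x - w k a) \<le> c / fact (Suc n) * (x - a) ^ Suc n - c / fact (Suc n) * (a - a) ^ Suc n"
      proof (rule differentiable_bound_general[where f'="w (Suc k)" and \<phi>'="\<lambda>t. c / fact n * (t - a) ^ n"])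
        show "a < x" using False Suc by simp
        show "continuous_on {a..x} (w k)"
          using continuous_on_subset[OF cont] a Suc by auto
        show "continuous_on {a..x} (\<lambda>x. c / fact (Suc n) * (x - a) ^ Suc n)"
          by (intro continuous_intros)
        show "(w k has_vector_derivative w (Suc k) t) (at t)" if "a < t" "t < x" for t
          using der[of t k] that a Suc by simp
        show "((\<lambda>x. c / fact (Suc n) * (x - a) ^ Suc n) has_vector_derivative c / fact n * (t - a) ^ n) (at t)" for t
          unfolding has_real_derivative_iff_has_vector_derivative[symmetric]
          by (rule derivative_eq_intros refl)+ (simp add: field_simps del: of_nat_Suc)
        show "norm (w (Suc k) t) \<le> c / fact n * (t - a) ^ n" if "a < t" "t < x" for t
          using Suc.IH[of t "Suc k"] that Suc.prems by (simp add: c_def)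
      qed
      then show ?thesis using a by (simp add: c_def)
    qed
  qed
  have "norm (w k x) \<le> (C * L ^ k * fact k * 2 ^ k) * (1/2) ^ n" for n
  proof -
    have "(fact (k + n) / fact n :: real) = fact k * real ((k + n) choose n)"
      by (simp add: binomial_fact)
    moreover have "real ((k + n) choose n) \<le> 2 ^ (k + n)"
      using binomial_le_pow2[of "k + n" n] by (metis of_nat_le_iff of_nat_numeral of_nat_power)
    ultimately have f: "(fact (k + n) / fact n :: real) \<le> fact k * 2 ^ (k + n)"
      by (metis fact_ge_zero mult_left_mono)
    have "norm (w k x) \<le> C * L ^ (k + n) * fact (k + n) / fact n * (x - a) ^ n"
      by (rule est[OF x(1,2)])
    also have "\<dots> = C * L ^ k * (fact (k + n) / fact n) * (L * (x - a)) ^ n"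
      by (simp add: power_add power_mult_distrib)
    also have "\<dots> \<le> C * L ^ k * (fact k * 2 ^ (k + n)) * (1/4) ^ n"
      using f x L C0 by (intro mult_mono power_mono mult_nonneg_nonneg) auto
    also have "\<dots> = (C * L ^ k * fact k * 2 ^ k) * (2 ^ n * (1/4) ^ n)"
      by (simp add: power_add)
    also have "2 ^ n * (1/4) ^ n = (1/2::real) ^ n" by (simp flip: power_mult_distrib)
    finally show ?thesis .
  qed
  moreover have "(\<lambda>n. (C * L ^ k * fact k * 2 ^ k) * (1/2) ^ n) \<longlonglongrightarrow> (C * L ^ k * fact k * 2 ^ k) * 0"
    by (intro tendsto_intros LIMSEQ_power_zero) auto
  ultimately have "norm (w k x) \<le> (C * L ^ k * fact k * 2 ^ k) * 0"
    by (intro LIMSEQ_le_const) auto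
  then show ?thesis by simp
qed

text \<open>The interval is exhausted by steps of length 1/(4L); the constants do not deteriorate
  because the bound is uniform on the whole interval.\<close>

lemma analytic_bound_zero:
  fixes w :: "nat \<Rightarrow> real \<Rightarrow> 'b::real_normed_vector"
  assumes cont: "\<And>k. continuous_on {0..b} (w k)"
    and der: "\<And>k x. 0 < x \<Longrightarrow> x < b \<Longrightarrow> (w k has_vector_derivative w (Suc k) x) (at x)"
    and bnd: "\<And>k x. 0 \<le> x \<Longrightarrow> x \<le> b \<Longrightarrow> norm (w k x) \<le> C * L ^ k * fact k"
    and zero: "\<And>k. w k 0 = 0" and L: "L > 0" and x: "0 \<le> x" "x \<le> b"
  shows "w k x = 0"
proof -
  have "w k y = 0" if "0 \<le> y" "y \<le> b" "y \<le> real N / (4 * L)" for N k y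
    using that
  proof (induction N arbitrary: k y)
    case 0
    then show ?case using zero by simp
  next
    case (Suc N)
    define a where "a = max 0 (y - 1 / (4 * L))"
    have "y - 1 / (4 * L) \<le> real N / (4 * L)" using Suc.prems(3) by (simp add: add_divide_distrib)
    then have a: "0 \<le> a" "a \<le> real N / (4 * L)" "a \<le> y" "y - a \<le> 1 / (4 * L)"
      using L Suc.prems by (auto simp: a_def)
    have "w k a = 0" for k using Suc.IH[of a k] a Suc.prems by simp
    moreover have "L * (y - a) \<le> 1/4" using mult_left_mono[OF a(4), of L] L by simp
    ultimately show ?case
      using analytic_bound_step[OF cont der bnd a(1)] a Suc.prems L by blast
  qed
  moreover obtain N where "x * (4 * L) \<le> real N" using real_arch_simple by blast
  then have "x \<le> real N / (4 * L)" using L by (simp add: field_simps)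
  ultimately show ?thesis using x by blast
qed

text \<open>Summation by parts through the Cauchy product with the geometric series: the difference
  from the limit is (1 - x) times the series of the errors of the partial sums. Finitely many errors
  are damped by 1 - x and the rest are small.\<close>

lemma Abel_limit:
  fixes c :: "nat \<Rightarrow> real"
  assumes "summable c"
  shows "((\<lambda>x. \<Sum>k. c k * x ^ k) \<longlongrightarrow> (\<Sum>k. c k)) (at_left 1)"
proof -
  define s where "s = (\<lambda>n. \<Sum>k\<le>n. c k)"
  define S where "S = (\<Sum>k. c k)"
  have sS: "s \<longlonglongrightarrow> S" unfolding s_def S_def by (rule summable_LIMSEQ'[OF assms])
  have rep: "(\<lambda>n. (s n - S) * x ^ n) sums (((\<Sum>k. c k * x ^ k) - S) / (1 - x))" if x: "0 \<le> x" "x < 1" for x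
  proof -
    have xn: "norm x < 1" using x by simp
    have sc: "summable (\<lambda>k. norm (c k * x ^ k))"
      using powser_insidea[of c 1 x] assms xn by simp
    have "(\<lambda>n. \<Sum>i\<le>n. (c i * x ^ i) * x ^ (n - i)) sums ((\<Sum>k. c k * x ^ k) * (\<Sum>k. x ^ k))"
      using sc x by (intro Cauchy_product_sums) (auto simp: norm_power intro: summable_geometric)
    moreover have "(\<Sum>i\<le>n. (c i * x ^ i) * x ^ (n - i)) = s n * x ^ n" for n
      by (auto simp: s_def sum_distrib_right mult.assoc power_add[symmetric] intro!: sum.cong)
    ultimately have "(\<lambda>n. s n * x ^ n) sums ((\<Sum>k. c k * x ^ k) * (1 / (1 - x)))"
      using suminf_geometric[OF xn] by simp
    moreover have "(\<lambda>n. S * x ^ n) sums (S * (1 / (1 - x)))"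
      by (intro sums_mult geometric_sums xn)
    ultimately have "(\<lambda>n. s n * x ^ n - S * x ^ n) sums ((\<Sum>k. c k * x ^ k) * (1 / (1 - x)) - S * (1 / (1 - x)))"
      by (rule sums_diff)
    then show ?thesis by (simp add: left_diff_distrib diff_divide_distrib)
  qed
  have "((\<lambda>x. \<Sum>k. c k * x ^ k) \<longlongrightarrow> S) (at_left 1)"
  proof (rule tendstoI)
    fix \<epsilon> :: real assume \<epsilon>: "\<epsilon> > 0"
    then obtain N where N: "\<And>n. n \<ge> N \<Longrightarrow> \<bar>s n - S\<bar> \<le> \<epsilon>/2"
      using LIMSEQ_D[OF sS, of "\<epsilon>/2"] by (auto intro: less_imp_le)
    define K where "K = (\<Sum>n<N. \<bar>s n - S\<bar>)"
    have K: "K \<ge> 0" by (simp add: K_def sum_nonneg)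
    \<comment> \<open>Makes the contribution of the first N errors less than \<epsilon>/2; the
      summand 2 also covers K = 0.\<close>
    define \<delta> where "\<delta> = min 1 (\<epsilon> / (2 * K + 2))"
    have \<delta>: "\<delta> > 0" "\<delta> \<le> 1" using \<epsilon> K by (auto simp: \<delta>_def)
    have "dist (\<Sum>k. c k * x ^ k) S < \<epsilon>" if x: "1 - \<delta> < x" "x < 1" for x
    proof -
      have x0: "0 \<le> x" using x \<delta> by simp
      let ?d = "\<lambda>n. (if n < N then \<bar>s n - S\<bar> else 0) + \<epsilon>/2 * x ^ n"
      have "(\<lambda>n. if n \<in> {..<N} then \<bar>s n - S\<bar> else 0) sums K"
        unfolding K_def by (rule sums_If_finite_set) simp
      then have "?d sums (K + \<epsilon>/2 * (1 / (1 - x)))"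
        using x x0 by (intro sums_add sums_mult geometric_sums) auto
      note d = this
      have pt: "norm ((s n - S) * x ^ n) \<le> ?d n" for n
      proof (cases "n < N")
        case True
        have "\<bar>s n - S\<bar> * x ^ n \<le> \<bar>s n - S\<bar>"
          using x x0 by (intro mult_left_le power_le_one) auto
        then show ?thesis using True \<epsilon> x0 by (simp add: abs_mult add_increasing2)
      next
        case False
        then show ?thesis using mult_right_mono[OF N, of n "x ^ n"] x0 by (simp add: abs_mult)
      qed
      have "norm (\<Sum>n. (s n - S) * x ^ n) \<le> (\<Sum>n. ?d n)"
        using d by (intro norm_suminf_le pt) (auto simp: sums_iff)
      then have "\<bar>((\<Sum>k. c k * x ^ k) - S) / (1 - x)\<bar> \<le> K + \<epsilon>/2 * (1 / (1 - x))"
        using d rep[OF x0 x(2)] by (simp add: sums_iff)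
      then have "\<bar>(\<Sum>k. c k * x ^ k) - S\<bar> \<le> (K + \<epsilon>/2 * (1 / (1 - x))) * (1 - x)"
        using x by (simp add: abs_divide pos_divide_le_eq)
      also have "\<dots> = K * (1 - x) + \<epsilon>/2" using x by (simp add: field_simps)
      also have "K * (1 - x) \<le> K * (\<epsilon> / (2 * K + 2))"
        using K x by (intro mult_left_mono) (auto simp: \<delta>_def)
      also have "K * (\<epsilon> / (2 * K + 2)) < \<epsilon> / 2"
        using K \<epsilon> by (simp add: field_simps)
      finally show ?thesis by (simp add: dist_real_def)
    qed
    then show "\<forall>\<^sub>F x in at_left 1. dist (\<Sum>k. c k * x ^ k) S < \<epsilon>"
      unfolding eventually_at_left_field using \<delta> by (intro exI[of _ "1 - \<delta>"]) auto
  qed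
  then show ?thesis by (simp add: S_def)
qed

lemma diffs_iter: "(diffs ^^ k) a n = fact k * real ((n + k) choose k) * (a (n + k) :: real)"
proof (induction k arbitrary: n)
  case (Suc k)
  have "(n + Suc k choose Suc k) * Suc k = Suc n * (Suc n + k choose k)"
    using Suc_times_binomial_add[of k n] by (simp add: mult.commute add_ac)
  then have "real (n + Suc k choose Suc k) * (1 + real k) = (1 + real n) * real (Suc n + k choose k)"
    by (metis of_nat_Suc of_nat_mult)
  then show ?case using Suc.IH[of "Suc n"]
    by (simp add: diffs_def mult_ac)
qed simp

text \<open>The derivative bound alone does not make the Taylor series at 0 represent G up to S;
  convergence at S is a hypothesis. Below S the sum of the series has the same derivatives at 0 as G
  and satisfies a bound of the same type on each [0, s], so the two coincide there. The value at S
  follows from \<open>Abel_limit\<close>, since convergence there may be conditional.\<close>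

lemma analytic_bound_sums:
  fixes G :: "nat \<Rightarrow> real \<Rightarrow> real"
  assumes S: "S > 0"
    and cont: "\<And>k. continuous_on {0..S} (G k)"
    and der: "\<And>k x. 0 < x \<Longrightarrow> x < S \<Longrightarrow> (G k has_real_derivative G (Suc k) x) (at x)"
    and bnd: "\<And>k x. 0 \<le> x \<Longrightarrow> x \<le> S \<Longrightarrow> \<bar>G k x\<bar> \<le> C * L ^ k * fact k"
    and L: "L > 0" and sm: "summable (\<lambda>k. G k 0 / fact k * S ^ k)"
  shows "G 0 S = (\<Sum>k. G k 0 / fact k * S ^ k)"
proof -
  define a where "a = (\<lambda>k. G k 0 / fact k)"
  define \<psi> where "\<psi> = (\<lambda>k s. \<Sum>n. (diffs ^^ k) a n * s ^ n)"
  have sm0: "summable (\<lambda>n. a n * x ^ n)" if "\<bar>x\<bar> < S" for x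
    using powser_inside[of a S x] sm that S by (simp add: a_def)
  have smk: "summable (\<lambda>n. (diffs ^^ k) a n * x ^ n)" if "\<bar>x\<bar> < S" for x k
    using that
  proof (induction k arbitrary: x)
    case (Suc k)
    show ?case
      using termdiff_converges[of x S "(diffs ^^ k) a"] Suc by simp
  qed (simp add: sm0)
  have \<psi>der: "(\<psi> k has_real_derivative \<psi> (Suc k) x) (at x)" if "\<bar>x\<bar> < S" for k x
  proof -
    have "\<bar>x\<bar> < \<bar>(\<bar>x\<bar> + S) / 2\<bar>" using that by simp
    moreover have "\<bar>(\<bar>x\<bar> + S) / 2\<bar> < S" using that by simp
    ultimately show ?thesis
      unfolding \<psi>_def using termdiffs_strong[OF smk, of "(\<bar>x\<bar> + S) / 2" x k] by simp
  qed
  have \<psi>0: "\<psi> k 0 = G k 0" for k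
    unfolding \<psi>_def powser_zero by (simp add: diffs_iter a_def)
  have eq: "G 0 s = \<psi> 0 s" if s: "0 \<le> s" "s < S" for s
  proof (cases "s = 0")
    case False
    \<comment> \<open>Half of the remaining distance: the series converges absolutely at s + t,
      which yields Cauchy estimates with 1/t on [0, s].\<close>
    define t where "t = (S - s) / 2"
    have t: "t > 0" "s + t < S" using s by (auto simp: t_def field_simps)
    define C' where "C' = (\<Sum>n. \<bar>a n\<bar> * (s + t) ^ n)"
    have smC: "summable (\<lambda>n. \<bar>a n\<bar> * (s + t) ^ n)"
      using powser_insidea[of a S "s + t"] sm t s S
      by (simp add: a_def abs_mult power_abs)
    have C'0: "C' \<ge> 0" unfolding C'_def using s t by (intro suminf_nonneg smC) auto
    have \<psi>b: "\<bar>\<psi> k x\<bar> \<le> C' * (1/t) ^ k * fact k" if x: "0 \<le> x" "x \<le> s" for k x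
    proof -
      have pt: "norm ((diffs ^^ k) a n * x ^ n) \<le> fact k * (1/t) ^ k * (\<bar>a (n + k)\<bar> * (s + t) ^ (n + k))" for n
      proof -
        \<comment> \<open>The left side is one term in the binomial expansion of (t + x)^(n +
          k).\<close>
        have "real (n + k choose k) * x ^ n * t ^ k \<le> (\<Sum>j\<le>n + k. real (n + k choose j) * t ^ j * x ^ (n + k - j))"
          using member_le_sum[of k "{..n+k}" "\<lambda>j. real (n + k choose j) * t ^ j * x ^ (n + k - j)"] t x
          by (simp add: mult_ac)
        also have "\<dots> = (t + x) ^ (n + k)" by (simp add: binomial_ring)
        also have "\<dots> \<le> (s + t) ^ (n + k)" using x t by (intro power_mono) auto
        finally have "real (n + k choose k) * x ^ n \<le> (1/t) ^ k * (s + t) ^ (n + k)"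
          using t by (simp add: field_simps)
        then have "(fact k * \<bar>a (n + k)\<bar>) * (real (n + k choose k) * x ^ n) \<le> (fact k * \<bar>a (n + k)\<bar>) * ((1/t) ^ k * (s + t) ^ (n + k))"
          by (intro mult_left_mono) auto
        then show ?thesis using x by (simp add: diffs_iter abs_mult mult_ac)
      qed
      have sk: "summable (\<lambda>n. \<bar>a (n + k)\<bar> * (s + t) ^ (n + k))"
        using summable_ignore_initial_segment[OF smC] by simp
      have "norm (\<psi> k x) \<le> (\<Sum>n. fact k * (1/t) ^ k * (\<bar>a (n + k)\<bar> * (s + t) ^ (n + k)))"
        unfolding \<psi>_def by (intro norm_suminf_le pt summable_mult sk)
      also have "\<dots> = fact k * (1/t) ^ k * (\<Sum>n. \<bar>a (n + k)\<bar> * (s + t) ^ (n + k))"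
        by (rule suminf_mult[OF sk])
      also have "(\<Sum>n. \<bar>a (n + k)\<bar> * (s + t) ^ (n + k)) \<le> C'"
      proof -
        have "C' = (\<Sum>n. \<bar>a (n + k)\<bar> * (s + t) ^ (n + k)) + (\<Sum>n<k. \<bar>a n\<bar> * (s + t) ^ n)"
          unfolding C'_def by (rule suminf_split_initial_segment[OF smC])
        moreover have "(\<Sum>n<k. \<bar>a n\<bar> * (s + t) ^ n) \<ge> 0" using s t by (intro sum_nonneg) auto
        ultimately show ?thesis by simp
      qed
      finally show ?thesis using t by (simp add: mult_ac mult_left_mono)
    qed
    define M where "M = max L (1/t)"
    have M: "M > 0" "L \<le> M" "1/t \<le> M" using L by (auto simp: M_def)
    have C0: "C \<ge> 0" using bnd[of 0 0] S by simp
    define w where "w = (\<lambda>k x. G k x - \<psi> k x)"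
    have "w 0 s = 0"
    proof (rule analytic_bound_zero[where b=s and w=w and C="C + C'" and L=M])
      show "continuous_on {0..s} (w k)" for k
        unfolding w_def
      proof (intro continuous_on_diff)
        show "continuous_on {0..s} (G k)" using continuous_on_subset[OF cont] s by auto
        show "continuous_on {0..s} (\<psi> k)"
          using s by (intro DERIV_continuous_on) (auto intro: DERIV_subset[OF \<psi>der])
      qed
      show "(w k has_vector_derivative w (Suc k) x) (at x)" if "0 < x" "x < s" for k x
        unfolding w_def has_real_derivative_iff_has_vector_derivative[symmetric]
        using that s by (intro DERIV_diff der \<psi>der) auto
      show "norm (w k x) \<le> (C + C') * M ^ k * fact k" if "0 \<le> x" "x \<le> s" for k x
      proof -
        have "norm (w k x) \<le> C * L ^ k * fact k + C' * (1/t) ^ k * fact k"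
          using bnd[of x k] \<psi>b[of x k] that s unfolding w_def by simp
        also have "\<dots> \<le> C * M ^ k * fact k + C' * M ^ k * fact k"
          using M C0 C'0 L t by (intro add_mono mult_right_mono mult_left_mono power_mono) auto
        finally show ?thesis by (simp add: algebra_simps)
      qed
    qed (use \<psi>0 M s in \<open>auto simp: w_def\<close>)
    then show ?thesis by (simp add: w_def)
  qed (simp add: \<psi>0)
  have l1: "((\<lambda>x. \<Sum>k. (a k * S ^ k) * x ^ k) \<longlongrightarrow> (\<Sum>k. a k * S ^ k)) (at_left 1)"
    by (rule Abel_limit) (use sm in \<open>simp add: a_def\<close>)
  have l2: "((\<lambda>x. G 0 (S * x)) \<longlongrightarrow> G 0 S) (at_left 1)"
  proof -
    have "continuous_on {0..1} (\<lambda>x. G 0 (S * x))"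
      using S by (intro continuous_on_compose2[OF cont] continuous_intros) (auto simp: mult_le_cancel_left1)
    from this[unfolded continuous_on_def, rule_format, of 1]
    have "((\<lambda>x. G 0 (S * x)) \<longlongrightarrow> G 0 (S * 1)) (at 1 within {0..1})"
      by simp
    then show ?thesis by (simp add: at_within_Icc_at_left)
  qed
  have ev: "\<forall>\<^sub>F x in at_left 1. (\<Sum>k. (a k * S ^ k) * x ^ k) = G 0 (S * x)"
    unfolding eventually_at_left_field
  proof (intro exI[of _ 0] conjI allI impI)
    fix x :: real assume "0 < x" "x < 1"
    then show "(\<Sum>k. (a k * S ^ k) * x ^ k) = G 0 (S * x)"
      using eq[of "S * x"] S by (simp add: \<psi>_def power_mult_distrib mult.assoc)
  qed simp
  have "G 0 S = (\<Sum>k. a k * S ^ k)"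
    by (rule tendsto_unique[OF trivial_limit_at_left_real l2 Lim_transform_eventually[OF l1 ev]])
  then show ?thesis by (simp add: a_def)
qed

text \<open>In the variable \<open>s = r\<^sup>2\<close> the operator \<open>(1/r) d/dr\<close> becomes \<open>2 d/ds\<close>.\<close>
lemma radial_sums:
  fixes A :: "nat \<Rightarrow> real \<Rightarrow> 'b::euclidean_space"
  assumes R: "R \<ge> 0"
    and cont: "\<And>k. continuous_on {0..R} (A k)"
    and der: "\<And>k r. 0 < r \<Longrightarrow> r < R \<Longrightarrow> (A k has_vector_derivative r *\<^sub>R A (Suc k) r) (at r)"
    and bnd: "\<And>k r. 0 \<le> r \<Longrightarrow> r \<le> R \<Longrightarrow> norm (A k r) \<le> C * L ^ k * fact k"
    and L: "L > 0"
    and sm: "summable (\<lambda>k. (R ^ (2 * k) / (2 ^ k * fact k)) *\<^sub>R A k 0)"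
  shows "A 0 R = (\<Sum>k. (R ^ (2 * k) / (2 ^ k * fact k)) *\<^sub>R A k 0)"
proof (cases "R = 0")
  case True
  have "(\<Sum>k. (R ^ (2 * k) / (2 ^ k * fact k)) *\<^sub>R A k 0) = (\<Sum>k\<in>{0}. (R ^ (2 * k) / (2 ^ k * fact k)) *\<^sub>R A k 0)"
    by (rule suminf_finite) (auto simp: True power_0_left)
  then show ?thesis by (simp add: True)
next
  case False
  then have R: "R > 0" using R by simp
  show ?thesis
  proof (rule euclidean_eqI)
    fix b :: 'b assume b: "b \<in> Basis"
    define G where "G = (\<lambda>k s. (1/2) ^ k * (A k (sqrt s) \<bullet> b))"
    have coeff: "G k 0 / fact k * (R\<^sup>2) ^ k = ((R ^ (2 * k) / (2 ^ k * fact k)) *\<^sub>R A k 0) \<bullet> b" for k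
      by (simp add: G_def power_mult power_one_over)
    have bl: "bounded_linear (\<lambda>x. x \<bullet> b)" by (rule bounded_linear_inner_left)
    have "G 0 (R\<^sup>2) = (\<Sum>k. G k 0 / fact k * (R\<^sup>2) ^ k)"
    proof (rule analytic_bound_sums[where C=C and L="L/2"])
      show "continuous_on {0..R\<^sup>2} (G k)" for k
        unfolding G_def using R
        by (intro continuous_intros continuous_on_compose2[OF cont]) (auto simp: real_le_lsqrt)
      show "(G k has_real_derivative G (Suc k) x) (at x)" if x: "0 < x" "x < R\<^sup>2" for k x
      proof -
        have "0 < sqrt x" "sqrt x < R" using x R by (auto simp: real_less_lsqrt)
        then have "((\<lambda>r. A k r \<bullet> b) has_vector_derivative (sqrt x *\<^sub>R A (Suc k) (sqrt x)) \<bullet> b) (at (sqrt x))"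
          by (intro bounded_linear.has_vector_derivative[OF bl] der)
        then have "((\<lambda>r. A k r \<bullet> b) has_real_derivative sqrt x * (A (Suc k) (sqrt x) \<bullet> b)) (at (sqrt x))"
          by (simp add: has_real_derivative_iff_has_vector_derivative)
        from DERIV_chain2[OF this DERIV_real_sqrt[OF x(1)]]
        have "((\<lambda>x. A k (sqrt x) \<bullet> b) has_real_derivative sqrt x * (A (Suc k) (sqrt x) \<bullet> b) * (inverse (sqrt x) / 2)) (at x)" .
        then have "((\<lambda>x. (1/2) ^ k * (A k (sqrt x) \<bullet> b)) has_real_derivative
            (1/2) ^ k * (sqrt x * (A (Suc k) (sqrt x) \<bullet> b) * (inverse (sqrt x) / 2))) (at x)"
          by (rule DERIV_cmult)
        moreover have "(1/2) ^ k * (sqrt x * (A (Suc k) (sqrt x) \<bullet> b) * (inverse (sqrt x) / 2)) = G (Suc k) x"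
          using x by (simp add: G_def field_simps)
        moreover have "G k = (\<lambda>x. (1/2) ^ k * (A k (sqrt x) \<bullet> b))" by (simp add: G_def)
        ultimately show ?thesis by (simp only:)
      qed
      show "\<bar>G k x\<bar> \<le> C * (L/2) ^ k * fact k" if x: "0 \<le> x" "x \<le> R\<^sup>2" for k x
      proof -
        have "\<bar>A k (sqrt x) \<bullet> b\<bar> \<le> norm (A k (sqrt x))" using b by (rule Basis_le_norm)
        also have "\<dots> \<le> C * L ^ k * fact k" using x R by (intro bnd) (auto simp: real_le_lsqrt)
        finally have "(1/2) ^ k * \<bar>A k (sqrt x) \<bullet> b\<bar> \<le> (1/2) ^ k * (C * L ^ k * fact k)"
          by (intro mult_left_mono) auto
        then show ?thesis by (simp add: G_def abs_mult power_divide mult_ac)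
      qed
      show "summable (\<lambda>k. G k 0 / fact k * (R\<^sup>2) ^ k)"
        unfolding coeff by (rule bounded_linear.summable[OF bl sm])
    qed (use R L in auto)
    also have "\<dots> = (\<Sum>k. (R ^ (2 * k) / (2 ^ k * fact k)) *\<^sub>R A k 0) \<bullet> b"
      unfolding coeff by (rule bounded_linear.suminf[OF bl sm, symmetric])
    finally show "A 0 R \<bullet> b = (\<Sum>k. (R ^ (2 * k) / (2 ^ k * fact k)) *\<^sub>R A k 0) \<bullet> b"
      using R by (simp add: G_def)
  qed
qed

section \<open>Smooth functions and radial integrals\<close>

definition smooth :: "'e::euclidean_space set \<Rightarrow> ('e \<Rightarrow> 'b::euclidean_space) \<Rightarrow> bool" where
  "smooth S u \<longleftrightarrow> (\<forall>as\<in>lists Basis. C1 S (foldr pd as u))"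

lemma smooth_C1: "smooth S u \<Longrightarrow> C1 S u"
  unfolding smooth_def by (drule bspec[of _ _ "[]"]) auto

lemma smooth_pd: "smooth S u \<Longrightarrow> b \<in> Basis \<Longrightarrow> smooth S (pd b u)"
  unfolding smooth_def
proof
  fix as assume u: "\<forall>as\<in>lists Basis. C1 S (foldr pd as u)" and b: "b \<in> Basis" and as: "as \<in> lists (Basis :: 'a set)"
  have "C1 S (foldr pd (as @ [b]) u)" by (rule bspec[OF u]) (use as b in auto)
  then show "C1 S (foldr pd as (pd b u))" by simp
qed

text \<open>Coinduction over a class of C1 functions closed under partial derivatives. Closure is
  only asked for up to equality on S, because \<open>pd\<close> is uncontrolled outside.\<close>

lemma smooth_coinduct:
  assumes P: "P u"
    and C: "\<And>u. P u \<Longrightarrow> C1 S u"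
    and D: "\<And>u b. P u \<Longrightarrow> b \<in> Basis \<Longrightarrow> \<exists>w. P w \<and> (\<forall>x\<in>S. pd b u x = w x)"
  shows "smooth S u"
  unfolding smooth_def
proof
  fix as assume "as \<in> lists (Basis :: 'a set)"
  then have "\<exists>w. P w \<and> (\<forall>x\<in>S. foldr pd as u x = w x)"
  proof (induction as)
    case Nil
    then show ?case using P by auto
  next
    case (Cons b as)
    then obtain w where w: "P w" "\<And>x. x \<in> S \<Longrightarrow> foldr pd as u x = w x" by auto
    have "pd b (foldr pd as u) x = pd b w x" if "x \<in> S" for x
      by (rule pd_cong_open[OF C1D(1)[OF C[OF w(1)]] that w(2)])
    then show ?case using D[OF w(1) Cons.hyps(1)] by auto
  qed
  then show "C1 S (foldr pd as u)" using C C1_cong by metis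
qed

lemma smooth_add:
  assumes "smooth S u" "smooth S w"
  shows "smooth S (\<lambda>x. u x + w x)"
proof (rule smooth_coinduct[where P="\<lambda>f. \<exists>u w. smooth S u \<and> smooth S w \<and> f = (\<lambda>x. u x + w x)"])
  fix f :: "'a \<Rightarrow> 'b" and b assume "\<exists>u w. smooth S u \<and> smooth S w \<and> f = (\<lambda>x. u x + w x)" and b: "b \<in> (Basis :: 'a set)"
  then obtain u w where *: "smooth S u" "smooth S w" "f = (\<lambda>x. u x + w x)" by blast
  have "\<forall>x\<in>S. pd b f x = pd b u x + pd b w x"
    using pd_add[OF smooth_C1 smooth_C1 b] * by blast
  then show "\<exists>g. (\<exists>u w. smooth S u \<and> smooth S w \<and> g = (\<lambda>x. u x + w x)) \<and> (\<forall>x\<in>S. pd b f x = g x)"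
    using smooth_pd[OF *(1) b] smooth_pd[OF *(2) b] by (intro exI[of _ "\<lambda>x. pd b u x + pd b w x"]) blast
qed (use assms smooth_C1 C1_add in blast)+

lemma smooth_linear:
  fixes u :: "'a::euclidean_space \<Rightarrow> 'c::euclidean_space" and L :: "'c \<Rightarrow> 'b::euclidean_space"
  assumes L: "bounded_linear L" and "smooth S u"
  shows "smooth S (\<lambda>x. L (u x))"
proof (rule smooth_coinduct[where P="\<lambda>f. \<exists>u. smooth S u \<and> f = (\<lambda>x. L (u x))"])
  fix f :: "'a \<Rightarrow> 'b" and b assume "\<exists>u. smooth S u \<and> f = (\<lambda>x. L (u x))" and b: "b \<in> (Basis :: 'a set)"
  then obtain u where *: "smooth S u" "f = (\<lambda>x. L (u x))" by blast
  have "\<forall>x\<in>S. pd b f x = L (pd b u x)"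
    using pd_linear[OF L smooth_C1 b] * by blast
  then show "\<exists>g. (\<exists>u. smooth S u \<and> g = (\<lambda>x. L (u x))) \<and> (\<forall>x\<in>S. pd b f x = g x)"
    using smooth_pd[OF *(1) b] by (intro exI[of _ "\<lambda>x. L (pd b u x)"]) blast
qed (use assms smooth_C1 C1_linear in blast)+

lemma (in dirac) mono_on_smooth:
  assumes "mono_on S u"
  shows "smooth S u"
  by (rule smooth_coinduct[of "mono_on S"]) (use assms mono_on_pd mono_onD(1) in blast)+

lemma smooth_pd_commute:
  assumes "smooth S u" "a \<in> Basis" "b \<in> Basis" "x \<in> S"
  shows "pd a (pd b u) x = pd b (pd a u) x"
  using assms by (intro pd_commute[of S]) (auto intro: smooth_C1 smooth_pd)

lemma smooth_iter: "smooth S u \<Longrightarrow> a \<in> Basis \<Longrightarrow> smooth S ((pd a ^^ k) u)"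
  by (induction k) (auto intro: smooth_pd)

text \<open>Division by r made smooth: if u vanishes at r = 0, then \<open>J 0\<close> of its
  r-derivative is u / r. The weight appears because every r-derivative releases one factor
  t.\<close>

definition J :: "nat \<Rightarrow> ('a::euclidean_space \<times> real \<Rightarrow> 'b::euclidean_space) \<Rightarrow> 'a \<times> real \<Rightarrow> 'b" where
  "J k u z = integral (cbox 0 1) (\<lambda>t. t ^ k *\<^sub>R u (fst z, t * snd z))"

abbreviation pr :: "('a::euclidean_space \<times> real \<Rightarrow> 'b::real_normed_vector) \<Rightarrow> 'a \<times> real \<Rightarrow> 'b" where
  "pr u \<equiv> pd (0, 1) u"

text \<open>On functions even in the last variable r this is \<open>(1/r) d/dr\<close>; the integral makes sense at \<open>r = 0\<close>.\<close>
definition rdiv :: "('a::euclidean_space \<times> real \<Rightarrow> 'b::euclidean_space) \<Rightarrow> 'a \<times> real \<Rightarrow> 'b" where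
  "rdiv u = J 0 (pr (pr u))"

lemma Basis_pair_cases:
  assumes "b \<in> (Basis :: ('a::euclidean_space \<times> real) set)"
  obtains b' where "b = (b', 0)" "b' \<in> Basis" | "b = (0, 1)"
  using assms by (auto simp: Basis_prod_def)

lemma Basis_pairI [simp]: "((0::'a::euclidean_space), 1::real) \<in> Basis"
    "b \<in> Basis \<Longrightarrow> (b::'a, 0::real) \<in> Basis"
  by (auto simp: Basis_prod_def)

text \<open>The scaling condition puts the segment to r = 0 inside S, as needed for the integrals,
  and includes the reflection in r, as needed for parity.\<close>

locale tube =
  fixes S :: "('a::euclidean_space \<times> real) set"
  assumes open_S: "open S"
    and star: "\<And>y r t. (y, r) \<in> S \<Longrightarrow> \<bar>t\<bar> \<le> 1 \<Longrightarrow> (y, t * r) \<in> S"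
begin

lemma refl_S: "(y, r) \<in> S \<Longrightarrow> (y, - r) \<in> S" using star[of y r "- 1"] by simp

lemma zero_S: "(y, r) \<in> S \<Longrightarrow> (y, 0) \<in> S" using star[of y r 0] by simp

lemma J_cont_aux:
  fixes u :: "'a \<times> real \<Rightarrow> 'b::euclidean_space"
  assumes "continuous_on S u"
  shows "continuous_on (S \<times> {0..1}) (\<lambda>(z, t). t ^ k *\<^sub>R u (fst z, t * snd z))"
  unfolding split_beta
  by (intro continuous_intros continuous_on_compose2[OF assms]) (auto intro: star)

lemma J_continuous_on:
  assumes "continuous_on S u"
  shows "continuous_on S (J k u)"
  unfolding J_def using integral_continuous_on_param[of S 0 1 "\<lambda>z t. t ^ k *\<^sub>R u (fst z, t * snd z)"]
    J_cont_aux[OF assms, of k] by simp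

lemma haspd_J:
  assumes u: "C1 S u" and b: "b \<in> Basis" and z: "z \<in> S"
  shows "haspd (b, 0) (J k u) (J k (pd (b, 0) u) z) z"
  unfolding J_def
proof (rule haspd_integral[OF open_S z _ J_cont_aux J_cont_aux])
  fix x t assume x: "x \<in> S" and t: "t \<in> {0..1::real}"
  have S: "(fst x, t * snd x) \<in> S" using x t by (intro star) auto
  have "haspd (b, 0) (\<lambda>z. u (fst z, t * snd z)) (pd (b, 0) u (fst x, t * snd x)) x"
    using C1D(3)[OF u _ S, of "(b, 0)"] b unfolding haspd_def by simp
  then show "haspd (b, 0) (\<lambda>z. t ^ k *\<^sub>R u (fst z, t * snd z)) (t ^ k *\<^sub>R pd (b, 0) u (fst x, t * snd x)) x"
    by (intro haspd_linear[OF bounded_linear_scaleR_right])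
qed (use C1D[OF u] b in auto)

lemma haspd_J_r:
  assumes u: "C1 S u" and z: "z \<in> S"
  shows "haspd (0, 1) (J k u) (J (Suc k) (pr u) z) z"
  unfolding J_def
proof (rule haspd_integral[OF open_S z _ J_cont_aux J_cont_aux])
  fix x t assume x: "x \<in> S" and t: "t \<in> {0..1::real}"
  have S: "(fst x, t * snd x) \<in> S" using x t by (intro star) auto
  have "((\<lambda>s. u ((fst x, t * snd x) + s *\<^sub>R (0, 1))) \<circ> (\<lambda>s. t * s) has_vector_derivative t *\<^sub>R pr u (fst x, t * snd x)) (at 0)"
    using C1D(3)[OF u _ S, of "(0, 1)"] unfolding haspd_def
    by (intro vector_diff_chain_at) (auto intro!: derivative_eq_intros)
  then have "haspd (0, 1) (\<lambda>z. u (fst z, t * snd z)) (t *\<^sub>R pr u (fst x, t * snd x)) x"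
    unfolding haspd_def by (simp add: o_def distrib_left)
  from haspd_linear[OF bounded_linear_scaleR_right[of "t ^ k"] this]
  show "haspd (0, 1) (\<lambda>z. t ^ k *\<^sub>R u (fst z, t * snd z)) (t ^ Suc k *\<^sub>R pr u (fst x, t * snd x)) x"
    by (simp add: mult.commute)
qed (use C1D[OF u] in auto)

lemma J_C1:
  assumes u: "C1 S u"
  shows "C1 S (J k u)"
proof (rule C1I[OF open_S J_continuous_on[OF C1D(2)[OF u]],
    where u'="\<lambda>b. if b = (0, 1) then J (Suc k) (pr u) else J k (pd b u)"])
  show "haspd b (J k u) ((if b = (0, 1) then J (Suc k) (pr u) else J k (pd b u)) z) z"
    if "b \<in> Basis" "z \<in> S" for b z
    using that(1)
  proof (cases rule: Basis_pair_cases)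
    case (1 b')
    then show ?thesis using haspd_J[OF u _ that(2)] by auto
  next
    case 2
    then show ?thesis using haspd_J_r[OF u that(2)] by auto
  qed
qed (use C1D[OF u] in \<open>auto intro!: J_continuous_on\<close>)

text \<open>The integrals of all smooth u with all weights form a class closed under partial
  derivatives: an r-derivative raises the weight by one and the others leave it alone.\<close>

lemma J_smooth:
  assumes u: "smooth S u"
  shows "smooth S (J k u)"
proof (rule smooth_coinduct[where P="\<lambda>f. \<exists>u k. smooth S u \<and> f = J k u"])
  fix f b assume "\<exists>u k. smooth S u \<and> f = J k u" and b: "b \<in> (Basis :: ('a \<times> real) set)"
  then obtain u k where *: "smooth S u" "f = J k u" by blast
  from b show "\<exists>g. (\<exists>u k. smooth S u \<and> g = J k u) \<and> (\<forall>x\<in>S. pd b f x = g x)"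
  proof (cases rule: Basis_pair_cases)
    case (1 b')
    then show ?thesis using haspd_pd[OF haspd_J[OF smooth_C1[OF *(1)]]] smooth_pd[OF *(1) b]
      unfolding *(2) by blast
  next
    case 2
    then show ?thesis using haspd_pd[OF haspd_J_r[OF smooth_C1[OF *(1)]]] smooth_pd[OF *(1) b]
      unfolding *(2) by blast
  qed
qed (use u smooth_C1 J_C1 in blast)+

lemma rdiv_smooth: "smooth S u \<Longrightarrow> smooth S (rdiv u)"
  unfolding rdiv_def by (intro J_smooth smooth_pd) auto

lemma J_ftc:
  assumes u: "C1 S u" and z: "(y, r) \<in> S"
  shows "r *\<^sub>R J 0 (pr u) (y, r) = u (y, r) - u (y, 0)"
proof (cases "r = 0")
  case False
  have seg: "(y, 0) + t *\<^sub>R (r *\<^sub>R (0, 1)) \<in> S" if "t \<in> {0..1}" for t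
    using star[OF z, of t] that by simp
  have "J 0 (pr u) (y, r) = avg (r *\<^sub>R (0, 1)) (pr u) (y, 0)"
    by (simp add: J_def avg_def)
  also have "\<dots> = (1 / r) *\<^sub>R (u ((y, 0) + r *\<^sub>R (0, 1)) - u (y, 0))"
    by (rule avg_same_direction[OF u _ False seg]) simp
  finally show ?thesis using False by simp
qed simp

section \<open>Parity in the last variable: c = 1 for even and c = -1 for odd functions\<close>

definition parity :: "real \<Rightarrow> ('a \<times> real \<Rightarrow> 'b::real_vector) \<Rightarrow> bool" where
  "parity c u \<longleftrightarrow> (\<forall>y r. (y, r) \<in> S \<longrightarrow> u (y, - r) = c *\<^sub>R u (y, r))"

lemma haspd_reflect:
  "haspd (b, 0) u d (y, - r) \<Longrightarrow> haspd (b, 0) (\<lambda>z. u (fst z, - snd z)) d (y, r)"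
  unfolding haspd_def by simp

lemma haspd_reflect_r:
  fixes u :: "'a \<times> real \<Rightarrow> 'b::real_normed_vector"
  assumes "haspd (0, 1) u d (y, - r)"
  shows "haspd (0, 1) (\<lambda>z. u (fst z, - snd z)) (- d) (y, r)"
proof -
  have "((\<lambda>s. u ((y, - r) + s *\<^sub>R (0, 1))) \<circ> (\<lambda>s. - s) has_vector_derivative (- 1) *\<^sub>R d) (at 0)"
    using assms unfolding haspd_def
    by (intro vector_diff_chain_at) (auto intro!: derivative_eq_intros)
  moreover have "- s - r = - r - s" for s :: real by simp
  ultimately show ?thesis unfolding haspd_def by (simp add: o_def)
qed

lemma parity_pr:
  assumes u: "C1 S u" and p: "parity c u"
  shows "parity (- c) (pr u)"
  unfolding parity_def
proof (intro allI impI)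
  fix y r assume z: "(y, r) \<in> S"
  have "haspd (0, 1) (\<lambda>z. u (fst z, - snd z)) (- pr u (y, - r)) (y, r)"
    by (intro haspd_reflect_r C1D(3)[OF u] refl_S z) auto
  then have "haspd (0, 1) (\<lambda>z. c *\<^sub>R u z) (- pr u (y, - r)) (y, r)"
    by (rule haspd_cong_open[OF open_S z, rotated]) (use p in \<open>auto simp: parity_def\<close>)
  moreover have "haspd (0, 1) (\<lambda>z. c *\<^sub>R u z) (c *\<^sub>R pr u (y, r)) (y, r)"
    by (intro haspd_linear[OF bounded_linear_scaleR_right] C1D(3)[OF u] z) auto
  ultimately have "- pr u (y, - r) = c *\<^sub>R pr u (y, r)" using haspd_pd by metis
  then show "pr u (y, - r) = (- c) *\<^sub>R pr u (y, r)" by (metis minus_minus scaleR_minus_left)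
qed

lemma parity_pd:
  assumes u: "C1 S u" and p: "parity c u" and b: "b \<in> Basis"
  shows "parity c (pd (b, 0) u)"
  unfolding parity_def
proof (intro allI impI)
  fix y r assume z: "(y, r) \<in> S"
  have "haspd (b, 0) (\<lambda>z. u (fst z, - snd z)) (pd (b, 0) u (y, - r)) (y, r)"
    by (intro haspd_reflect C1D(3)[OF u] refl_S z) (use b in auto)
  then have "haspd (b, 0) (\<lambda>z. c *\<^sub>R u z) (pd (b, 0) u (y, - r)) (y, r)"
    by (rule haspd_cong_open[OF open_S z, rotated]) (use p in \<open>auto simp: parity_def\<close>)
  moreover have "haspd (b, 0) (\<lambda>z. c *\<^sub>R u z) (c *\<^sub>R pd (b, 0) u (y, r)) (y, r)"
    by (intro haspd_linear[OF bounded_linear_scaleR_right] C1D(3)[OF u] z) (use b in auto)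
  ultimately show "pd (b, 0) u (y, - r) = c *\<^sub>R pd (b, 0) u (y, r)" using haspd_pd by metis
qed

lemma parity_J: "parity 1 u \<Longrightarrow> parity 1 (J k u)"
  unfolding parity_def J_def
  by (intro allI impI) (simp, rule integral_cong, use star in \<open>auto simp: abs_le_iff\<close>)

lemma parity_rdiv: "smooth S u \<Longrightarrow> parity 1 u \<Longrightarrow> parity 1 (rdiv u)"
  unfolding rdiv_def
  using parity_pr[OF smooth_C1] parity_pr[OF smooth_C1[OF smooth_pd]]
  by (metis Basis_pairI(1) minus_minus parity_J)

text \<open>The r-derivative of an even function is odd, hence zero at r = 0, and
  \<open>J_ftc\<close> divides it by r.\<close>

lemma pr_even:
  assumes u: "smooth S u" and p: "parity 1 u" and z: "(y, r) \<in> S"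
  shows "pr u (y, r) = r *\<^sub>R rdiv u (y, r)"
proof -
  have "pr u (y, - 0) = (- 1) *\<^sub>R pr u (y, 0)"
    using parity_pr[OF smooth_C1[OF u] p] zero_S[OF z] unfolding parity_def by blast
  then have "2 *\<^sub>R pr u (y, 0) = 0" by (simp add: scaleR_2 eq_neg_iff_add_eq_0)
  then have "pr u (y, 0) = 0" by simp
  then show ?thesis
    unfolding rdiv_def using J_ftc[OF smooth_C1[OF smooth_pd[OF u]] z, of "(0, 1)"] by simp
qed

section \<open>Growth of radial integrals\<close>

lemma J_bound:
  assumes u: "continuous_on S u" and z: "(y, r) \<in> S"
    and B: "\<And>t. t \<in> {0..1} \<Longrightarrow> norm (u (y, t * r)) \<le> B"
  shows "norm (J k u (y, r)) \<le> B / (real k + 1)"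
proof -
  have c: "continuous_on {0..1} (\<lambda>t. t ^ k *\<^sub>R u (y, t * r))"
    using z by (intro continuous_intros continuous_on_compose2[OF u]) (auto intro!: star)
  have "((\<lambda>t. B / (real k + 1) * t ^ Suc k) has_vector_derivative t ^ k * B) (at t within {0..1})" for t
  proof -
    have "((\<lambda>t. B / (real k + 1) * t ^ Suc k) has_real_derivative B / (real k + 1) * (real (Suc k) * t ^ k)) (at t within {0..1})"
      by (rule DERIV_cmult) (use DERIV_pow[of "Suc k" t "{0..1}"] in simp)
    moreover have "B / (real k + 1) * (real (Suc k) * t ^ k) = t ^ k * B"
      by (simp add: add_nonneg_eq_0_iff add.commute)
    ultimately show ?thesis by (simp only: has_real_derivative_iff_has_vector_derivative)
  qed
  from fundamental_theorem_of_calculus[OF _ this]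
  have i: "((\<lambda>t. t ^ k * B) has_integral (B / (real k + 1))) {0..1}" by simp
  have "norm (integral {0..1} (\<lambda>t. t ^ k *\<^sub>R u (y, t * r))) \<le> integral {0..1} (\<lambda>t. t ^ k * B)"
  proof (rule integral_norm_bound_integral)
    show "(\<lambda>t. t ^ k *\<^sub>R u (y, t * r)) integrable_on {0..1}"
      using c by (rule integrable_continuous_real)
    show "norm (t ^ k *\<^sub>R u (y, t * r)) \<le> t ^ k * B" if "t \<in> {0..1}" for t
      using B[OF that] that by (simp add: mult_left_mono)
  qed (use i in auto)
  also have "\<dots> = B / (real k + 1)" by (rule integral_unique[OF i])
  finally show ?thesis unfolding J_def by simp
qed

lemma pr_iter_J:
  assumes u: "smooth S u"
  shows "z \<in> S \<Longrightarrow> (pd (0, 1) ^^ i) (J k u) z = J (k + i) ((pd (0, 1) ^^ i) u) z"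
proof (induction i arbitrary: z)
  case (Suc i)
  have "pr ((pd (0, 1) ^^ i) (J k u)) z = pr (J (k + i) ((pd (0, 1) ^^ i) u)) z"
    by (rule pd_cong_open[OF open_S Suc.prems Suc.IH])
  also have "\<dots> = J (Suc (k + i)) (pr ((pd (0, 1) ^^ i) u)) z"
    by (rule haspd_pd[OF haspd_J_r[OF smooth_C1[OF smooth_iter[OF u]] Suc.prems]]) simp
  finally show ?case by simp
qed simp

text \<open>After i derivatives the weight is t^(k + i), whose integral over [0, 1] is the gained
  factor.\<close>

lemma pr_iter_J_bound:
  assumes u: "smooth S u" and z: "(y, R) \<in> S"
    and B: "\<And>r. 0 \<le> r \<Longrightarrow> r \<le> R \<Longrightarrow> norm ((pd (0, 1) ^^ i) u (y, r)) \<le> B"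
    and r: "0 \<le> r" "r \<le> R"
  shows "norm ((pd (0, 1) ^^ i) (J k u) (y, r)) \<le> B / (real k + real i + 1)"
proof -
  have zr: "(y, r) \<in> S"
  proof (cases "R = 0")
    case False
    then show ?thesis using star[OF z, of "r / R"] r by simp
  qed (use z r in auto)
  have "norm (J (k + i) ((pd (0, 1) ^^ i) u) (y, r)) \<le> B / (real (k + i) + 1)"
  proof (rule J_bound[OF C1D(2)[OF smooth_C1[OF smooth_iter[OF u]]] zr])
    fix t :: real assume t: "t \<in> {0..1}"
    then have "t * r \<le> r" using r by (auto simp: mult_left_le_one_le)
    then show "norm ((pd (0, 1) ^^ i) u (y, t * r)) \<le> B" using t r by (intro B) auto
  qed simp
  then show ?thesis using pr_iter_J[OF u zr] by simp
qed

text \<open>The gain \<open>1/(i+1)\<close> in each step turns \<open>(2k)!\<close> into \<open>2^k k!\<close>.\<close>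
lemma rdiv_iter_bound:
  assumes u: "smooth S u" and z: "(y, R) \<in> S"
    and B: "\<And>i r. 0 \<le> r \<Longrightarrow> r \<le> R \<Longrightarrow> norm ((pd (0, 1) ^^ i) u (y, r)) \<le> C * L ^ i * fact i"
    and r: "0 \<le> r" "r \<le> R"
  shows "norm ((rdiv ^^ k) u (y, r)) \<le> C * (2 * L\<^sup>2) ^ k * fact k"
proof -
  have sm: "smooth S ((rdiv ^^ k) u)" for k
    by (induction k) (use u rdiv_smooth in auto)
  \<comment> \<open>All r-derivatives are bounded at once: each application of \<open>rdiv\<close>
    consumes two further derivatives of the preceding function, so the induction needs every
    i.\<close>
  have main: "norm ((pd (0, 1) ^^ i) ((rdiv ^^ k) u) (y, r))
      \<le> C * L ^ (i + 2 * k) * fact (i + 2 * k) / (\<Prod>l<k. real (i + 2 * l + 1))"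
    if "0 \<le> r" "r \<le> R" for i k r
    using that
  proof (induction k arbitrary: i r)
    case 0
    then show ?case using B by simp
  next
    case (Suc k)
    let ?w = "pr (pr ((rdiv ^^ k) u))"
    have "norm ((pd (0, 1) ^^ i) (J 0 ?w) (y, r)) \<le>
        C * L ^ (Suc (Suc i) + 2 * k) * fact (Suc (Suc i) + 2 * k) / (\<Prod>l<k. real (Suc (Suc i) + 2 * l + 1)) / (real 0 + real i + 1)"
    proof (rule pr_iter_J_bound[OF _ z _ Suc.prems])
      show "smooth S ?w" by (intro smooth_pd sm) auto
      fix r' assume r': "0 \<le> r'" "r' \<le> R"
      have "(pd (0, 1) ^^ i) ?w = (pd (0, 1) ^^ Suc (Suc i)) ((rdiv ^^ k) u)"
        by (simp add: funpow_swap1)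
      then show "norm ((pd (0, 1) ^^ i) ?w (y, r')) \<le>
        C * L ^ (Suc (Suc i) + 2 * k) * fact (Suc (Suc i) + 2 * k) / (\<Prod>l<k. real (Suc (Suc i) + 2 * l + 1))"
        using Suc.IH[OF r', of "Suc (Suc i)"] by simp
    qed
    moreover have "(\<Prod>l<Suc k. real (i + 2 * l + 1)) = (\<Prod>l<k. real (Suc (Suc i) + 2 * l + 1)) * (real 0 + real i + 1)"
      unfolding prod.lessThan_Suc_shift by (simp add: algebra_simps)
    moreover have "(pd (0, 1) ^^ i) ((rdiv ^^ Suc k) u) = (pd (0, 1) ^^ i) (J 0 ?w)"
      by (simp add: rdiv_def)
    moreover have "Suc (Suc i) + 2 * k = i + 2 * Suc k" by simp
    ultimately show ?case by (simp only: divide_divide_eq_left)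
  qed
  \<comment> \<open>The accumulated gains at i = 0 form (2k - 1)!!, and (2k - 1)!! times 2^k k! is
    (2k)!.\<close>
  have f: "(\<Prod>l<k. real (2 * l + 1)) * (2 ^ k * fact k) = fact (2 * k)" for k
  proof (induction k)
    case (Suc k)
    have "(\<Prod>l<Suc k. real (2 * l + 1)) * (2 ^ Suc k * fact (Suc k)) =
        ((\<Prod>l<k. real (2 * l + 1)) * (2 ^ k * fact k)) * (real (2 * k + 1) * (2 * real (Suc k)))"
      by (simp add: mult_ac)
    also have "\<dots> = fact (2 * Suc k)"
      unfolding Suc.IH by (simp add: algebra_simps)
    finally show ?case .
  qed simp
  have p: "(\<Prod>l<k. real (2 * l + 1)) > 0" by (intro prod_pos) auto
  have "norm ((rdiv ^^ k) u (y, r)) \<le> C * L ^ (2 * k) * fact (2 * k) / (\<Prod>l<k. real (2 * l + 1))"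
    using main[OF r, of 0 k] by simp
  also have "\<dots> = C * L ^ (2 * k) * (2 ^ k * fact k)"
    unfolding f[symmetric] using p by simp
  also have "\<dots> = C * (2 * L\<^sup>2) ^ k * fact k"
    by (simp add: power_mult_distrib power_mult)
  finally show ?thesis .
qed

end

section \<open>Slice functions\<close>

text \<open>Uniformity over K: cubes of one fixed size about the points of K lie in a compact
  neighbourhood of K, where u has a single supremum.\<close>

lemma (in dirac) mono_on_compact_bound:
  assumes u: "mono_on S u" and a: "a \<in> Basis" and K: "compact K" "K \<subseteq> S"
  obtains C L :: real where "L > 0" "\<And>k z. z \<in> K \<Longrightarrow> norm ((pd a ^^ k) u z) \<le> C * L ^ k * fact k"
proof -
  obtain d where d: "d > 0" "(\<Union>x\<in>K. cball x d) \<subseteq> S"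
    using compact_subset_open_imp_cball_epsilon_subset[OF K(1) C1D(1)[OF mono_onD(1)[OF u]] K(2)] by blast
  define K' where "K' = {x + y |x y. x \<in> K \<and> y \<in> cball 0 d}"
  have K'I: "y \<in> K'" if "x \<in> K" "y \<in> cball x d" for x y
    unfolding K'_def using that
    by (intro CollectI exI[of _ x] exI[of _ "y - x"]) (auto simp: dist_norm norm_minus_commute)
  have "K' \<subseteq> S"
  proof
    fix z assume "z \<in> K'"
    then obtain x y where "z = x + y" "x \<in> K" "y \<in> cball 0 d" unfolding K'_def by blast
    then have "z \<in> (\<Union>x\<in>K. cball x d)" by (intro UN_I[of x]) (auto simp: dist_norm)
    then show "z \<in> S" using d(2) by blast
  qed
  moreover have "compact K'" unfolding K'_def by (intro compact_sums K compact_cball)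
  ultimately have "bounded (u ` K')"
    using compact_continuous_image[OF continuous_on_subset[OF C1D(2)[OF mono_onD(1)[OF u]]]] compact_imp_bounded by blast
  then obtain M where M: "\<And>z. z \<in> K' \<Longrightarrow> norm (u z) \<le> M"
    unfolding bounded_iff by blast
  \<comment> \<open>With n the dimension, a cube of half-side d / n lies in the ball of radius d, by
    comparison with the l1 norm.\<close>
  define \<rho> where "\<rho> = d / DIM('e)"
  have \<rho>: "\<rho> > 0" using d by (simp add: \<rho>_def)
  have sub: "y \<in> cball x d" if "y \<in> cbox (x - \<rho> *\<^sub>R One) (x + \<rho> *\<^sub>R One)" for x y :: 'e
  proof -
    have "norm (y - x) \<le> (\<Sum>b\<in>Basis. \<bar>(y - x) \<bullet> b\<bar>)" by (rule norm_le_l1)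
    also have "\<dots> \<le> (\<Sum>b\<in>(Basis::'e set). \<rho>)" using that by (intro sum_mono) (auto simp: mem_cube)
    also have "\<dots> = d" by (simp add: \<rho>_def)
    finally show ?thesis by (simp add: dist_norm norm_minus_commute)
  qed
  show ?thesis
  proof (rule that[of "DIM('e) * exp 1 / \<rho>" M])
    show "DIM('e) * exp 1 / \<rho> > 0" using \<rho> by simp
    fix k z assume z: "z \<in> K"
    show "norm ((pd a ^^ k) u z) \<le> M * (DIM('e) * exp 1 / \<rho>) ^ k * fact k"
    proof (rule mono_on_iter_bound[OF u \<rho> a])
      show "cbox (z - \<rho> *\<^sub>R One) (z + \<rho> *\<^sub>R One) \<subseteq> S" using sub z d(2) by blast
      show "norm (u y) \<le> M" if "y \<in> cbox (z - \<rho> *\<^sub>R One) (z + \<rho> *\<^sub>R One)" for y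
        using M K'I[OF z sub[OF that]] by blast
    qed
  qed
qed

text \<open>The properties of the algebra that enter the analysis: squares and anticommutators of
  left multiplications by the \<open>v s\<close>. The vectors \<open>bs s\<close> serve as
  orthonormal coordinate axes for R^(p+1); the \<open>v s\<close> themselves need not be orthonormal
  for the inner product of the type.\<close>

locale frame =
  fixes mul :: "'a::euclidean_space \<Rightarrow> 'a \<Rightarrow> 'a" and v :: "nat \<Rightarrow> 'a" and m p :: nat and bs :: "nat \<Rightarrow> 'a"
  assumes bil: "bilinear mul"
    and v0: "\<And>w. mul (v 0) w = w"
    and vsq: "\<And>s w. 1 \<le> s \<Longrightarrow> s \<le> m \<Longrightarrow> mul (v s) (mul (v s) w) = - w"
    and vanti: "\<And>s t w. 1 \<le> s \<Longrightarrow> s \<le> m \<Longrightarrow> 1 \<le> t \<Longrightarrow> t \<le> m \<Longrightarrow> s \<noteq> t \<Longrightarrow>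
        mul (v s) (mul (v t) w) = - mul (v t) (mul (v s) w)"
    and pm: "p < m"
    and bs_inj: "inj_on bs {..p}" and bs_Basis: "\<And>s. s \<le> p \<Longrightarrow> bs s \<in> Basis"
begin

lemma lin_mul: "linear (mul a)" and lin_mul_left: "linear (\<lambda>a. mul a w)"
  using bil by (auto simp: bilinear_def)

lemma bl_mul: "bounded_linear (mul a)"
  using lin_mul linear_conv_bounded_linear by blast

lemmas mul_simps = linear_add[OF lin_mul] linear_diff[OF lin_mul] linear_0[OF lin_mul]
  linear_neg[OF lin_mul] linear_cmul[OF lin_mul] linear_add[OF lin_mul_left]
  linear_diff[OF lin_mul_left] linear_0[OF lin_mul_left] linear_neg[OF lin_mul_left]
  linear_cmul[OF lin_mul_left]

lemma mul_sum_left: "mul (\<Sum>s\<in>A. g s) w = (\<Sum>s\<in>A. mul (g s) w)"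
  by (rule linear_sum[OF lin_mul_left])

lemma mul_sum_right: "mul a (\<Sum>s\<in>A. g s) = (\<Sum>s\<in>A. mul a (g s))"
  by (rule linear_sum[OF lin_mul])

text \<open>Anticommutation removes the mixed products, so left multiplication by x_q behaves like r
  times an imaginary unit.\<close>

lemma xq_sq: "mul (xqpart v p m c) (mul (xqpart v p m c) w) = - ((rq p m c)\<^sup>2 *\<^sub>R w)"
proof -
  let ?I = "{p+1..m}"
  have "mul (xqpart v p m c) (mul (xqpart v p m c) w) =
      (\<Sum>s\<in>?I. \<Sum>t\<in>?I. - mul (v s) (mul (v t) (- (c s * c t) *\<^sub>R w)))"
    unfolding xqpart_def mul_sum_left mul_sum_right
    by (simp add: mul_simps sum_distrib_left scaleR_right.sum mult.commute)
       (subst sum.swap, simp add: mult.commute)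
  also have "\<dots> = (\<Sum>s\<in>?I. - (c s * c s) *\<^sub>R w)"
  proof (rule clifford_sum[where P="\<lambda>s t x. - mul (v s) (mul (v t) x)"])
    show "- mul (v i) (mul (v i) (- (c i * c i) *\<^sub>R w)) = - (c i * c i) *\<^sub>R w" if "i \<in> ?I" for i
      using that vsq[of i] by simp
    show "- mul (v i) (mul (v j) (- (c i * c j) *\<^sub>R w)) + - mul (v j) (mul (v i) (- (c i * c j) *\<^sub>R w)) = 0"
      if "i \<in> ?I" "j \<in> ?I" "i \<noteq> j" for i j
      using that vanti[of i j] by simp
  qed (auto simp: mult.commute)
  also have "\<dots> = - ((\<Sum>s\<in>?I. (c s)\<^sup>2) *\<^sub>R w)"
    by (simp add: scaleR_left.sum sum_negf power2_eq_square)
  also have "(\<Sum>s\<in>?I. (c s)\<^sup>2) = (rq p m c)\<^sup>2" by (simp add: rq_def sum_nonneg)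
  finally show ?thesis .
qed

lemma xq_anti:
  assumes "1 \<le> s" "s \<le> p"
  shows "mul (v s) (mul (xqpart v p m c) w) = - mul (xqpart v p m c) (mul (v s) w)"
  unfolding xqpart_def mul_sum_left mul_sum_right sum_negf[symmetric]
  using assms pm vanti[of s] by (intro sum.cong refl) (auto simp: mul_simps)

lemma Ssph_xq:
  assumes "\<omega> \<in> Ssph v p m"
  obtains c where "\<omega> = xqpart v p m c" "rq p m c = 1"
  using assms by (auto simp: Ssph_def xqpart_def rq_def)

lemma Ssph_neg:
  assumes "\<omega> \<in> Ssph v p m"
  shows "- \<omega> \<in> Ssph v p m"
proof -
  obtain c where "\<omega> = xqpart v p m c" "rq p m c = 1" using Ssph_xq[OF assms] by blast
  then show ?thesis unfolding Ssph_def xqpart_def rq_def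
    by (intro CollectI exI[of _ "\<lambda>s. - c s"]) (auto simp: sum_negf)
qed

lemma xq_unit:
  assumes "rq p m c > 0"
  shows "(1 / rq p m c) *\<^sub>R xqpart v p m c \<in> Ssph v p m"
  unfolding Ssph_def
proof (intro CollectI exI conjI)
  have rqs: "(rq p m c)\<^sup>2 = (\<Sum>s\<in>{p+1..m}. (c s)\<^sup>2)" by (simp add: rq_def sum_nonneg)
  show "(1 / rq p m c) *\<^sub>R xqpart v p m c = (\<Sum>s\<in>{p+1..m}. (c s / rq p m c) *\<^sub>R v s)"
    by (simp add: xqpart_def scaleR_right.sum)
  have "(\<Sum>s\<in>{p+1..m}. (c s / rq p m c)\<^sup>2) = (\<Sum>s\<in>{p+1..m}. (c s)\<^sup>2) / (rq p m c)\<^sup>2"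
    by (simp add: power_divide sum_divide_distrib)
  also have "\<dots> = 1" unfolding rqs[symmetric] using assms by simp
  finally show "(\<Sum>s\<in>{p+1..m}. (c s / rq p m c)\<^sup>2) = 1" .
qed

lemma om_sq: "\<omega> \<in> Ssph v p m \<Longrightarrow> mul \<omega> (mul \<omega> w) = - w"
  using xq_sq by (metis Ssph_xq power_one scaleR_one)

lemma om_anti: "\<omega> \<in> Ssph v p m \<Longrightarrow> 1 \<le> s \<Longrightarrow> s \<le> p \<Longrightarrow> mul (v s) (mul \<omega> w) = - mul \<omega> (mul (v s) w)"
  using xq_anti by (metis Ssph_xq)

text \<open>Passage from the orthonormal axes to the given frame. Surplus axes are sent to 0, so
  pullbacks along T do not depend on them.\<close>

definition T :: "'a \<Rightarrow> 'a" where "T y = (\<Sum>s\<le>p. (y \<bullet> bs s) *\<^sub>R v s)"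

lemma T_bs: "s \<le> p \<Longrightarrow> T (bs s) = v s"
proof -
  assume s: "s \<le> p"
  have "T (bs s) = (\<Sum>t\<le>p. if t = s then v s else 0)"
    unfolding T_def
  proof (intro sum.cong refl)
    fix t assume "t \<in> {..p}"
    then have "bs s = bs t \<longleftrightarrow> s = t" using inj_onD[OF bs_inj, of s t] s by auto
    then show "(bs s \<bullet> bs t) *\<^sub>R v t = (if t = s then v s else 0)"
      using bs_Basis[OF s] bs_Basis[of t] \<open>t \<in> {..p}\<close> by (auto simp: inner_Basis)
  qed
  then show ?thesis using s by simp
qed

lemma T_other: "b \<in> Basis \<Longrightarrow> b \<notin> bs ` {..p} \<Longrightarrow> T b = 0"
  unfolding T_def using bs_Basis by (intro sum.neutral) (auto simp: inner_Basis)

lemma T_add: "T (x + y) = T x + T y" and T_scale: "T (a *\<^sub>R x) = a *\<^sub>R T x"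
  by (simp_all add: T_def inner_add_left scaleR_left_distrib sum.distrib scaleR_right.sum)

lemma linear_T: "linear T"
  by (rule linearI) (simp_all add: T_add T_scale)

lemma T_span: "T y \<in> Rp1 v p"
  unfolding T_def Rp1_def by (intro span_sum span_scale span_base) auto

definition ei :: "nat \<Rightarrow> 'a \<times> real" where "ei i = (if i \<le> p then (bs i, 0) else (0, 1))"

definition Ei :: "'a \<Rightarrow> nat \<Rightarrow> 'a \<Rightarrow> 'a" where "Ei \<omega> i = (if i \<le> p then mul (v i) else mul \<omega>)"

text \<open>Left multiplication by \<open>v 0\<close> is the identity; every other coefficient
  squares to minus the identity, so its inverse is its negative.\<close>

definition Ebi :: "'a \<Rightarrow> nat \<Rightarrow> 'a \<Rightarrow> 'a" where
  "Ebi \<omega> i w = (if i = 0 then w else - Ei \<omega> i w)"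

lemma Ei_linear: "linear (Ei \<omega> i)"
  using lin_mul by (simp add: Ei_def)

lemma dirac_om:
  assumes om: "\<omega> \<in> Ssph v p m"
  shows "dirac (p + 2) ei (Ei \<omega>) (Ebi \<omega>)"
proof (rule dirac.intro)
  show "inj_on ei {..<p + 2}"
    using bs_inj by (auto simp: inj_on_def ei_def)
  show "ei i \<in> Basis" for i using bs_Basis by (auto simp: ei_def)
  show "linear (Ei \<omega> i)" for i by (rule Ei_linear)
  then show "linear (Ebi \<omega> i)" for i
    by (auto simp: Ebi_def linear_iff intro!: linearI)
  have sq: "Ei \<omega> i (Ei \<omega> i w) = - w" if "i \<noteq> 0" for i w
    using that pm om_sq[OF om] by (auto simp: Ei_def intro!: vsq)
  have an: "Ei \<omega> i (Ei \<omega> j w) = - Ei \<omega> j (Ei \<omega> i w)" if "i \<noteq> 0" "j \<noteq> 0" "i < p + 2" "j < p + 2" "i \<noteq> j" for i j w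
    using that pm om_anti[OF om, of i w] om_anti[OF om, of j w] vanti[of i j w] by (auto simp: Ei_def)
  have z: "Ei \<omega> 0 w = w" for w by (simp add: Ei_def v0)
  show "Ebi \<omega> i (Ei \<omega> i w) = w" for i w
    using sq[of i w] z by (simp add: Ebi_def)
  show "Ebi \<omega> i (Ei \<omega> j w) + Ebi \<omega> j (Ei \<omega> i w) = 0" if "i < p + 2" "j < p + 2" "i \<noteq> j" for i j w
    using that an[of i j w] z by (auto simp: Ebi_def)
qed

definition Dp :: "('a \<times> real \<Rightarrow> 'a) \<Rightarrow> 'a \<times> real \<Rightarrow> 'a" where
  "Dp u z = (\<Sum>s\<le>p. mul (v s) (pd (bs s, 0) u z))"

definition Db :: "('a \<times> real \<Rightarrow> 'a) \<Rightarrow> 'a \<times> real \<Rightarrow> 'a" where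
  "Db u z = pd (bs 0, 0) u z - (\<Sum>s\<in>{1..p}. mul (v s) (pd (bs s, 0) u z))"

definition Lp :: "('a \<times> real \<Rightarrow> 'a) \<Rightarrow> 'a \<times> real \<Rightarrow> 'a" where
  "Lp u z = (\<Sum>s\<le>p. pd (bs s, 0) (pd (bs s, 0) u) z)"

lemma sum_atMost_0: "(\<Sum>s\<le>p. g s) = g 0 + (\<Sum>s\<in>{1..p}. g s)" for g :: "nat \<Rightarrow> 'b::comm_monoid_add"
  by (simp add: atMost_atLeast0 sum.atLeast_Suc_atMost)

text \<open>Left multiplication by the conjugate of \<open>v s\<close>: the coefficients of the
  conjugate operator.\<close>

definition Lb :: "nat \<Rightarrow> 'a \<Rightarrow> 'a" where "Lb s w = (if s = 0 then w else - mul (v s) w)"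

lemma lin_Lb: "linear (Lb s)"
  unfolding Lb_def by (auto simp: mul_simps intro!: linearI)

lemma bl_Lb: "bounded_linear (Lb s)"
  using lin_Lb linear_conv_bounded_linear by blast

lemma Db_alt: "Db u z = (\<Sum>s\<le>p. Lb s (pd (bs s, 0) u z))"
  unfolding Db_def sum_atMost_0 by (simp add: Lb_def sum_negf)

lemma sum_Ei: "(\<Sum>i<p + 2. Ei \<omega> i (pd (ei i) u z)) = Dp u z + mul \<omega> (pr u z)"
proof -
  have "{..<p + 2} = insert (p + 1) {..p}" by auto
  then show ?thesis by (simp add: Dp_def Ei_def ei_def add.commute)
qed

lemma mono_iff:
  assumes "\<omega> \<in> Ssph v p m"
  shows "dirac.mono_on (p + 2) ei (Ei \<omega>) S u \<longleftrightarrow> C1 S u \<and> (\<forall>z\<in>S. Dp u z + mul \<omega> (pr u z) = 0) \<and>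
     (\<forall>z\<in>S. \<forall>b\<in>Basis - bs ` {..p}. pd (b, 0) u z = 0)"
proof -
  have "ei ` {..<p + 2} = insert (0, 1) ((\<lambda>i. (bs i, 0)) ` {..p})"
  proof -
    have "{..<p + 2} = insert (p + 1) {..p}" by auto
    then show ?thesis by (auto simp: ei_def)
  qed
  then have eq: "b \<in> Basis - ei ` {..<p + 2} \<longleftrightarrow> (\<exists>b'. b = (b', 0) \<and> b' \<in> Basis - bs ` {..p})" for b
    by (auto simp: Basis_prod_def)
  have "(\<forall>b\<in>Basis - ei ` {..<p + 2}. pd b u z = 0) \<longleftrightarrow> (\<forall>b\<in>Basis - bs ` {..p}. pd (b, 0) u z = 0)" for z
    unfolding Ball_def eq by blast
  then show ?thesis
    unfolding dirac.mono_on_def[OF dirac_om[OF assms]] sum_Ei by simp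
qed

lemma T_cont: "continuous_on A T"
  unfolding T_def by (intro continuous_intros)

text \<open>The derivative of f is given only within the slice. Short lines in the open set S are
  mapped into the slice, so the chain rule still yields two-sided partial derivatives of the
  pullback.\<close>

lemma slice_mono:
  assumes om: "\<omega> \<in> Ssph v p m" and mono: "gen_ps_monogenic mul v p m \<Omega> f"
    and S: "open S" "\<And>z. z \<in> S \<Longrightarrow> T (fst z) + snd z *\<^sub>R \<omega> \<in> \<Omega>"
  shows "dirac.mono_on (p + 2) ei (Ei \<omega>) S (\<lambda>z. f (T (fst z) + snd z *\<^sub>R \<omega>))"
proof -
  let ?\<Theta> = "\<lambda>z. T (fst z) + snd z *\<^sub>R \<omega>"
  let ?F = "\<lambda>z. f (?\<Theta> z)"
  let ?O = "Oslice \<Omega> v p \<omega>"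
  have vL: "v s \<in> Lslice v p \<omega>" if "s \<le> p" for s
    unfolding Lslice_def using that by (intro span_base) auto
  have omL: "\<omega> \<in> Lslice v p \<omega>" unfolding Lslice_def by (intro span_base) auto
  have TL: "?\<Theta> z \<in> Lslice v p \<omega>" for z
    unfolding Lslice_def
    using T_span[of "fst z"] span_mono[of "v ` {0..p}" "insert \<omega> (v ` {0..p})"]
    by (intro span_add span_scale span_base[of \<omega>]) (auto simp: Rp1_def)
  have in_O: "?\<Theta> z \<in> ?O" if "z \<in> S" for z using S(2)[OF that] TL by (simp add: Oslice_def)
  obtain f' where f': "\<And>y. y \<in> ?O \<Longrightarrow> (f has_derivative f' y) (at y within ?O)"
      "\<And>u. u \<in> Lslice v p \<omega> \<Longrightarrow> continuous_on ?O (\<lambda>y. f' y u)"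
      and eq: "\<And>y. y \<in> ?O \<Longrightarrow> Dxp mul v p f y + mul \<omega> (pd \<omega> f y) = 0"
    using mono om unfolding gen_ps_monogenic_def C1_on_def by blast
  have \<Theta>add: "?\<Theta> (z + t *\<^sub>R b) = ?\<Theta> z + t *\<^sub>R ?\<Theta> b" for z t b
    by (simp add: T_add T_scale algebra_simps)
  have pd_eq: "pd b ?F z = pd (?\<Theta> b) f (?\<Theta> z)" for b z
    unfolding pd_def \<Theta>add ..
  have hp: "haspd b ?F (f' (?\<Theta> z) (?\<Theta> b)) z" if z: "z \<in> S" for b z
  proof -
    let ?l = "\<lambda>t::real. ?\<Theta> z + t *\<^sub>R ?\<Theta> b"
    obtain \<delta> where \<delta>: "\<delta> > 0" "\<And>t. \<bar>t\<bar> < \<delta> \<Longrightarrow> z + t *\<^sub>R b \<in> S"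
      using eventually_line_open[OF S(1) z, of b] by (auto simp: eventually_nhds_metric dist_real_def)
    let ?U = "ball (0::real) \<delta>"
    have lO: "?l ` ?U \<subseteq> ?O"
      using in_O[OF \<delta>(2)] unfolding \<Theta>add by (auto simp: dist_real_def)
    have "(f has_derivative f' (?l 0)) (at (?l 0) within ?l ` ?U)"
      using has_derivative_subset[OF f'(1)[OF in_O[OF z]] lO] by simp
    moreover have "(?l has_derivative (\<lambda>t. t *\<^sub>R ?\<Theta> b)) (at 0 within ?U)"
      by (auto intro!: derivative_eq_intros)
    ultimately have "(f \<circ> ?l has_derivative f' (?l 0) \<circ> (\<lambda>t. t *\<^sub>R ?\<Theta> b)) (at 0 within ?U)"
      by (intro diff_chain_within)
    moreover have "linear (f' (?\<Theta> z))" using has_derivative_linear[OF f'(1)[OF in_O[OF z]]] .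
    ultimately have "((\<lambda>t. f (?l t)) has_derivative (\<lambda>t. t *\<^sub>R f' (?\<Theta> z) (?\<Theta> b))) (at 0)"
      using \<delta>(1) by (simp add: o_def linear_cmul at_within_open[of 0 ?U])
    then show ?thesis unfolding haspd_def has_vector_derivative_def \<Theta>add .
  qed
  have \<Theta>c: "continuous_on S ?\<Theta>"
    by (intro continuous_intros continuous_on_compose2[OF T_cont[of UNIV]]) auto
  have fc: "continuous_on ?O f"
    using f'(1) has_derivative_continuous_on by blast
  have C: "C1 S ?F"
  proof (rule C1I[OF S(1) _ hp])
    show "continuous_on S ?F"
      by (rule continuous_on_compose2[OF fc \<Theta>c]) (use in_O in auto)
    show "continuous_on S (\<lambda>z. f' (?\<Theta> z) (?\<Theta> b))" for b
      by (rule continuous_on_compose2[OF f'(2) \<Theta>c]) (use in_O TL in auto)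
  qed
  moreover have "Dp ?F z + mul \<omega> (pr ?F z) = 0" if "z \<in> S" for z
    \<comment> \<open>The instance \<open>T_scale[of 0 0]\<close> gives T 0 = 0, so the r-axis is
      mapped to \<omega>.\<close>
    using eq[OF in_O[OF that]] T_scale[of 0 0]
    by (simp add: Dp_def Dxp_def pd_eq T_bs)
  moreover have "pd (b, 0) ?F z = 0" if "b \<in> Basis - bs ` {..p}" for b z
  proof -
    have "pd (b, 0) ?F z = pd 0 f (?\<Theta> z)" unfolding pd_eq using T_other[of b] that by simp
    also have "\<dots> = 0" by (rule haspd_pd) (simp add: haspd_def)
    finally show ?thesis .
  qed
  ultimately show ?thesis unfolding mono_iff[OF om] by blast
qed

end

subsection \<open>The first-order operators on functions on the tube\<close>

locale frame_tube = frame mul v m p bs + tube S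
  for mul :: "'a::euclidean_space \<Rightarrow> 'a \<Rightarrow> 'a" and v :: "nat \<Rightarrow> 'a" and m p :: nat and bs :: "nat \<Rightarrow> 'a"
    and S :: "('a \<times> real) set"
begin

lemma bsB: "s \<le> p \<Longrightarrow> (bs s, 0::real) \<in> Basis"
  using bs_Basis by simp

lemma smooth_haspd: "smooth S u \<Longrightarrow> b \<in> Basis \<Longrightarrow> z \<in> S \<Longrightarrow> haspd b u (pd b u z) z"
  using C1D(3)[OF smooth_C1] .

lemma haspd_Dp:
  assumes "smooth S u" "b \<in> Basis" "z \<in> S"
  shows "haspd b (Dp u) (Dp (pd b u) z) z"
proof -
  have "haspd b (Dp u) (\<Sum>s\<le>p. mul (v s) (pd b (pd (bs s, 0) u) z)) z"
    unfolding Dp_def using assms bsB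
    by (intro haspd_sum haspd_linear[OF bl_mul] smooth_haspd smooth_pd) auto
  also have "(\<Sum>s\<le>p. mul (v s) (pd b (pd (bs s, 0) u) z)) = Dp (pd b u) z"
    unfolding Dp_def using smooth_pd_commute[OF assms(1,2) bsB assms(3)] by simp
  finally show ?thesis .
qed

lemma haspd_Db:
  assumes "smooth S u" "b \<in> Basis" "z \<in> S"
  shows "haspd b (Db u) (Db (pd b u) z) z"
proof -
  have "haspd b (Db u) (\<Sum>s\<le>p. Lb s (pd b (pd (bs s, 0) u) z)) z"
    unfolding Db_alt using assms bsB
    by (intro haspd_sum haspd_linear[OF bl_Lb] smooth_haspd smooth_pd) auto
  also have "(\<Sum>s\<le>p. Lb s (pd b (pd (bs s, 0) u) z)) = Db (pd b u) z"
    unfolding Db_alt using smooth_pd_commute[OF assms(1,2) bsB assms(3)] by simp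
  finally show ?thesis .
qed

lemma Lb_mul: 
  assumes "s \<le> p" "t \<le> p"
  shows "s \<noteq> t \<Longrightarrow> mul (v s) (Lb t w) + mul (v t) (Lb s w) = 0" "mul (v s) (Lb s w) = w"
    "s \<noteq> t \<Longrightarrow> Lb s (mul (v t) w) + Lb t (mul (v s) w) = 0" "Lb s (mul (v s) w) = w"
  using vsq[of s w] vanti[of s t w] assms pm v0
  by (auto simp: Lb_def mul_simps Suc_le_eq)

lemma Dp_Db:
  assumes u: "smooth S u" and z: "z \<in> S"
  shows "Dp (Db u) z = Lp u z"
proof -
  have "Dp (Db u) z = (\<Sum>s\<le>p. mul (v s) (Db (pd (bs s, 0) u) z))"
    unfolding Dp_def[of "Db u"] using haspd_pd[OF haspd_Db[OF u bsB z]] by simp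
  also have "\<dots> = (\<Sum>s\<le>p. \<Sum>t\<le>p. mul (v s) (Lb t (pd (bs t, 0) (pd (bs s, 0) u) z)))"
    unfolding Db_alt mul_sum_right ..
  also have "\<dots> = Lp u z"
    unfolding Lp_def
    by (rule clifford_sum) (use Lb_mul smooth_pd_commute[OF u bsB bsB z] in auto)
  finally show ?thesis .
qed

lemma Db_Dp:
  assumes u: "smooth S u" and z: "z \<in> S"
  shows "Db (Dp u) z = Lp u z"
proof -
  have "Db (Dp u) z = (\<Sum>s\<le>p. Lb s (Dp (pd (bs s, 0) u) z))"
    unfolding Db_alt[of "Dp u"] using haspd_pd[OF haspd_Dp[OF u bsB z]] by simp
  also have "\<dots> = (\<Sum>s\<le>p. \<Sum>t\<le>p. Lb s (mul (v t) (pd (bs t, 0) (pd (bs s, 0) u) z)))"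
    unfolding Dp_def linear_sum[OF lin_Lb] ..
  also have "\<dots> = Lp u z"
    unfolding Lp_def
    by (rule clifford_sum) (use Lb_mul smooth_pd_commute[OF u bsB bsB z] in auto)
  finally show ?thesis .
qed

lemma pd_transfer:
  assumes "z \<in> S" "\<And>z. z \<in> S \<Longrightarrow> u z = w z"
  shows "pd b u z = pd b w z"
  by (rule pd_cong_open[OF open_S assms])

lemma Dp_cong: "z \<in> S \<Longrightarrow> (\<And>z. z \<in> S \<Longrightarrow> u z = w z) \<Longrightarrow> Dp u z = Dp w z"
  unfolding Dp_def using pd_transfer by (metis (no_types, lifting))

lemma Db_cong: "z \<in> S \<Longrightarrow> (\<And>z. z \<in> S \<Longrightarrow> u z = w z) \<Longrightarrow> Db u z = Db w z"
  unfolding Db_alt using pd_transfer by (metis (no_types, lifting))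

text \<open>The coefficient \<open>h\<close> only depends on r, so it commutes with the operators in y.\<close>
lemma pd_y_coeff:
  assumes w: "smooth S w" "smooth S w'" and s: "s \<le> p" and z: "z \<in> S"
  shows "pd (bs s, 0) (\<lambda>z. c *\<^sub>R w z + h (snd z) *\<^sub>R w' z) z =
    c *\<^sub>R pd (bs s, 0) w z + h (snd z) *\<^sub>R pd (bs s, 0) w' z"
proof (rule haspd_pd)
  have "haspd (bs s, 0) (\<lambda>z. h (snd z) *\<^sub>R w' z) (h (snd z) *\<^sub>R pd (bs s, 0) w' z) z"
    using haspd_linear[OF bounded_linear_scaleR_right[of "h (snd z)"] smooth_haspd[OF w(2) bsB[OF s] z]]
    unfolding haspd_def by simp
  then show "haspd (bs s, 0) (\<lambda>z. c *\<^sub>R w z + h (snd z) *\<^sub>R w' z)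
      (c *\<^sub>R pd (bs s, 0) w z + h (snd z) *\<^sub>R pd (bs s, 0) w' z) z"
    by (intro haspd_add haspd_linear[OF bounded_linear_scaleR_right] smooth_haspd[OF w(1) bsB[OF s] z])
qed

lemma Dp_coeff:
  assumes w: "smooth S w" "smooth S w'" and z: "z \<in> S"
  shows "Dp (\<lambda>z. c *\<^sub>R w z + h (snd z) *\<^sub>R w' z) z = c *\<^sub>R Dp w z + h (snd z) *\<^sub>R Dp w' z"
  unfolding Dp_def using pd_y_coeff[OF w _ z]
  by (simp add: mul_simps sum.distrib scaleR_right.sum)

lemma Db_coeff:
  assumes w: "smooth S w" "smooth S w'" and z: "z \<in> S"
  shows "Db (\<lambda>z. c *\<^sub>R w z + h (snd z) *\<^sub>R w' z) z = c *\<^sub>R Db w z + h (snd z) *\<^sub>R Db w' z"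
  unfolding Db_alt using pd_y_coeff[OF w _ z]
  by (simp add: linear_add[OF lin_Lb] linear_cmul[OF lin_Lb] sum.distrib scaleR_right.sum)

lemma smooth_continuous: "smooth S u \<Longrightarrow> continuous_on S u"
  using C1D(2)[OF smooth_C1] .

lemma Dp_continuous: "smooth S u \<Longrightarrow> continuous_on S (Dp u)"
  unfolding Dp_def[abs_def] using bsB
  by (intro continuous_on_sum bounded_linear.continuous_on[OF bl_mul] smooth_continuous smooth_pd) auto

lemma Db_continuous: "smooth S u \<Longrightarrow> continuous_on S (Db u)"
  unfolding Db_alt[abs_def] using bsB
  by (intro continuous_on_sum bounded_linear.continuous_on[OF bl_Lb] smooth_continuous smooth_pd) auto

text \<open>Relations found by cancelling r are valid only for r nonzero; continuity along the
  r-axis extends them.\<close>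

lemma eq_at_zero:
  fixes g h :: "'a \<times> real \<Rightarrow> 'a"
  assumes g: "continuous_on S g" and h: "continuous_on S h"
    and eq: "\<And>y r. (y, r) \<in> S \<Longrightarrow> r \<noteq> 0 \<Longrightarrow> g (y, r) = h (y, r)" and z: "z \<in> S"
  shows "g z = h z"
proof (cases "snd z = 0")
  case True
  have ev: "\<forall>\<^sub>F t in at (0::real). z + t *\<^sub>R (0, 1) \<in> S"
    using eventually_line_open[OF open_S z, of "(0, 1)"] by (simp add: eventually_nhds_conv_at)
  have lim: "((\<lambda>t. k (z + t *\<^sub>R (0, 1))) \<longlongrightarrow> k z) (at (0::real))" if "continuous_on S k" for k :: "'a \<times> real \<Rightarrow> 'a"
  proof -
    have "isCont k z" using that z open_S continuous_on_eq_continuous_at by blast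
    moreover have "((\<lambda>t. z + t *\<^sub>R (0, 1)) \<longlongrightarrow> z + 0 *\<^sub>R (0, 1)) (at (0::real))" by (intro tendsto_intros)
    then have "((\<lambda>t. z + t *\<^sub>R (0, 1)) \<longlongrightarrow> z) (at (0::real))" by (simp only: scaleR_zero_left add_0_right)
    ultimately show ?thesis by (rule isCont_tendsto_compose)
  qed
  have "\<forall>\<^sub>F t in at (0::real). t \<noteq> 0" by (simp add: eventually_at_filter)
  with ev have "\<forall>\<^sub>F t in at (0::real). g (z + t *\<^sub>R (0, 1)) = h (z + t *\<^sub>R (0, 1))"
  proof eventually_elim
    case (elim t)
    then show ?case using eq[of "fst z" "snd z + t"] True by (cases z) auto
  qed
  from Lim_transform_eventually[OF lim[OF g] this] show ?thesis
    using tendsto_unique[OF trivial_limit_at lim[OF h]] by auto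
next
  case False
  then show ?thesis using eq[of "fst z" "snd z"] z by simp
qed

end

subsection \<open>Sequences generated by the radial derivative\<close>

text \<open>No imaginary unit occurs in these assumptions: they describe the part of a monogenic
  function that is the same on all slices.\<close>

locale radial_pair = frame_tube mul v m p bs S
  for mul :: "'a::euclidean_space \<Rightarrow> 'a \<Rightarrow> 'a" and v :: "nat \<Rightarrow> 'a" and m p :: nat and bs :: "nat \<Rightarrow> 'a"
    and S :: "('a \<times> real) set" +
  fixes \<alpha> \<beta> :: "'a \<times> real \<Rightarrow> 'a"
  assumes sm_al: "smooth S \<alpha>" and sm_be: "smooth S \<beta>"
    and par_al: "parity 1 \<alpha>" and par_be: "parity (- 1) \<beta>"
    and cr1: "\<And>z. z \<in> S \<Longrightarrow> Dp \<alpha> z = pr \<beta> z"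
    and cr2: "\<And>z. z \<in> S \<Longrightarrow> Db \<beta> z = - pr \<alpha> z"
begin

definition A :: "nat \<Rightarrow> 'a \<times> real \<Rightarrow> 'a" where "A i = (rdiv ^^ i) \<alpha>"
text \<open>The starting term is the smooth extension of \<beta>/r.\<close>

definition E :: "nat \<Rightarrow> 'a \<times> real \<Rightarrow> 'a" where "E i = (rdiv ^^ i) (J 0 (pr \<beta>))"

lemma A_smooth: "smooth S (A i)"
  unfolding A_def by (induction i) (use sm_al rdiv_smooth in auto)

lemma E_smooth: "smooth S (E i)"
  unfolding E_def by (induction i) (auto intro!: rdiv_smooth J_smooth smooth_pd sm_be)

lemma A_parity: "parity 1 (A i)"
proof (induction i)
  case (Suc i)
  then show ?case using parity_rdiv[OF A_smooth] by (simp add: A_def)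
qed (simp add: A_def par_al)

lemma E_parity: "parity 1 (E i)"
proof (induction i)
  case 0
  have "parity (- (- 1)) (pr \<beta>)" by (rule parity_pr[OF smooth_C1[OF sm_be] par_be])
  then show ?case by (simp add: E_def parity_J)
next
  case (Suc i)
  then show ?case using parity_rdiv[OF E_smooth] by (simp add: E_def)
qed

lemma pr_A: "z \<in> S \<Longrightarrow> pr (A i) z = snd z *\<^sub>R A (Suc i) z"
  using pr_even[OF A_smooth A_parity, of "fst z" "snd z" i] by (simp add: A_def)

lemma pr_E: "z \<in> S \<Longrightarrow> pr (E i) z = snd z *\<^sub>R E (Suc i) z"
  using pr_even[OF E_smooth E_parity, of "fst z" "snd z" i] by (simp add: E_def)

lemma beta_zero: "(y, 0) \<in> S \<Longrightarrow> \<beta> (y, 0) = 0"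
proof -
  assume "(y, 0) \<in> S"
  then have "\<beta> (y, - 0) = (- 1) *\<^sub>R \<beta> (y, 0)" using par_be unfolding parity_def by blast
  then have "2 *\<^sub>R \<beta> (y, 0) = 0" by (simp add: scaleR_2 eq_neg_iff_add_eq_0)
  then show ?thesis by simp
qed

lemma beta_E: "z \<in> S \<Longrightarrow> \<beta> z = snd z *\<^sub>R E 0 z"
  using J_ftc[OF smooth_C1[OF sm_be], of "fst z" "snd z"] beta_zero[of "fst z"] zero_S[of "fst z" "snd z"]
  by (simp add: E_def)

lemma haspd_r_coeff:
  assumes w: "smooth S w" and z: "z \<in> S" and h: "(h has_real_derivative h') (at (snd z))"
  shows "haspd (0, 1) (\<lambda>z. h (snd z) *\<^sub>R w z) (h (snd z) *\<^sub>R pr w z + h' *\<^sub>R w z) z"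
proof -
  have "((\<lambda>t. h (snd z + t)) has_real_derivative h') (at 0)"
    using DERIV_shift[of h h' 0 "snd z"] h by (simp add: add.commute)
  from has_vector_derivative_scaleR[OF this smooth_haspd[OF w _ z, of "(0, 1)", unfolded haspd_def]]
  show ?thesis unfolding haspd_def by (simp add: zero_prod_def[symmetric])
qed

text \<open>Induction by applying the r-derivative: it commutes with the operators in y and sends
  each term of the sequences to r times the next, after which r is cancelled. Differentiating the
  coefficient \<open>(snd z)\<^sup>2\<close> contributes 2r and raises 2i + 1 to 2i + 3.\<close>

lemma D_relations:
  "z \<in> S \<Longrightarrow> Dp (A i) z = (2 * real i + 1) *\<^sub>R E i z + (snd z)\<^sup>2 *\<^sub>R E (Suc i) z \<and> Db (E i) z = - A (Suc i) z"
proof (induction i arbitrary: z)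
  case 0
  have 1: "Dp (A 0) z = E 0 z + (snd z)\<^sup>2 *\<^sub>R E (Suc 0) z"
  proof -
    have "haspd (0, 1) (\<lambda>z. snd z *\<^sub>R E 0 z) (snd z *\<^sub>R pr (E 0) z + 1 *\<^sub>R E 0 z) z"
      using haspd_r_coeff[OF E_smooth 0 DERIV_ident] by simp
    then have "pr (\<lambda>z. snd z *\<^sub>R E 0 z) z = E 0 z + (snd z)\<^sup>2 *\<^sub>R E (Suc 0) z"
      using haspd_pd pr_E[OF 0] by (fastforce simp: power2_eq_square)
    moreover have "pr \<beta> z = pr (\<lambda>z. snd z *\<^sub>R E 0 z) z"
      by (rule pd_transfer[OF 0 beta_E])
    ultimately show ?thesis using cr1[OF 0] by (simp add: A_def)
  qed
  have 2: "Db (E 0) z = - A (Suc 0) z"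
  proof (rule eq_at_zero[OF Db_continuous[OF E_smooth] _ _ 0])
    show "continuous_on S (\<lambda>z. - A (Suc 0) z)" by (intro continuous_intros smooth_continuous A_smooth)
    fix y r assume z: "(y, r) \<in> S" and r: "r \<noteq> (0::real)"
    have "Db \<beta> (y, r) = Db (\<lambda>z. 0 *\<^sub>R E 0 z + snd z *\<^sub>R E 0 z) (y, r)"
      by (rule Db_cong[OF z]) (simp add: beta_E)
    also have "\<dots> = r *\<^sub>R Db (E 0) (y, r)"
      using Db_coeff[OF E_smooth E_smooth z, of 0 0 "\<lambda>r. r" 0] by simp
    finally have "r *\<^sub>R Db (E 0) (y, r) = r *\<^sub>R (- A (Suc 0) (y, r))"
      using cr2[OF z] pr_A[OF z, of 0] by (simp add: A_def)
    then show "Db (E 0) (y, r) = - A (Suc 0) (y, r)" using r by (metis scaleR_left_imp_eq)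
  qed
  show ?case using 1 2 by simp
next
  case (Suc i)
  have 1: "Dp (A (Suc i)) z = (2 * real (Suc i) + 1) *\<^sub>R E (Suc i) z + (snd z)\<^sup>2 *\<^sub>R E (Suc (Suc i)) z"
  proof (rule eq_at_zero[OF Dp_continuous[OF A_smooth] _ _ Suc.prems])
    show "continuous_on S (\<lambda>z. (2 * real (Suc i) + 1) *\<^sub>R E (Suc i) z + (snd z)\<^sup>2 *\<^sub>R E (Suc (Suc i)) z)"
      by (intro continuous_intros smooth_continuous E_smooth)
    fix y r assume z: "(y, r) \<in> S" and r: "r \<noteq> (0::real)"
    have "pr (Dp (A i)) (y, r) = Dp (pr (A i)) (y, r)"
      by (rule haspd_pd[OF haspd_Dp[OF A_smooth _ z]]) simp
    also have "\<dots> = Dp (\<lambda>z. 0 *\<^sub>R A 0 z + snd z *\<^sub>R A (Suc i) z) (y, r)"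
      by (rule Dp_cong[OF z]) (simp add: pr_A)
    also have "\<dots> = r *\<^sub>R Dp (A (Suc i)) (y, r)"
      using Dp_coeff[OF A_smooth A_smooth z, of 0 0 "\<lambda>r. r" "Suc i"] by simp
    finally have l: "pr (Dp (A i)) (y, r) = r *\<^sub>R Dp (A (Suc i)) (y, r)" .
    have "haspd (0, 1) (\<lambda>z. (2 * real i + 1) *\<^sub>R E i z + (snd z)\<^sup>2 *\<^sub>R E (Suc i) z)
       ((2 * real i + 1) *\<^sub>R pr (E i) (y, r) + (r\<^sup>2 *\<^sub>R pr (E (Suc i)) (y, r) + (2 * r) *\<^sub>R E (Suc i) (y, r))) (y, r)"
    proof (intro haspd_add haspd_linear[OF bounded_linear_scaleR_right] smooth_haspd E_smooth z)
      have "((\<lambda>r. r\<^sup>2) has_real_derivative 2 * r) (at (snd (y, r)))"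
        by (auto intro!: derivative_eq_intros)
      from haspd_r_coeff[OF E_smooth z this]
      show "haspd (0, 1) (\<lambda>z. (snd z)\<^sup>2 *\<^sub>R E (Suc i) z) (r\<^sup>2 *\<^sub>R pr (E (Suc i)) (y, r) + (2 * r) *\<^sub>R E (Suc i) (y, r)) (y, r)"
        by simp
    qed simp
    then have "pr (\<lambda>z. (2 * real i + 1) *\<^sub>R E i z + (snd z)\<^sup>2 *\<^sub>R E (Suc i) z) (y, r) =
       (2 * real i + 1) *\<^sub>R pr (E i) (y, r) + (r\<^sup>2 *\<^sub>R pr (E (Suc i)) (y, r) + (2 * r) *\<^sub>R E (Suc i) (y, r))"
      by (rule haspd_pd)
    also have "\<dots> = r *\<^sub>R ((2 * real (Suc i) + 1) *\<^sub>R E (Suc i) (y, r) + r\<^sup>2 *\<^sub>R E (Suc (Suc i)) (y, r))"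
      using pr_E[OF z] scaleR_left_distrib[of r "r * 2" "E (Suc i) (y, r)"] by (simp add: algebra_simps)
    also have "pr (\<lambda>z. (2 * real i + 1) *\<^sub>R E i z + (snd z)\<^sup>2 *\<^sub>R E (Suc i) z) (y, r) = pr (Dp (A i)) (y, r)"
      by (rule pd_transfer[OF z, symmetric]) (use Suc.IH in blast)
    finally have "r *\<^sub>R Dp (A (Suc i)) (y, r) = r *\<^sub>R ((2 * real (Suc i) + 1) *\<^sub>R E (Suc i) (y, r) + r\<^sup>2 *\<^sub>R E (Suc (Suc i)) (y, r))"
      using l by simp
    then show "Dp (A (Suc i)) (y, r) = (2 * real (Suc i) + 1) *\<^sub>R E (Suc i) (y, r) + (snd (y, r))\<^sup>2 *\<^sub>R E (Suc (Suc i)) (y, r)"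
      using r by (metis scaleR_left_imp_eq snd_conv)
  qed
  have 2: "Db (E (Suc i)) z = - A (Suc (Suc i)) z"
  proof (rule eq_at_zero[OF Db_continuous[OF E_smooth] _ _ Suc.prems])
    show "continuous_on S (\<lambda>z. - A (Suc (Suc i)) z)" by (intro continuous_intros smooth_continuous A_smooth)
    fix y r assume z: "(y, r) \<in> S" and r: "r \<noteq> (0::real)"
    have "pr (Db (E i)) (y, r) = Db (pr (E i)) (y, r)"
      by (rule haspd_pd[OF haspd_Db[OF E_smooth _ z]]) simp
    also have "\<dots> = Db (\<lambda>z. 0 *\<^sub>R E 0 z + snd z *\<^sub>R E (Suc i) z) (y, r)"
      by (rule Db_cong[OF z]) (simp add: pr_E)
    also have "\<dots> = r *\<^sub>R Db (E (Suc i)) (y, r)"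
      using Db_coeff[OF E_smooth E_smooth z, of 0 0 "\<lambda>r. r" "Suc i"] by simp
    finally have l: "pr (Db (E i)) (y, r) = r *\<^sub>R Db (E (Suc i)) (y, r)" .
    have "pr (Db (E i)) (y, r) = pr (\<lambda>z. - A (Suc i) z) (y, r)"
      by (rule pd_transfer[OF z]) (use Suc.IH in blast)
    also have "\<dots> = - pr (A (Suc i)) (y, r)"
      by (rule haspd_pd[OF haspd_linear[OF bounded_linear_minus[OF bounded_linear_ident] smooth_haspd[OF A_smooth _ z]]]) simp
    finally have "r *\<^sub>R Db (E (Suc i)) (y, r) = r *\<^sub>R (- A (Suc (Suc i)) (y, r))"
      using l pr_A[OF z] by simp
    then show "Db (E (Suc i)) (y, r) = - A (Suc (Suc i)) (y, r)" using r by (metis scaleR_left_imp_eq)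
  qed
  show ?case using 1 2 by blast
qed

lemmas Dp_A = D_relations[THEN conjunct1] and Db_E = D_relations[THEN conjunct2]

lemma Lp_A:
  assumes z: "z \<in> S"
  shows "Lp (A i) z = - ((2 * real i + 1) *\<^sub>R A (Suc i) z + (snd z)\<^sup>2 *\<^sub>R A (Suc (Suc i)) z)"
proof -
  have "Lp (A i) z = Db (Dp (A i)) z" by (rule Db_Dp[OF A_smooth z, symmetric])
  also have "\<dots> = Db (\<lambda>z. (2 * real i + 1) *\<^sub>R E i z + (snd z)\<^sup>2 *\<^sub>R E (Suc i) z) z"
    by (rule Db_cong[OF z Dp_A])
  also have "\<dots> = (2 * real i + 1) *\<^sub>R Db (E i) z + (snd z)\<^sup>2 *\<^sub>R Db (E (Suc i)) z"
    by (rule Db_coeff[OF E_smooth E_smooth z])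
  finally show ?thesis using Db_E[OF z] by simp
qed

text \<open>The constant is 2i + 3, not 2i + 1, because the conjugate operator moves to index i + 1
  before \<open>Dp\<close> acts.\<close>

lemma Lp_E:
  assumes z: "z \<in> S"
  shows "Lp (E i) z = - ((2 * real i + 3) *\<^sub>R E (Suc i) z + (snd z)\<^sup>2 *\<^sub>R E (Suc (Suc i)) z)"
proof -
  have "Lp (E i) z = Dp (Db (E i)) z" by (rule Dp_Db[OF E_smooth z, symmetric])
  also have "\<dots> = Dp (\<lambda>z. (- 1) *\<^sub>R A (Suc i) z + 0 *\<^sub>R A 0 z) z"
    by (rule Dp_cong[OF z]) (simp add: Db_E)
  also have "\<dots> = (- 1) *\<^sub>R Dp (A (Suc i)) z + 0 *\<^sub>R Dp (A 0) z"
    by (rule Dp_coeff[OF A_smooth A_smooth z, where h="\<lambda>_. 0"])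
  finally show ?thesis using Dp_A[OF z] by (simp add: algebra_simps)
qed

end

subsection \<open>The representation formula\<close>

context tube
begin

lemma pr_iter_add:
  assumes "smooth S u" "smooth S w"
  shows "z \<in> S \<Longrightarrow> (pd (0, 1) ^^ i) (\<lambda>z. u z + w z) z = (pd (0, 1) ^^ i) u z + (pd (0, 1) ^^ i) w z"
proof (induction i arbitrary: z)
  case (Suc i)
  have "pr ((pd (0, 1) ^^ i) (\<lambda>z. u z + w z)) z = pr (\<lambda>z. (pd (0, 1) ^^ i) u z + (pd (0, 1) ^^ i) w z) z"
    by (rule pd_cong_open[OF open_S Suc.prems Suc.IH])
  also have "\<dots> = pr ((pd (0, 1) ^^ i) u) z + pr ((pd (0, 1) ^^ i) w) z"
    using assms Suc.prems by (intro pd_add[OF smooth_C1 smooth_C1] smooth_iter) auto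
  finally show ?case by simp
qed simp

lemma pr_iter_linear:
  assumes L: "bounded_linear L" and u: "smooth S u"
  shows "z \<in> S \<Longrightarrow> (pd (0, 1) ^^ i) (\<lambda>z. L (u z)) z = L ((pd (0, 1) ^^ i) u z)"
proof (induction i arbitrary: z)
  case (Suc i)
  have "pr ((pd (0, 1) ^^ i) (\<lambda>z. L (u z))) z = pr (\<lambda>z. L ((pd (0, 1) ^^ i) u z)) z"
    by (rule pd_cong_open[OF open_S Suc.prems Suc.IH])
  also have "\<dots> = L (pr ((pd (0, 1) ^^ i) u) z)"
    using L u Suc.prems by (intro pd_linear[OF _ smooth_C1] smooth_iter) auto
  finally show ?case by simp
qed simp

text \<open>Cauchy-type bounds along one ray. The class is stable under sums, linear maps and
  division by r, which carries the bounds from the slices to \<alpha> and to \<beta>/r.\<close>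

definition r_analytic :: "'a \<Rightarrow> real \<Rightarrow> ('a \<times> real \<Rightarrow> 'b::euclidean_space) \<Rightarrow> bool" where
  "r_analytic y R u \<longleftrightarrow> (\<exists>C L. C \<ge> 0 \<and> L > 0 \<and>
     (\<forall>i r. 0 \<le> r \<longrightarrow> r \<le> R \<longrightarrow> norm ((pd (0, 1) ^^ i) u (y, r)) \<le> C * L ^ i * fact i))"

lemma segment_S:
  assumes "(y, R) \<in> S" "0 \<le> r" "r \<le> R"
  shows "(y, r) \<in> S"
  using star[OF assms(1), of "r / R"] assms by (cases "R = 0") auto

lemma r_analytic_add:
  assumes u: "smooth S u" "r_analytic y R u" and w: "smooth S w" "r_analytic y R w" and z: "(y, R) \<in> S"
  shows "r_analytic y R (\<lambda>z. u z + w z)"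
proof -
  obtain C L C' L' where u': "C \<ge> 0" "L > 0"
      "\<And>i r. 0 \<le> r \<Longrightarrow> r \<le> R \<Longrightarrow> norm ((pd (0, 1) ^^ i) u (y, r)) \<le> C * L ^ i * fact i"
    and w': "C' \<ge> 0" "L' > 0"
      "\<And>i r. 0 \<le> r \<Longrightarrow> r \<le> R \<Longrightarrow> norm ((pd (0, 1) ^^ i) w (y, r)) \<le> C' * L' ^ i * fact i"
    using u(2) w(2) unfolding r_analytic_def by blast
  define M where "M = max L L'"
  have M: "L \<le> M" "L' \<le> M" "M > 0" using u'(2) by (auto simp: M_def)
  show ?thesis unfolding r_analytic_def
  proof (rule exI[of _ "C + C'"], rule exI[of _ M], intro conjI allI impI)
    fix i r assume r: "0 \<le> r" "r \<le> R"
    have "norm ((pd (0, 1) ^^ i) (\<lambda>z. u z + w z) (y, r)) \<le> C * L ^ i * fact i + C' * L' ^ i * fact i"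
      unfolding pr_iter_add[OF u(1) w(1) segment_S[OF z r]]
      by (intro order_trans[OF norm_triangle_ineq] add_mono u'(3) w'(3) r)
    also have "\<dots> \<le> C * M ^ i * fact i + C' * M ^ i * fact i"
      using M u' w' by (intro add_mono mult_right_mono mult_left_mono power_mono) auto
    finally show "norm ((pd (0, 1) ^^ i) (\<lambda>z. u z + w z) (y, r)) \<le> (C + C') * M ^ i * fact i"
      by (simp add: algebra_simps)
  qed (use u' w' M in auto)
qed

lemma r_analytic_linear:
  assumes L: "bounded_linear T" and u: "smooth S u" "r_analytic y R u" and z: "(y, R) \<in> S"
  shows "r_analytic y R (\<lambda>z. T (u z))"
proof -
  obtain C L where u': "C \<ge> 0" "L > 0"
      "\<And>i r. 0 \<le> r \<Longrightarrow> r \<le> R \<Longrightarrow> norm ((pd (0, 1) ^^ i) u (y, r)) \<le> C * L ^ i * fact i"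
    using u(2) unfolding r_analytic_def by blast
  obtain K where K: "K \<ge> 0" "\<And>x. norm (T x) \<le> norm x * K"
    using bounded_linear.nonneg_bounded[OF L] by blast
  show ?thesis unfolding r_analytic_def
  proof (rule exI[of _ "C * K"], rule exI[of _ L], intro conjI allI impI)
    fix i r assume r: "0 \<le> r" "r \<le> R"
    have "norm ((pd (0, 1) ^^ i) (\<lambda>z. T (u z)) (y, r)) \<le> (C * L ^ i * fact i) * K"
      unfolding pr_iter_linear[OF L u(1) segment_S[OF z r]]
      using K u'(3)[OF r] by (meson mult_right_mono order_trans)
    then show "norm ((pd (0, 1) ^^ i) (\<lambda>z. T (u z)) (y, r)) \<le> C * K * L ^ i * fact i"
      by (simp add: mult_ac)
  qed (use u' K in auto)
qed

lemma r_analytic_quotient: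
  assumes u: "smooth S u" "r_analytic y R u" and z: "(y, R) \<in> S"
  shows "r_analytic y R (J 0 (pr u))"
proof -
  obtain C L where u': "C \<ge> 0" "L > 0"
      "\<And>i r. 0 \<le> r \<Longrightarrow> r \<le> R \<Longrightarrow> norm ((pd (0, 1) ^^ i) u (y, r)) \<le> C * L ^ i * fact i"
    using u(2) unfolding r_analytic_def by blast
  show ?thesis unfolding r_analytic_def
  proof (rule exI[of _ "C * L"], rule exI[of _ L], intro conjI allI impI)
    fix i r assume r: "0 \<le> r" "r \<le> R"
    have "norm ((pd (0, 1) ^^ i) (J 0 (pr u)) (y, r)) \<le> (C * L ^ Suc i * fact (Suc i)) / (real 0 + real i + 1)"
    proof (rule pr_iter_J_bound[OF smooth_pd[OF u(1)] z _ r])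
      fix r' assume r': "0 \<le> r'" "r' \<le> R"
      have "(pd (0, 1) ^^ i) (pr u) = (pd (0, 1) ^^ Suc i) u" by (simp add: funpow_swap1)
      then show "norm ((pd (0, 1) ^^ i) (pr u) (y, r')) \<le> C * L ^ Suc i * fact (Suc i)"
        using u'(3)[OF r', of "Suc i"] by simp
    qed simp
    also have "\<dots> = C * L * L ^ i * fact i" by (simp add: field_simps)
    finally show "norm ((pd (0, 1) ^^ i) (J 0 (pr u)) (y, r)) \<le> C * L * L ^ i * fact i" .
  qed (use u' in auto)
qed

lemma r_analytic_rdiv_iter:
  assumes u: "smooth S u" "r_analytic y R u" and z: "(y, R) \<in> S"
  obtains C L where "L > 0" "\<And>k r. 0 \<le> r \<Longrightarrow> r \<le> R \<Longrightarrow> norm ((rdiv ^^ k) u (y, r)) \<le> C * L ^ k * fact k"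
proof -
  obtain C L where u': "C \<ge> 0" "L > 0"
      "\<And>i r. 0 \<le> r \<Longrightarrow> r \<le> R \<Longrightarrow> norm ((pd (0, 1) ^^ i) u (y, r)) \<le> C * L ^ i * fact i"
    using u(2) unfolding r_analytic_def by blast
  show ?thesis
    by (rule that[of "2 * L\<^sup>2" C]) (use u' rdiv_iter_bound[OF u(1) z u'(3)] in auto)
qed

lemma parity_pd': "smooth S u \<Longrightarrow> parity c u \<Longrightarrow> b \<in> Basis \<Longrightarrow> parity c (pd (b, 0) u)"
  by (rule parity_pd[OF smooth_C1])

end

locale slice_fun = frame_tube mul v m p bs S
  for mul :: "'a::euclidean_space \<Rightarrow> 'a \<Rightarrow> 'a" and v :: "nat \<Rightarrow> 'a" and m p :: nat and bs :: "nat \<Rightarrow> 'a"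
    and S :: "('a \<times> real) set" +
  fixes f :: "'a \<Rightarrow> 'a" and \<Omega> :: "'a set" and \<eta> :: 'a
  assumes mono: "gen_ps_monogenic mul v p m \<Omega> f" and eta: "\<eta> \<in> Ssph v p m"
    and in_Om: "\<And>\<omega> y r. \<omega> \<in> Ssph v p m \<Longrightarrow> (y, r) \<in> S \<Longrightarrow> T y + r *\<^sub>R \<omega> \<in> \<Omega>"
begin

definition F :: "'a \<Rightarrow> 'a \<times> real \<Rightarrow> 'a" where "F \<omega> z = f (T (fst z) + snd z *\<^sub>R \<omega>)"

definition al :: "'a \<times> real \<Rightarrow> 'a" where "al z = (1/2) *\<^sub>R (F \<eta> z + F (- \<eta>) z)"

text \<open>Since \<open>F (- \<eta>) (y, r)\<close> is \<open>F \<eta> (y, - r)\<close>,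
  \<open>al\<close> is the even part of f on the slice of \<eta>. The function \<open>be\<close> is
  the odd part with \<eta> removed; the sign arises because -\<eta> inverts \<eta>.\<close>

definition be :: "'a \<times> real \<Rightarrow> 'a" where "be z = mul \<eta> ((-1/2) *\<^sub>R (F \<eta> z + (- 1) *\<^sub>R F (- \<eta>) z))"

lemmas neg_eta = Ssph_neg[OF eta]

lemma F_mono: "\<omega> \<in> Ssph v p m \<Longrightarrow> dirac.mono_on (p + 2) ei (Ei \<omega>) S (F \<omega>)"
  unfolding F_def[abs_def] using in_Om by (intro slice_mono[OF _ mono open_S]) auto

lemma F_smooth: "\<omega> \<in> Ssph v p m \<Longrightarrow> smooth S (F \<omega>)"
  using dirac.mono_on_smooth[OF dirac_om F_mono] by blast

lemma al_smooth: "smooth S al"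
  unfolding al_def[abs_def]
  by (intro smooth_linear[OF bounded_linear_scaleR_right] smooth_add F_smooth eta neg_eta)

lemma be_smooth: "smooth S be"
  unfolding be_def[abs_def]
  by (intro smooth_linear[OF bl_mul] smooth_linear[OF bounded_linear_scaleR_right] smooth_add F_smooth eta neg_eta)

lemma al_parity: "parity 1 al"
  unfolding parity_def al_def by (simp add: F_def add.commute)

lemma be_parity: "parity (- 1) be"
  unfolding parity_def be_def by (simp add: F_def mul_simps algebra_simps)

lemma F_decomp: "F \<eta> z = al z + mul \<eta> (be z)"
  unfolding al_def be_def om_sq[OF eta] by (simp add: algebra_simps flip: scaleR_left_distrib)

lemma Dp_slice:
  assumes om: "\<omega> \<in> Ssph v p m" and a: "smooth S a" and b: "smooth S b" and z: "z \<in> S"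
  shows "Dp (\<lambda>z. a z + mul \<omega> (b z)) z = Dp a z + mul \<omega> (Db b z)"
    "pr (\<lambda>z. a z + mul \<omega> (b z)) z = pr a z + mul \<omega> (pr b z)"
proof -
  have h: "pd e (\<lambda>z. a z + mul \<omega> (b z)) z = pd e a z + mul \<omega> (pd e b z)" if "e \<in> Basis" for e
    using that z by (intro haspd_pd haspd_add haspd_linear[OF bl_mul] smooth_haspd a b)
  then show "pr (\<lambda>z. a z + mul \<omega> (b z)) z = pr a z + mul \<omega> (pr b z)" by simp
  have "mul (v s) (mul \<omega> w) = mul \<omega> (Lb s w)" if "s \<le> p" for s w
    using om_anti[OF om, of s w] that v0 by (simp add: Lb_def mul_simps)
  then show "Dp (\<lambda>z. a z + mul \<omega> (b z)) z = Dp a z + mul \<omega> (Db b z)"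
    unfolding Dp_def Db_alt mul_sum_right using h bsB by (simp add: mul_simps sum.distrib)
qed

lemma cr_eq: "z \<in> S \<Longrightarrow> Dp al z + mul \<eta> (Db be z) + mul \<eta> (pr al z) - pr be z = 0"
proof -
  assume z: "z \<in> S"
  have "Dp (F \<eta>) z + mul \<eta> (pr (F \<eta>) z) = 0"
    using F_mono[OF eta] z unfolding mono_iff[OF eta] by blast
  moreover have "F \<eta> = (\<lambda>z. al z + mul \<eta> (be z))" using F_decomp by blast
  ultimately show ?thesis
    using Dp_slice[OF eta al_smooth be_smooth z] om_sq[OF eta] by (simp add: mul_simps algebra_simps)
qed

lemma pd_parity_bs:
  assumes "smooth S u" "parity c u" "(y, r) \<in> S" "s \<le> p"
  shows "pd (bs s, 0) u (y, - r) = c *\<^sub>R pd (bs s, 0) u (y, r)"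
  using parity_pd'[OF assms(1,2) bs_Basis[OF assms(4)]] assms(3) unfolding parity_def by blast

lemma Dp_parity: "smooth S u \<Longrightarrow> parity c u \<Longrightarrow> parity c (Dp u)"
  unfolding parity_def[of c "Dp u"] Dp_def
  by (simp add: pd_parity_bs mul_simps scaleR_right.sum)

lemma Db_parity: "smooth S u \<Longrightarrow> parity c u \<Longrightarrow> parity c (Db u)"
  unfolding parity_def[of c "Db u"] Db_alt
  by (simp add: pd_parity_bs linear_cmul[OF lin_Lb] scaleR_right.sum)

text \<open>The slice equation at (y, r) and at (y, -r) separates by parity: the sum gives the first
  relation, and what remains is \<eta> times the second, where \<eta> can be cancelled.\<close>

lemma cr:
  assumes "z \<in> S"
  shows "Dp al z = pr be z" "Db be z = - pr al z"
proof -
  obtain y r where z: "z = (y, r)" "(y, r) \<in> S" using assms by (cases z) auto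
  have "Dp al (y, - r) = Dp al (y, r)" "Db be (y, - r) = - Db be (y, r)"
    "pr al (y, - r) = - pr al (y, r)" "pr be (y, - r) = pr be (y, r)"
    using Dp_parity[OF al_smooth al_parity] Db_parity[OF be_smooth be_parity]
      parity_pr[OF smooth_C1[OF al_smooth] al_parity] parity_pr[OF smooth_C1[OF be_smooth] be_parity] z(2)
    unfolding parity_def by simp_all
  then have m: "Dp al z - mul \<eta> (Db be z) - mul \<eta> (pr al z) - pr be z = 0"
    using cr_eq[OF refl_S[OF z(2)]] by (simp add: z(1) mul_simps)
  have "2 *\<^sub>R (Dp al z - pr be z) = (Dp al z + mul \<eta> (Db be z) + mul \<eta> (pr al z) - pr be z) +
      (Dp al z - mul \<eta> (Db be z) - mul \<eta> (pr al z) - pr be z)"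
    by (simp add: scaleR_2)
  then have "2 *\<^sub>R (Dp al z - pr be z) = 0" using cr_eq[OF assms] m by simp
  then show 1: "Dp al z = pr be z" by simp
  then have "mul \<eta> (Db be z + pr al z) = 0" using cr_eq[OF assms] by (simp add: mul_simps)
  then have "- (Db be z + pr al z) = 0" using om_sq[OF eta, of "Db be z + pr al z"] by (simp add: mul_simps)
  then have "Db be z + pr al z = 0" by (simp only: neg_equal_0_iff_equal)
  then show "Db be z = - pr al z" by (simp only: eq_neg_iff_add_eq_0)
qed

sublocale radial_pair mul v m p bs S al be
  by unfold_locales (use al_smooth be_smooth al_parity be_parity cr in auto)

lemma F_r_analytic:
  assumes om: "\<omega> \<in> Ssph v p m" and mono': "dirac.mono_on (p + 2) ei (Ei \<omega>) S u"
    and z: "(y, R) \<in> S"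
  shows "r_analytic y R u"
proof -
  have "compact ({y} \<times> {0..R})" by (intro compact_Times) auto
  moreover have "{y} \<times> {0..R} \<subseteq> S" using segment_S[OF z] by auto
  ultimately obtain C L :: real where CL: "L > 0"
      "\<And>k z. z \<in> {y} \<times> {0..R} \<Longrightarrow> norm ((pd (0, 1) ^^ k) u z) \<le> C * L ^ k * fact k"
    using dirac.mono_on_compact_bound[OF dirac_om[OF om] mono' Basis_pairI(1)] by metis
  show ?thesis unfolding r_analytic_def
  proof (rule exI[of _ "max 0 C"], rule exI[of _ L], intro conjI allI impI)
    fix i r assume "0 \<le> r" "r \<le> R"
    then have "norm ((pd (0, 1) ^^ i) u (y, r)) \<le> C * L ^ i * fact i" by (intro CL) auto
    also have "\<dots> \<le> max 0 C * L ^ i * fact i" using CL(1) by (intro mult_right_mono) auto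
    finally show "norm ((pd (0, 1) ^^ i) u (y, r)) \<le> max 0 C * L ^ i * fact i" .
  qed (use CL in auto)
qed

lemma A_bound:
  assumes z: "(y, R) \<in> S"
  obtains C L where "L > 0" "\<And>k r. 0 \<le> r \<Longrightarrow> r \<le> R \<Longrightarrow> norm (A k (y, r)) \<le> C * L ^ k * fact k"
proof -
  have "r_analytic y R al" unfolding al_def[abs_def]
    by (intro r_analytic_linear[OF bounded_linear_scaleR_right] r_analytic_add smooth_add F_smooth eta neg_eta z
        F_r_analytic[OF eta F_mono] F_r_analytic[OF neg_eta F_mono])
  from r_analytic_rdiv_iter[OF al_smooth this z] show ?thesis using that unfolding A_def by metis
qed

lemma E_bound:
  assumes z: "(y, R) \<in> S"
  obtains C L where "L > 0" "\<And>k r. 0 \<le> r \<Longrightarrow> r \<le> R \<Longrightarrow> norm (E k (y, r)) \<le> C * L ^ k * fact k"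
proof -
  have "r_analytic y R be" unfolding be_def[abs_def]
    by (intro r_analytic_linear[OF bl_mul] r_analytic_linear[OF bounded_linear_scaleR_right] r_analytic_add smooth_add
        smooth_linear[OF bounded_linear_scaleR_right] F_smooth eta neg_eta z
        F_r_analytic[OF eta F_mono] F_r_analytic[OF neg_eta F_mono])
  from r_analytic_rdiv_iter[OF _ r_analytic_quotient[OF be_smooth this z] z]
  show ?thesis using that J_smooth[OF smooth_pd[OF be_smooth Basis_pairI(1)]] unfolding E_def by metis
qed

text \<open>The derivatives in y vanish along r = 0, so the equation leaves only \<omega> times the
  r-derivative, and \<omega> is invertible.\<close>

lemma pr_zero:
  assumes om: "\<omega> \<in> Ssph v p m" and u: "dirac.mono_on (p + 2) ei (Ei \<omega>) S u"
    and zero: "\<And>y. (y, 0) \<in> S \<Longrightarrow> u (y, 0) = 0" and z: "(y, 0) \<in> S"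
  shows "pr u (y, 0) = 0"
proof -
  note U = u[unfolded mono_iff[OF om]]
  have "pd (bs s, 0) u (y, 0) = 0" if s: "s \<le> p" for s
  proof -
    have h: "haspd (bs s, 0) u (pd (bs s, 0) u (y, 0)) (y, 0)"
      using C1D(3)[of S u] U bsB[OF s] z by blast
    have "\<forall>\<^sub>F t in at (0::real). (y, 0) + t *\<^sub>R (bs s, 0) \<in> S"
      using eventually_line_open[OF open_S z, of "(bs s, 0)"] by (simp add: eventually_nhds_conv_at)
    then have ev: "\<forall>\<^sub>F t in at (0::real). u ((y, 0) + t *\<^sub>R (bs s, 0)) = 0"
      by eventually_elim (use zero in simp)
    have "haspd (bs s, 0) (\<lambda>_. 0) (pd (bs s, 0) u (y, 0)) (y, 0::real)"
      by (rule haspd_transform[OF h]) (use ev zero z in simp_all)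
    from haspd_pd[OF this] show ?thesis by simp
  qed
  then have "Dp u (y, 0) = 0" by (simp add: Dp_def mul_simps)
  then have "mul \<omega> (pr u (y, 0)) = 0" using U z by auto
  then show ?thesis using om_sq[OF om, of "pr u (y, 0)"] by (simp add: mul_simps)
qed

text \<open>All r-derivatives of u are solutions, so repeated use of \<open>pr_zero\<close> makes
  the whole jet vanish at r = 0; analyticity along the ray carries this to R.\<close>

lemma unique_continuation:
  assumes om: "\<omega> \<in> Ssph v p m" and u: "dirac.mono_on (p + 2) ei (Ei \<omega>) S u"
    and zero: "\<And>y. (y, 0) \<in> S \<Longrightarrow> u (y, 0) = 0" and z: "(y, R) \<in> S" and R: "R \<ge> 0"
  shows "u (y, R) = 0"
proof -
  interpret D: dirac "p + 2" ei "Ei \<omega>" "Ebi \<omega>" by (rule dirac_om[OF om])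
  have it: "D.mono_on S ((pd (0, 1) ^^ k) u)" for k by (rule D.mono_on_iter[OF u]) simp
  have z0: "(pd (0, 1) ^^ k) u (y, 0) = 0" if "(y, 0) \<in> S" for k y
    using that
  proof (induction k arbitrary: y)
    case (Suc k)
    then show ?case using pr_zero[OF om it, of k y] by simp
  qed (simp add: zero)
  obtain C L where CL: "L > 0"
      "\<And>i r. 0 \<le> r \<Longrightarrow> r \<le> R \<Longrightarrow> norm ((pd (0, 1) ^^ i) u (y, r)) \<le> C * L ^ i * fact i"
    using F_r_analytic[OF om u z] unfolding r_analytic_def by blast
  have "(\<lambda>k r. (pd (0, 1) ^^ k) u (y, r)) 0 R = 0"
  proof (rule analytic_bound_zero[OF _ _ CL(2) _ CL(1) R order_refl])
    show "continuous_on {0..R} (\<lambda>r. (pd (0, 1) ^^ k) u (y, r))" for k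
      by (intro continuous_on_compose2[OF C1D(2)[OF D.mono_onD(1)[OF it]]] continuous_intros)
         (use segment_S[OF z] in auto)
    show "((\<lambda>r. (pd (0, 1) ^^ k) u (y, r)) has_vector_derivative (pd (0, 1) ^^ Suc k) u (y, x)) (at x)"
      if "0 < x" "x < R" for k x
    proof -
      have "haspd (0, 1) ((pd (0, 1) ^^ k) u) (pr ((pd (0, 1) ^^ k) u) ((y, 0) + x *\<^sub>R (0, 1))) ((y, 0) + x *\<^sub>R (0, 1))"
        using segment_S[OF z, of x] that by (intro C1D(3)[OF D.mono_onD(1)[OF it]]) auto
      from haspd_shift[OF this] show ?thesis by simp
    qed
  qed (use z0 zero_S[OF z] in auto)
  then show ?thesis by simp
qed

text \<open>The relations \<open>cr\<close> do not involve \<eta>, so the right side solves the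
  system of every slice. At r = 0 both sides equal f at T y, whatever \<omega> is, and unique
  continuation applies.\<close>

lemma representation:
  assumes om: "\<omega> \<in> Ssph v p m" and z: "(y, R) \<in> S" and R: "R \<ge> 0"
  shows "f (T y + R *\<^sub>R \<omega>) = al (y, R) + mul \<omega> (be (y, R))"
proof -
  interpret D: dirac "p + 2" ei "Ei \<omega>" "Ebi \<omega>" by (rule dirac_om[OF om])
  let ?h = "\<lambda>z. al z + mul \<omega> (be z)"
  have hs: "smooth S ?h" by (intro smooth_add al_smooth smooth_linear[OF bl_mul] be_smooth)
  have "D.mono_on S ?h"
    unfolding mono_iff[OF om]
  proof (intro conjI ballI)
    show "C1 S ?h" by (rule smooth_C1[OF hs])
    show "Dp ?h z + mul \<omega> (pr ?h z) = 0" if "z \<in> S" for z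
      using Dp_slice[OF om al_smooth be_smooth that] cr[OF that] om_sq[OF om]
      by (simp add: mul_simps)
    show "pd (b, 0) ?h z = 0" if z: "z \<in> S" and b: "b \<in> Basis - bs ` {..p}" for z b
    proof -
      have Fz: "pd (b, 0) (F \<omega>) z = 0" if "\<omega> \<in> Ssph v p m" for \<omega>
        using F_mono[OF that] z b unfolding mono_iff[OF that] by blast
      have bb: "(b, 0::real) \<in> Basis" using b by simp
      have "haspd (b, 0) al ((1/2) *\<^sub>R (0 + 0)) z"
        unfolding al_def[abs_def]
        using smooth_haspd[OF F_smooth[OF eta] bb z] smooth_haspd[OF F_smooth[OF neg_eta] bb z] Fz eta neg_eta
        by (intro haspd_linear[OF bounded_linear_scaleR_right] haspd_add) auto
      moreover have "haspd (b, 0) be (mul \<eta> ((-1/2) *\<^sub>R (0 + (- 1) *\<^sub>R 0))) z"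
        unfolding be_def[abs_def]
        using smooth_haspd[OF F_smooth[OF eta] bb z] smooth_haspd[OF F_smooth[OF neg_eta] bb z] Fz[OF eta] Fz[OF neg_eta]
        by (intro haspd_linear[OF bl_mul] haspd_linear[OF bounded_linear_scaleR_right] haspd_add) (auto)
      ultimately have "haspd (b, 0) ?h ((1/2) *\<^sub>R (0 + 0) + mul \<omega> (mul \<eta> ((-1/2) *\<^sub>R (0 + (- 1) *\<^sub>R 0)))) z"
        by (intro haspd_add haspd_linear[OF bl_mul])
      from haspd_pd[OF this] show ?thesis by (simp add: mul_simps)
    qed
  qed
  from D.mono_on_linear_comb[OF F_mono[OF om] this, of 1]
  have "D.mono_on S (\<lambda>z. 1 *\<^sub>R (F \<omega> z - ?h z))" .
  then have "1 *\<^sub>R (F \<omega> (y, R) - ?h (y, R)) = 0"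
  proof (rule unique_continuation[OF om _ _ z R])
    fix y assume "(y, 0::real) \<in> S"
    then show "1 *\<^sub>R (F \<omega> (y, 0) - ?h (y, 0)) = 0"
      using beta_zero by (simp add: F_def al_def mul_simps flip: scaleR_left_distrib)
  qed
  then show ?thesis by (simp add: F_def)
qed

end

subsection \<open>Differentiation in the coordinates of M\<close>

lemma sum_upd:
  fixes g :: "nat \<Rightarrow> 'b::real_vector"
  assumes "finite I"
  shows "(\<Sum>i\<in>I. (c(s := c s + t)) i *\<^sub>R g i) = (\<Sum>i\<in>I. c i *\<^sub>R g i) + (if s \<in> I then t *\<^sub>R g s else 0)"
proof -
  have "(\<Sum>i\<in>I. (c(s := c s + t)) i *\<^sub>R g i) = (\<Sum>i\<in>I. c i *\<^sub>R g i + (if i = s then t *\<^sub>R g s else 0))"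
    by (intro sum.cong) (auto simp: scaleR_left_distrib)
  then show ?thesis using assms by (simp add: sum.distrib)
qed

text \<open>Partial derivative with respect to a coordinate, for functions of the coordinate
  sequence c instead of the point of M.\<close>

definition hasc :: "nat \<Rightarrow> ((nat \<Rightarrow> real) \<Rightarrow> 'b::real_normed_vector) \<Rightarrow> 'b \<Rightarrow> (nat \<Rightarrow> real) \<Rightarrow> bool" where
  "hasc s k d c \<longleftrightarrow> ((\<lambda>t. k (c(s := c s + t))) has_vector_derivative d) (at 0)"

context slice_fun
begin

definition io :: "(nat \<Rightarrow> real) \<Rightarrow> 'a" where "io c = (\<Sum>s\<le>p. c s *\<^sub>R bs s)"

abbreviation Q :: "(nat \<Rightarrow> real) \<Rightarrow> real" where "Q c \<equiv> rq p m c"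
abbreviation X :: "(nat \<Rightarrow> real) \<Rightarrow> 'a" where "X c \<equiv> xqpart v p m c"

text \<open>Coordinates of points covered by the tube. With r the length of x_q, one tube covers all
  directions of x_q at once.\<close>

definition W :: "(nat \<Rightarrow> real) set" where "W = {c. (io c, Q c) \<in> S}"

definition ev :: "('a \<times> real \<Rightarrow> 'a) \<Rightarrow> (nat \<Rightarrow> real) \<Rightarrow> 'a" where "ev g c = g (io c, Q c)"

definition Rep :: "('a \<times> real \<Rightarrow> 'a) \<Rightarrow> ('a \<times> real \<Rightarrow> 'a) \<Rightarrow> (nat \<Rightarrow> real) \<Rightarrow> 'a" where
  "Rep g h c = ev g c + mul (X c) (ev h c)"

lemma io_upd: "io (c(s := c s + t)) = io c + (if s \<le> p then t *\<^sub>R bs s else 0)"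
  unfolding io_def by (subst sum_upd) auto

lemma xq_upd: "X (c(s := c s + t)) = X c + (if s \<in> {p+1..m} then t *\<^sub>R v s else 0)"
  unfolding xqpart_def by (subst sum_upd) auto

lemma pt_upd: "s \<le> m \<Longrightarrow> pt v m (c(s := c s + t)) = pt v m c + t *\<^sub>R v s"
  unfolding pt_def by (subst sum_upd) auto

lemma rq_upd: "s \<le> p \<Longrightarrow> Q (c(s := c s + t)) = Q c"
  unfolding rq_def by (intro arg_cong[where f=sqrt] sum.cong) auto

lemma rq_sq: "(Q c)\<^sup>2 = (\<Sum>s\<in>{p+1..m}. (c s)\<^sup>2)" and rq_nonneg: "0 \<le> Q c"
  by (simp_all add: rq_def sum_nonneg)

lemma rq_upd_q:
  assumes "s \<in> {p+1..m}"
  shows "Q (c(s := c s + t)) = sqrt ((Q c)\<^sup>2 + 2 * c s * t + t\<^sup>2)"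
proof -
  have "(\<Sum>i\<in>{p+1..m}. ((c(s := c s + t)) i)\<^sup>2) = (\<Sum>i\<in>{p+1..m}. (c i)\<^sup>2 + (if i = s then 2 * c s * t + t\<^sup>2 else 0))"
    by (intro sum.cong) (auto simp: power2_sum)
  also have "\<dots> = (Q c)\<^sup>2 + 2 * c s * t + t\<^sup>2"
    using assms by (simp add: sum.distrib rq_sq)
  finally show ?thesis by (simp add: rq_def)
qed

lemma rq_0: "Q c = 0 \<Longrightarrow> s \<in> {p+1..m} \<Longrightarrow> c s = 0"
  using rq_sq[of c] sum_nonneg_eq_0_iff[of "{p+1..m}" "\<lambda>s. (c s)\<^sup>2"] by auto

lemma T_io: "T (io c) = xpart v p c"
  unfolding io_def xpart_def linear_sum[OF linear_T] by (simp add: T_scale T_bs)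

lemma sum_split: "(\<Sum>s\<le>m. g s) = (\<Sum>s\<le>p. g s) + (\<Sum>s\<in>{p+1..m}. g s)" for g :: "nat \<Rightarrow> 'b::comm_monoid_add"
proof -
  have "{..m} = {..p} \<union> {p+1..m}" using pm by auto
  moreover have "{..p} \<inter> {p+1..m} = {}" by auto
  ultimately show ?thesis by (simp add: sum.union_disjoint)
qed

lemma pt_split: "pt v m c = xpart v p c + X c"
  unfolding pt_def xpart_def xqpart_def by (rule sum_split)

lemma f_pt:
  assumes c: "c \<in> W"
  shows "f (pt v m c) = Rep (A 0) (E 0) c"
proof -
  have z: "(io c, Q c) \<in> S" using c by (simp add: W_def)
  \<comment> \<open>For x_q = 0 the direction is undetermined, and any unit serves because its
    coefficient is zero.\<close>
  obtain \<omega> where om: "\<omega> \<in> Ssph v p m" "X c = Q c *\<^sub>R \<omega>"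
  proof (cases "Q c = 0")
    case True
    then have "X c = 0" unfolding xqpart_def using rq_0 by (intro sum.neutral) auto
    then show ?thesis using that[OF eta] True by simp
  next
    case False
    then have "Q c > 0" using rq_nonneg[of c] by simp
    then show ?thesis using that[OF xq_unit] False by simp
  qed
  have "f (pt v m c) = f (T (io c) + Q c *\<^sub>R \<omega>)" by (simp add: pt_split T_io om(2))
  also have "\<dots> = al (io c, Q c) + mul \<omega> (be (io c, Q c))"
    by (rule representation[OF om(1) z rq_nonneg])
  also have "\<dots> = Rep (A 0) (E 0) c"
    using beta_E[OF z] by (simp add: Rep_def ev_def A_def om(2) mul_simps)
  finally show ?thesis .
qed

text \<open>Openness of W along coordinate lines, which is all that partial derivatives see.\<close>

lemma W_line:
  assumes c: "c \<in> W"
  shows "\<forall>\<^sub>F t in nhds 0. c(s := c s + t) \<in> W"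
proof -
  have z: "(io c, Q c) \<in> S" using c by (simp add: W_def)
  have "((\<lambda>t. (io (c(s := c s + t)), Q (c(s := c s + t)))) \<longlongrightarrow> (io c, Q c)) (at 0)"
  proof (rule tendsto_Pair)
    have "((\<lambda>t. io c + (if s \<le> p then t *\<^sub>R bs s else 0)) \<longlongrightarrow> io c) (at 0)"
      by (cases "s \<le> p") (auto intro!: tendsto_eq_intros)
    then show "((\<lambda>t. io (c(s := c s + t))) \<longlongrightarrow> io c) (at 0)" by (simp only: io_upd)
    show "((\<lambda>t. Q (c(s := c s + t))) \<longlongrightarrow> Q c) (at 0)"
    proof (cases "s \<in> {p+1..m}")
      case True
      have "((\<lambda>t. sqrt ((Q c)\<^sup>2 + 2 * c s * t + t\<^sup>2)) \<longlongrightarrow> sqrt ((Q c)\<^sup>2 + 2 * c s * 0 + 0\<^sup>2)) (at 0)"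
        by (intro tendsto_intros)
      then show ?thesis using rq_upd_q[OF True] rq_nonneg[of c] by simp
    next
      case False
      have "Q (c(s := c s + t)) = Q c" for t
        unfolding rq_def using False by (intro arg_cong[where f=sqrt] sum.cong) auto
      then show ?thesis by simp
    qed
  qed
  then have "\<forall>\<^sub>F t in at 0. (io (c(s := c s + t)), Q (c(s := c s + t))) \<in> S"
    by (rule topological_tendstoD[OF _ open_S z])
  then show ?thesis using c by (simp add: eventually_nhds_conv_at W_def)
qed

lemma pd_pt:
  assumes c: "c \<in> W" and s: "s \<le> m" and h: "\<And>c. c \<in> W \<Longrightarrow> h (pt v m c) = k c" and d: "hasc s k d c"
  shows "pd (v s) h (pt v m c) = d"
proof (rule haspd_pd)
  have "\<forall>\<^sub>F t in nhds 0. k (c(s := c s + t)) = h (pt v m c + t *\<^sub>R v s)"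
    using W_line[OF c, of s] by eventually_elim (use h pt_upd[OF s, of c] in metis)
  then have "\<forall>\<^sub>F t in at 0. k (c(s := c s + t)) = h (pt v m c + t *\<^sub>R v s)"
    by (simp add: eventually_nhds_conv_at)
  moreover have "k (c(s := c s + 0)) = h (pt v m c + 0 *\<^sub>R v s)" using h[OF c] by simp
  ultimately show "haspd (v s) h d (pt v m c)"
    using d unfolding haspd_def hasc_def has_vector_derivative_def
    by (auto intro: has_derivative_transform_eventually)
qed

lemma hasc_ev_y:
  assumes g: "smooth S g" and c: "c \<in> W" and s: "s \<le> p"
  shows "hasc s (ev g) (ev (pd (bs s, 0) g) c) c"
  using smooth_haspd[OF g bsB[OF s], of "(io c, Q c)"] c s
  unfolding hasc_def haspd_def ev_def io_upd rq_upd[OF s] W_def by simp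

text \<open>The derivative of r in direction s is c s / r, and the r-derivative of g carries a
  factor r; the two cancel, leaving a formula that is meaningful at r = 0 as well.\<close>

lemma hasc_ev_q:
  assumes g: "smooth S g" and par: "parity 1 g" and g': "\<And>z. z \<in> S \<Longrightarrow> pr g z = snd z *\<^sub>R g' z"
    and c: "c \<in> W" and s: "s \<in> {p+1..m}"
  shows "hasc s (ev g) (c s *\<^sub>R ev g' c) c"
proof -
  have z: "(io c, Q c) \<in> S" using c by (simp add: W_def)
  have sp: "\<not> s \<le> p" using s by simp
  have ev: "ev g (c(s := c s + t)) = g (io c, sqrt ((Q c)\<^sup>2 + 2 * c s * t + t\<^sup>2))" for t
    using sp unfolding ev_def io_upd rq_upd_q[OF s] by simp
  have line: "((\<lambda>r. g (io c, r)) has_vector_derivative r *\<^sub>R g' (io c, r)) (at r)" if "(io c, r) \<in> S" for r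
  proof -
    have "haspd (0, 1) g (pr g ((io c, 0) + r *\<^sub>R (0, 1))) ((io c, 0) + r *\<^sub>R (0, 1))"
      using that by (intro smooth_haspd[OF g]) auto
    from haspd_shift[OF this] show ?thesis using g'[OF that] by simp
  qed
  show ?thesis
  proof (cases "Q c = 0")
    case True
    then have c0: "c s = 0" using rq_0 s by blast
    have "((\<lambda>r. g (io c, r)) has_vector_derivative 0) (at 0)"
      using line[of 0] z True by simp
    \<comment> \<open>At r = 0 the radius along the coordinate line is the absolute value of t, and
      evenness of g removes its corner.\<close>
    moreover have "\<forall>\<^sub>F t in at 0. g (io c, t) = g (io c, \<bar>t\<bar>)"
    proof -
      have "\<forall>\<^sub>F t in nhds (0::real). (io c, 0) + t *\<^sub>R (0, 1) \<in> S"
        using eventually_line_open[OF open_S, of "(io c, 0)" "(0, 1)"] z True by simp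
      then have "\<forall>\<^sub>F t in nhds (0::real). g (io c, t) = g (io c, \<bar>t\<bar>)"
      proof eventually_elim
        case (elim t)
        then show ?case using par unfolding parity_def by (cases "t \<ge> 0") auto
      qed
      then show ?thesis by (simp add: eventually_nhds_conv_at)
    qed
    ultimately have "((\<lambda>t. g (io c, \<bar>t\<bar>)) has_vector_derivative 0) (at 0)"
      unfolding has_vector_derivative_def
      by (auto intro: has_derivative_transform_eventually)
    then show ?thesis unfolding hasc_def ev using True c0 by simp
  next
    case False
    then have Qp: "Q c > 0" using rq_nonneg[of c] by simp
    let ?\<phi> = "\<lambda>t. sqrt ((Q c)\<^sup>2 + 2 * c s * t + t\<^sup>2)"
    have \<phi>0: "?\<phi> 0 = Q c" using Qp by simp
    have "(?\<phi> has_real_derivative c s / Q c) (at 0)"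
      using Qp by (auto intro!: derivative_eq_intros simp: field_simps)
    then have "((\<lambda>r. g (io c, r)) \<circ> ?\<phi> has_vector_derivative (c s / Q c) *\<^sub>R (Q c *\<^sub>R g' (io c, Q c))) (at 0)"
      unfolding has_real_derivative_iff_has_vector_derivative
      using line[OF z] \<phi>0 by (intro vector_diff_chain_at) auto
    then show ?thesis unfolding hasc_def ev using Qp by (simp add: o_def ev_def)
  qed
qed

lemma bbl_mul: "bounded_bilinear mul"
  using bil bilinear_conv_bounded_bilinear by blast

lemma hasc_Rep_y:
  assumes g: "smooth S g" and h: "smooth S h" and c: "c \<in> W" and s: "s \<le> p"
  shows "hasc s (Rep g h) (Rep (pd (bs s, 0) g) (pd (bs s, 0) h) c) c"
proof -
  have "X (c(s := c s + t)) = X c" for t using s by (simp add: xq_upd)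
  then show ?thesis
    using hasc_ev_y[OF g c s] bounded_linear.has_vector_derivative[OF bl_mul, of "\<lambda>t. ev h (c(s := c s + t))" _ _ "X c"]
      hasc_ev_y[OF h c s]
    unfolding hasc_def Rep_def by (auto intro!: has_vector_derivative_add)
qed

lemma hasc_Rep_q:
  assumes g: "smooth S g" "parity 1 g" "\<And>z. z \<in> S \<Longrightarrow> pr g z = snd z *\<^sub>R g' z"
    and h: "smooth S h" "parity 1 h" "\<And>z. z \<in> S \<Longrightarrow> pr h z = snd z *\<^sub>R h' z"
    and c: "c \<in> W" and s: "s \<in> {p+1..m}"
  shows "hasc s (Rep g h) (c s *\<^sub>R Rep g' h' c + mul (v s) (ev h c)) c"
proof -
  have "((\<lambda>t. X c + t *\<^sub>R v s) has_vector_derivative v s) (at 0)"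
    unfolding has_vector_derivative_def by (auto intro!: derivative_eq_intros)
  then have x: "((\<lambda>t. X (c(s := c s + t))) has_vector_derivative v s) (at 0)"
    using s by (simp add: xq_upd)
  from bounded_bilinear.has_vector_derivative[OF bbl_mul x hasc_ev_q[OF h c s, unfolded hasc_def]]
  have "((\<lambda>t. mul (X (c(s := c s + t))) (ev h (c(s := c s + t)))) has_vector_derivative
      mul (X c) (c s *\<^sub>R ev h' c) + mul (v s) (ev h c)) (at 0)" by simp
  from has_vector_derivative_add[OF hasc_ev_q[OF g c s, unfolded hasc_def] this]
  show ?thesis unfolding hasc_def Rep_def by (simp add: mul_simps algebra_simps)
qed

lemma hasc_scale: "hasc s k d c \<Longrightarrow> hasc s (\<lambda>c. a *\<^sub>R k c) (a *\<^sub>R d) c"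
  unfolding hasc_def by (rule bounded_linear.has_vector_derivative[OF bounded_linear_scaleR_right])

abbreviation q :: real where "q \<equiv> real (m - p)"

lemma pd_Rep_y:
  assumes h: "\<And>c. c \<in> W \<Longrightarrow> h (pt v m c) = a *\<^sub>R Rep g g1 c" and g: "smooth S g" "smooth S g1"
    and c: "c \<in> W" and s: "s \<le> p"
  shows "pd (v s) h (pt v m c) = a *\<^sub>R Rep (pd (bs s, 0) g) (pd (bs s, 0) g1) c"
  using s pm by (intro pd_pt[where k="\<lambda>c. a *\<^sub>R Rep g g1 c"] h hasc_scale hasc_Rep_y g c) auto

lemma pd_Rep_q:
  assumes h: "\<And>c. c \<in> W \<Longrightarrow> h (pt v m c) = a *\<^sub>R Rep (A i) (E i) c" and c: "c \<in> W" and s: "s \<in> {p+1..m}"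
  shows "pd (v s) h (pt v m c) = a *\<^sub>R (c s *\<^sub>R Rep (A (Suc i)) (E (Suc i)) c + mul (v s) (ev (E i) c))"
  using s by (intro pd_pt[where k="\<lambda>c. a *\<^sub>R Rep (A i) (E i) c"] h hasc_scale hasc_Rep_q A_smooth A_parity pr_A E_smooth E_parity pr_E c) auto

lemma sum_q: "(\<Sum>s\<in>{p+1..m}. c s *\<^sub>R mul (v s) w) = mul (X c) w"
  unfolding xqpart_def mul_sum_left by (simp add: mul_simps)

text \<open>The terms with r^2 from the directions in R^(p+1) and from the remaining ones cancel.
  Differentiating x_q itself gives twice x_q times \<open>E (Suc i)\<close>, which reconciles the
  constants 2i + 1 for A and 2i + 3 for E.\<close>

lemma Lapp_Rep:
  assumes h: "\<And>c. c \<in> W \<Longrightarrow> h (pt v m c) = a *\<^sub>R Rep (A i) (E i) c" and c: "c \<in> W"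
  shows "Lapp v m h (pt v m c) = (a * (q - 2 * real i - 1)) *\<^sub>R Rep (A (Suc i)) (E (Suc i)) c"
proof -
  let ?A = "\<lambda>j. ev (A j) c" and ?E = "\<lambda>j. ev (E j) c" and ?R = "\<lambda>j. Rep (A j) (E j) c"
  have z: "(io c, Q c) \<in> S" using c by (simp add: W_def)
  have y: "pd (v s) (pd (v s) h) (pt v m c) = a *\<^sub>R Rep (pd (bs s, 0) (pd (bs s, 0) (A i))) (pd (bs s, 0) (pd (bs s, 0) (E i))) c"
    if s: "s \<le> p" for s
    by (intro pd_Rep_y h A_smooth E_smooth smooth_pd bsB s c)
  have x: "pd (v s) (pd (v s) h) (pt v m c) =
      a *\<^sub>R (?R (Suc i) + (c s)\<^sup>2 *\<^sub>R ?R (Suc (Suc i)) + (2 * c s) *\<^sub>R mul (v s) (?E (Suc i)))"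
    if s: "s \<in> {p+1..m}" for s
  proof (rule pd_pt[where k="\<lambda>c. a *\<^sub>R (c s *\<^sub>R Rep (A (Suc i)) (E (Suc i)) c + mul (v s) (ev (E i) c))", OF c])
    show "s \<le> m" using s by simp
    show "pd (v s) h (pt v m c) = a *\<^sub>R (c s *\<^sub>R Rep (A (Suc i)) (E (Suc i)) c + mul (v s) (ev (E i) c))"
      if "c \<in> W" for c by (rule pd_Rep_q[OF h that s])
    have "hasc s (\<lambda>c. c s) 1 c"
      unfolding hasc_def has_vector_derivative_def by (auto intro!: derivative_eq_intros)
    then have cs: "((\<lambda>t. (c(s := c s + t)) s) has_real_derivative 1) (at 0)"
      unfolding hasc_def has_real_derivative_iff_has_vector_derivative .
    have 1: "hasc s (Rep (A (Suc i)) (E (Suc i))) (c s *\<^sub>R ?R (Suc (Suc i)) + mul (v s) (?E (Suc i))) c"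
      by (intro hasc_Rep_q A_smooth A_parity pr_A E_smooth E_parity pr_E c s)
    have 2: "hasc s (ev (E i)) (c s *\<^sub>R ?E (Suc i)) c"
      by (intro hasc_ev_q E_smooth E_parity pr_E c s)
    from has_vector_derivative_add[OF has_vector_derivative_scaleR[OF cs 1[unfolded hasc_def]]
        bounded_linear.has_vector_derivative[OF bl_mul 2[unfolded hasc_def], of "v s"]]
    have "hasc s (\<lambda>c. c s *\<^sub>R Rep (A (Suc i)) (E (Suc i)) c + mul (v s) (ev (E i) c))
       ((c s *\<^sub>R (c s *\<^sub>R ?R (Suc (Suc i)) + mul (v s) (?E (Suc i))) + ?R (Suc i)) + mul (v s) (c s *\<^sub>R ?E (Suc i))) c"
      unfolding hasc_def by simp
    moreover have "(c s *\<^sub>R (c s *\<^sub>R ?R (Suc (Suc i)) + mul (v s) (?E (Suc i))) + ?R (Suc i)) + mul (v s) (c s *\<^sub>R ?E (Suc i))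
      = ?R (Suc i) + (c s)\<^sup>2 *\<^sub>R ?R (Suc (Suc i)) + (2 * c s) *\<^sub>R mul (v s) (?E (Suc i))"
      using scaleR_left_distrib[of "c s" "c s" "mul (v s) (?E (Suc i))"]
      by (simp add: mul_simps algebra_simps power2_eq_square)
    ultimately show "hasc s (\<lambda>c. a *\<^sub>R (c s *\<^sub>R Rep (A (Suc i)) (E (Suc i)) c + mul (v s) (ev (E i) c)))
       (a *\<^sub>R (?R (Suc i) + (c s)\<^sup>2 *\<^sub>R ?R (Suc (Suc i)) + (2 * c s) *\<^sub>R mul (v s) (?E (Suc i)))) c"
      by (intro hasc_scale) simp
  qed
  have "(\<Sum>s\<le>p. pd (v s) (pd (v s) h) (pt v m c)) = a *\<^sub>R Rep (Lp (A i)) (Lp (E i)) c"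
    using y by (simp add: Rep_def ev_def Lp_def mul_sum_right scaleR_right.sum[symmetric] sum.distrib scaleR_right_distrib)
  moreover have "(\<Sum>s\<in>{p+1..m}. pd (v s) (pd (v s) h) (pt v m c)) =
      a *\<^sub>R (q *\<^sub>R ?R (Suc i) + (Q c)\<^sup>2 *\<^sub>R ?R (Suc (Suc i)) + 2 *\<^sub>R mul (X c) (?E (Suc i)))"
  proof -
    have "(\<Sum>s\<in>{p+1..m}. pd (v s) (pd (v s) h) (pt v m c)) =
      a *\<^sub>R (\<Sum>s\<in>{p+1..m}. ?R (Suc i) + (c s)\<^sup>2 *\<^sub>R ?R (Suc (Suc i)) + (2 * c s) *\<^sub>R mul (v s) (?E (Suc i)))"
      unfolding scaleR_right.sum using x by (intro sum.cong) auto
    also have "(\<Sum>s\<in>{p+1..m}. ?R (Suc i) + (c s)\<^sup>2 *\<^sub>R ?R (Suc (Suc i)) + (2 * c s) *\<^sub>R mul (v s) (?E (Suc i))) =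
      q *\<^sub>R ?R (Suc i) + (Q c)\<^sup>2 *\<^sub>R ?R (Suc (Suc i)) + 2 *\<^sub>R (\<Sum>s\<in>{p+1..m}. c s *\<^sub>R mul (v s) (?E (Suc i)))"
      by (simp add: sum.distrib scaleR_left.sum[symmetric] rq_sq scaleR_right.sum sum_constant_scaleR)
    finally show ?thesis unfolding sum_q .
  qed
  moreover have "Rep (Lp (A i)) (Lp (E i)) c + (q *\<^sub>R ?R (Suc i) + (Q c)\<^sup>2 *\<^sub>R ?R (Suc (Suc i)) + 2 *\<^sub>R mul (X c) (?E (Suc i)))
     = (q - 2 * real i - 1) *\<^sub>R ?R (Suc i)"
    using scaleR_left_distrib[of 1 2 "mul (X c) (E (Suc i) (io c, Q c))"] unfolding Rep_def ev_def Lp_A[OF z] Lp_E[OF z]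
    by (simp add: mul_simps algebra_simps) 
  ultimately show ?thesis unfolding Lapp_def sum_split by (simp add: scaleR_right_distrib[symmetric])
qed

lemma Lapp_power_f:
  "c \<in> W \<Longrightarrow> (Lapp v m ^^ j) f (pt v m c) = (\<Prod>l<j. q - 2 * real l - 1) *\<^sub>R Rep (A j) (E j) c"
proof (induction j arbitrary: c)
  case (Suc j)
  show ?case using Lapp_Rep[OF Suc.IH Suc.prems] by simp
qed (simp add: f_pt)

text \<open>Moving \<open>v s\<close> past x_q conjugates it, so the inner operator becomes
  \<open>Db\<close>. By \<open>Db_E\<close> the products of x_q with \<open>A (Suc i)\<close>
  cancel, and the square of x_q removes the term with r^2 from \<open>Dp_A\<close>; only
  \<open>E i\<close> survives.\<close>

lemma Dxp_Rep:
  assumes h: "\<And>c. c \<in> W \<Longrightarrow> h (pt v m c) = a *\<^sub>R Rep (A i) (E i) c" and c: "c \<in> W"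
  shows "Dxp mul v m h (pt v m c) = (a * (2 * real i + 1 - q)) *\<^sub>R ev (E i) c"
proof -
  let ?A = "\<lambda>j. ev (A j) c" and ?E = "\<lambda>j. ev (E j) c" and ?R = "\<lambda>j. Rep (A j) (E j) c"
  have z: "(io c, Q c) \<in> S" using c by (simp add: W_def)
  have x: "mul (v s) (mul (X c) w) = mul (X c) (Lb s w)" if "s \<le> p" for s w
    using xq_anti[of s c w] that v0 by (auto simp: Lb_def mul_simps Suc_le_eq)
  have "(\<Sum>s\<le>p. mul (v s) (pd (v s) h (pt v m c))) = a *\<^sub>R (ev (Dp (A i)) c + mul (X c) (ev (Db (E i)) c))"
    using pd_Rep_y[OF h A_smooth E_smooth c] x
    by (simp add: Rep_def ev_def Dp_def Db_alt mul_simps mul_sum_right scaleR_right.sum[symmetric] sum.distrib scaleR_right_distrib)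
  moreover have "(\<Sum>s\<in>{p+1..m}. mul (v s) (pd (v s) h (pt v m c))) = a *\<^sub>R (mul (X c) (?R (Suc i)) - q *\<^sub>R ?E i)"
  proof -
    have "(\<Sum>s\<in>{p+1..m}. mul (v s) (pd (v s) h (pt v m c))) =
        (\<Sum>s\<in>{p+1..m}. a *\<^sub>R (c s *\<^sub>R mul (v s) (?R (Suc i)) - ?E i))"
      using pd_Rep_q[OF h c] vsq by (intro sum.cong refl) (auto simp: mul_simps)
    also have "\<dots> = a *\<^sub>R ((\<Sum>s\<in>{p+1..m}. c s *\<^sub>R mul (v s) (?R (Suc i))) - q *\<^sub>R ?E i)"
      by (simp add: scaleR_right.sum[symmetric] sum_subtractf sum_constant_scaleR)
    finally show ?thesis unfolding sum_q .
  qed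
  moreover have "(ev (Dp (A i)) c + mul (X c) (ev (Db (E i)) c)) + (mul (X c) (?R (Suc i)) - q *\<^sub>R ?E i) = (2 * real i + 1 - q) *\<^sub>R ?E i"
    unfolding Rep_def linear_add[OF lin_mul] xq_sq
    using Dp_A[OF z, of i] Db_E[OF z, of i] by (simp add: ev_def mul_simps algebra_simps)
  ultimately show ?thesis unfolding Dxp_def sum_split by (simp add: scaleR_right_distrib[symmetric])
qed

text \<open>Here x_q is not in front of the function: the directions in R^(p+1) produce
  \<open>A (Suc i)\<close> through \<open>Db_E\<close>, and the other directions produce x_q times
  \<open>E (Suc i)\<close> by the chain rule.\<close>

lemma Dxpbar_Rep:
  assumes h: "\<And>c. c \<in> W \<Longrightarrow> h (pt v m c) = a *\<^sub>R ev (E i) c" and c: "c \<in> W"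
  shows "Dxpbar mul v m h (pt v m c) = (- a) *\<^sub>R Rep (A (Suc i)) (E (Suc i)) c"
proof -
  have z: "(io c, Q c) \<in> S" using c by (simp add: W_def)
  have y: "pd (v s) h (pt v m c) = a *\<^sub>R ev (pd (bs s, 0) (E i)) c" if "s \<le> p" for s
    using that pm by (intro pd_pt[where k="\<lambda>c. a *\<^sub>R ev (E i) c"] h hasc_scale hasc_ev_y E_smooth c) auto
  have x: "pd (v s) h (pt v m c) = a *\<^sub>R (c s *\<^sub>R ev (E (Suc i)) c)" if "s \<in> {p+1..m}" for s
    using that by (intro pd_pt[where k="\<lambda>c. a *\<^sub>R ev (E i) c"] h hasc_scale hasc_ev_q E_smooth E_parity pr_E c) auto
  have "{1..m} = {1..p} \<union> {p+1..m}" using pm by auto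
  then have "(\<Sum>s\<in>{1..m}. mul (v s) (pd (v s) h (pt v m c))) =
     (\<Sum>s\<in>{1..p}. mul (v s) (pd (v s) h (pt v m c))) + (\<Sum>s\<in>{p+1..m}. mul (v s) (pd (v s) h (pt v m c)))"
    by (simp add: sum.union_disjoint)
  also have "(\<Sum>s\<in>{p+1..m}. mul (v s) (pd (v s) h (pt v m c))) = a *\<^sub>R mul (X c) (ev (E (Suc i)) c)"
    unfolding sum_q[symmetric] scaleR_right.sum using x by (intro sum.cong refl) (simp add: mul_simps)
  finally have "Dxpbar mul v m h (pt v m c) = a *\<^sub>R (ev (Db (E i)) c - mul (X c) (ev (E (Suc i)) c))"
    unfolding Dxpbar_def using y
    by (simp add: ev_def Db_def mul_simps scaleR_right_diff_distrib scaleR_right.sum[symmetric] algebra_simps)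
  also have "ev (Db (E i)) c = - ev (A (Suc i)) c" using Db_E[OF z] by (simp add: ev_def)
  finally show ?thesis by (simp add: Rep_def algebra_simps)
qed

section \<open>The operators in the brackets, computed on R^(p+1)\<close>

definition W0 :: "(nat \<Rightarrow> real) set" where "W0 = {c \<in> W. \<forall>s\<in>{p+1..m}. c s = 0}"

lemma W0_Q: "c \<in> W0 \<Longrightarrow> Q c = 0" and W0_X: "c \<in> W0 \<Longrightarrow> X c = 0" and W0_S: "c \<in> W0 \<Longrightarrow> (io c, 0) \<in> S"
proof -
  show "Q c = 0" if "c \<in> W0" using that by (simp add: W0_def rq_def)
  then show "(io c, 0) \<in> S" if "c \<in> W0" using that by (simp add: W0_def W_def)
  show "X c = 0" if "c \<in> W0" using that by (simp add: W0_def xqpart_def)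
qed

text \<open>For h only the values on R^(p+1) are known, and that is enough: a line along
  \<open>v s\<close> with s at most p does not leave it.\<close>

lemma pd_pt0:
  assumes h: "\<And>c. c \<in> W0 \<Longrightarrow> h (pt v m c) = g (io c, 0)" and g: "smooth S g" and c: "c \<in> W0" and s: "s \<le> p"
  shows "pd (v s) h (pt v m c) = pd (bs s, 0) g (io c, 0)"
proof (rule haspd_pd)
  have sm: "s \<le> m" using s pm by simp
  have "\<forall>\<^sub>F t in nhds 0. c(s := c s + t) \<in> W" using c by (intro W_line) (simp add: W0_def)
  then have "\<forall>\<^sub>F t in nhds 0. c(s := c s + t) \<in> W0"
    by eventually_elim (use c s in \<open>auto simp: W0_def\<close>)
  then have "\<forall>\<^sub>F t in nhds 0. g ((io c, 0) + t *\<^sub>R (bs s, 0)) = h (pt v m c + t *\<^sub>R v s)"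
  proof eventually_elim
    case (elim t)
    have "h (pt v m c + t *\<^sub>R v s) = h (pt v m (c(s := c s + t)))" by (simp only: pt_upd[OF sm])
    also have "\<dots> = g (io (c(s := c s + t)), 0)" by (rule h[OF elim])
    also have "\<dots> = g ((io c, 0) + t *\<^sub>R (bs s, 0))" using s by (simp add: io_upd)
    finally show ?case by simp
  qed
  then have "\<forall>\<^sub>F t in at 0. g ((io c, 0) + t *\<^sub>R (bs s, 0)) = h (pt v m c + t *\<^sub>R v s)"
    by (simp add: eventually_nhds_conv_at)
  moreover have "g ((io c, 0) + 0 *\<^sub>R (bs s, 0)) = h (pt v m c + 0 *\<^sub>R v s)" using h[OF c] by simp
  ultimately show "haspd (v s) h (pd (bs s, 0) g (io c, 0)) (pt v m c)"
    using smooth_haspd[OF g bsB[OF s] W0_S[OF c]] unfolding haspd_def has_vector_derivative_def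
    by (auto intro: has_derivative_transform_eventually)
qed

lemma Lapp0:
  assumes h: "\<And>c. c \<in> W0 \<Longrightarrow> h (pt v m c) = g (io c, 0)" and g: "smooth S g" and c: "c \<in> W0"
  shows "Lapp v p h (pt v m c) = Lp g (io c, 0)"
  unfolding Lapp_def Lp_def
  by (intro sum.cong refl pd_pt0 h g c smooth_pd bsB) auto

lemma Dxp0:
  assumes h: "\<And>c. c \<in> W0 \<Longrightarrow> h (pt v m c) = g (io c, 0)" and g: "smooth S g" and c: "c \<in> W0"
  shows "Dxp mul v p h (pt v m c) = Dp g (io c, 0)"
  unfolding Dxp_def Dp_def using pd_pt0[OF h g c] by simp

lemma Dxpbar0:
  assumes h: "\<And>c. c \<in> W0 \<Longrightarrow> h (pt v m c) = g (io c, 0)" and g: "smooth S g" and c: "c \<in> W0"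
  shows "Dxpbar mul v p h (pt v m c) = Db g (io c, 0)"
  unfolding Dxpbar_def Db_def using pd_pt0[OF h g c] by simp

lemma pd_scale: "smooth S u \<Longrightarrow> z \<in> S \<Longrightarrow> b \<in> Basis \<Longrightarrow> pd b (\<lambda>z. a *\<^sub>R u z) z = a *\<^sub>R pd b u z"
  by (intro haspd_pd haspd_linear[OF bounded_linear_scaleR_right] smooth_haspd)

lemma smooth_scale: "smooth S u \<Longrightarrow> smooth S (\<lambda>z. a *\<^sub>R u z)"
  by (rule smooth_linear[OF bounded_linear_scaleR_right])

lemma Lp_scale:
  assumes u: "smooth S u" and z: "z \<in> S"
  shows "Lp (\<lambda>z. a *\<^sub>R u z) z = a *\<^sub>R Lp u z"
  unfolding Lp_def scaleR_right.sum
proof (intro sum.cong refl)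
  fix s assume "s \<in> {..p}"
  then have b: "(bs s, 0::real) \<in> Basis" using bsB by simp
  have "pd (bs s, 0) (pd (bs s, 0) (\<lambda>z. a *\<^sub>R u z)) z = pd (bs s, 0) (\<lambda>z. a *\<^sub>R pd (bs s, 0) u z) z"
    by (rule pd_transfer[OF z pd_scale[OF u _ b]])
  also have "\<dots> = a *\<^sub>R pd (bs s, 0) (pd (bs s, 0) u) z" by (rule pd_scale[OF smooth_pd[OF u b] z b])
  finally show "pd (bs s, 0) (pd (bs s, 0) (\<lambda>z. a *\<^sub>R u z)) z = a *\<^sub>R pd (bs s, 0) (pd (bs s, 0) u) z" .
qed

text \<open>At r = 0 the second term of \<open>Lp_E\<close> drops out, so the Laplacian acts as a
  shift of the sequence with an explicit factor.\<close>

lemma Lapp_power_E0: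
  assumes h: "\<And>c. c \<in> W0 \<Longrightarrow> h (pt v m c) = a *\<^sub>R E i (io c, 0)" and c: "c \<in> W0"
  shows "(Lapp v p ^^ k) h (pt v m c) = (a * (\<Prod>l<k. - (2 * real (i + l) + 3))) *\<^sub>R E (i + k) (io c, 0)"
  using c
proof (induction k arbitrary: c)
  case (Suc k)
  define b where "b = a * (\<Prod>l<k. - (2 * real (i + l) + 3))"
  have "(Lapp v p ^^ Suc k) h (pt v m c) = Lp (\<lambda>z. b *\<^sub>R E (i + k) z) (io c, 0)"
    using Lapp0[OF Suc.IH smooth_scale[OF E_smooth] Suc.prems] by (simp add: b_def)
  also have "\<dots> = b *\<^sub>R Lp (E (i + k)) (io c, 0)" by (rule Lp_scale[OF E_smooth W0_S[OF Suc.prems]])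
  also have "\<dots> = (b * - (2 * real (i + k) + 3)) *\<^sub>R E (i + Suc k) (io c, 0)"
    unfolding Lp_E[OF W0_S[OF Suc.prems]] by (simp only: snd_conv power_zero_numeral scaleR_zero_left add_0_right scaleR_minus_right scaleR_minus_left mult_minus_right scaleR_scaleR add_Suc_right)
  also have "b * - (2 * real (i + k) + 3) = a * (\<Prod>l<Suc k. - (2 * real (i + l) + 3))"
    by (simp only: b_def prod.lessThan_Suc mult.assoc)
  finally show ?case .
qed (simp add: h)

lemma Lapp_power_A0:
  assumes h: "\<And>c. c \<in> W0 \<Longrightarrow> h (pt v m c) = a *\<^sub>R A i (io c, 0)" and c: "c \<in> W0"
  shows "(Lapp v p ^^ k) h (pt v m c) = (a * (\<Prod>l<k. - (2 * real (i + l) + 1))) *\<^sub>R A (i + k) (io c, 0)"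
  using c
proof (induction k arbitrary: c)
  case (Suc k)
  define b where "b = a * (\<Prod>l<k. - (2 * real (i + l) + 1))"
  have "(Lapp v p ^^ Suc k) h (pt v m c) = Lp (\<lambda>z. b *\<^sub>R A (i + k) z) (io c, 0)"
    using Lapp0[OF Suc.IH smooth_scale[OF A_smooth] Suc.prems] by (simp add: b_def)
  also have "\<dots> = b *\<^sub>R Lp (A (i + k)) (io c, 0)" by (rule Lp_scale[OF A_smooth W0_S[OF Suc.prems]])
  also have "\<dots> = (b * - (2 * real (i + k) + 1)) *\<^sub>R A (i + Suc k) (io c, 0)"
    unfolding Lp_A[OF W0_S[OF Suc.prems]] by (simp only: snd_conv power_zero_numeral scaleR_zero_left add_0_right scaleR_minus_right scaleR_minus_left mult_minus_right scaleR_scaleR add_Suc_right)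
  also have "b * - (2 * real (i + k) + 1) = a * (\<Prod>l<Suc k. - (2 * real (i + l) + 1))"
    by (simp only: b_def prod.lessThan_Suc mult.assoc)
  finally show ?case .
qed (simp add: h)

lemma Dxp_f0:
  assumes c: "c \<in> W0"
  shows "Dxp mul v p f (pt v m c) = 1 *\<^sub>R E 0 (io c, 0)"
proof -
  have "f (pt v m c) = A 0 (io c, 0)" if "c \<in> W0" for c
  proof -
    have "c \<in> W" using that by (simp add: W0_def)
    from f_pt[OF this] show ?thesis using W0_Q[OF that] W0_X[OF that] by (simp add: Rep_def ev_def mul_simps)
  qed
  from Dxp0[OF this A_smooth c] show ?thesis using Dp_A[OF W0_S[OF c], of 0] by simp
qed

lemma Dxp_A0:
  assumes h: "\<And>c. c \<in> W0 \<Longrightarrow> h (pt v m c) = a *\<^sub>R A i (io c, 0)" and c: "c \<in> W0"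
  shows "Dxp mul v p h (pt v m c) = (a * (2 * real i + 1)) *\<^sub>R E i (io c, 0)"
proof -
  have "Dxp mul v p h (pt v m c) = Dp (\<lambda>z. a *\<^sub>R A i z + 0 *\<^sub>R A i z) (io c, 0)"
    using Dxp0[OF h smooth_scale[OF A_smooth] c] by simp
  also have "\<dots> = a *\<^sub>R Dp (A i) (io c, 0) + 0 *\<^sub>R Dp (A i) (io c, 0)"
    by (rule Dp_coeff[OF A_smooth A_smooth W0_S[OF c], where h="\<lambda>_. 0"])
  finally show ?thesis using Dp_A[OF W0_S[OF c], of i] by simp
qed

lemma Dxpbar_E0:
  assumes h: "\<And>c. c \<in> W0 \<Longrightarrow> h (pt v m c) = a *\<^sub>R E i (io c, 0)" and c: "c \<in> W0"
  shows "Dxpbar mul v p h (pt v m c) = (- a) *\<^sub>R A (Suc i) (io c, 0)"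
proof -
  have "Dxpbar mul v p h (pt v m c) = Db (\<lambda>z. a *\<^sub>R E i z + 0 *\<^sub>R E i z) (io c, 0)"
    using Dxpbar0[OF h smooth_scale[OF E_smooth] c] by simp
  also have "\<dots> = a *\<^sub>R Db (E i) (io c, 0) + 0 *\<^sub>R Db (E i) (io c, 0)"
    by (rule Db_coeff[OF E_smooth E_smooth W0_S[OF c], where h="\<lambda>_. 0"])
  finally show ?thesis using Db_E[OF W0_S[OF c], of i] by simp
qed

end

section \<open>Power series and the main theorem\<close>

lemma fact_add_le: "(fact (j + k) :: real) \<le> 2 ^ (j + k) * fact j * fact k"
proof -
  have "(fact (j + k) :: real) = fact j * fact k * real ((j + k) choose j)"
    by (simp add: binomial_fact)
  also have "real ((j + k) choose j) \<le> 2 ^ (j + k)"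
    using binomial_le_pow2[of "j + k" j] by (metis of_nat_le_iff of_nat_numeral of_nat_power)
  finally show ?thesis by (simp add: mult_ac)
qed

lemma dfact_even: "real (dfact (2 * j + 2)) = 2 * (\<Prod>l<j. 2 * real j + 2 - 2 * real l)"
proof (induction j)
  case (Suc j)
  have "(\<Prod>l<Suc j. 2 * real (Suc j) + 2 - 2 * real l) = (2 * real j + 4) * (\<Prod>l<j. 2 * real j + 2 - 2 * real l)"
    unfolding prod.lessThan_Suc_shift by (simp add: algebra_simps)
  moreover have s: "2 * Suc j + 2 = Suc (Suc (2 * j + 2))" by simp
  have "real (Suc (Suc (2 * j + 2)) * d) = (2 * real j + 4) * real d" for d
    by (simp add: algebra_simps)
  then have "real (dfact (2 * Suc j + 2)) = (2 * real j + 4) * (2 * (\<Prod>l<j. 2 * real j + 2 - 2 * real l))"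
    by (simp only: s dfact.simps Suc.IH)
  ultimately show ?case by (simp only: mult.left_commute)
qed (simp add: numeral_2_eq_2)

lemma dfact_odd: "real (dfact (2 * j + 1)) = (\<Prod>l<j. 2 * real l + 3)"
  by (induction j) (simp_all add: algebra_simps)

lemma half_pochhammer: "2 ^ k * pochhammer (q / 2) k = (\<Prod>l<k. 2 * real l + q)" for q :: real
proof -
  have "2 ^ k * pochhammer (q / 2) k = (\<Prod>l<k. 2 * (q / 2 + real l))"
    unfolding pochhammer_prod prod.distrib by (simp add: atLeast0LessThan)
  then show ?thesis by (simp add: algebra_simps)
qed

lemma Gamma_quotient:
  assumes "z > (0::real)"
  shows "Gamma z / Gamma (real k + z) = 1 / pochhammer z k"
proof -
  have "z \<notin> \<int>\<^sub>\<le>\<^sub>0" using assms nonpos_Ints_nonpos by force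
  then have "pochhammer z k = Gamma (z + real k) / Gamma z" by (rule pochhammer_Gamma)
  then show ?thesis using assms Gamma_real_pos[OF assms] by (simp add: add.commute)
qed

lemma prod_uminus: "(\<Prod>l<k. - g l) = (- 1) ^ k * (\<Prod>l<k. g l)" for g :: "nat \<Rightarrow> real"
  by (induction k) simp_all

text \<open>The Gamma quotient is the reciprocal of a Pochhammer symbol, and 2^k times that symbol
  is the product produced by the k-th power of the Laplacian. What remains is the weight required by
  \<open>radial_sums\<close>.\<close>

lemma gck_c0_coeff:
  assumes pm: "p < m"
  shows "gck_c0 p m R k * (\<Prod>l<k. - (2 * real l + real (m - p))) = R ^ (2 * k) / (2 ^ k * fact k)"
proof -
  define q where "q = real (m - p)"
  have q: "q > 0" using pm by (simp add: q_def)
  have P: "pochhammer (q / 2) k > 0" using q by (intro pochhammer_pos) simp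
  have "gck_c0 p m R k = (Gamma (q / 2) / Gamma (real k + q / 2)) * ((- 1) ^ k * R ^ (2 * k) / (2 ^ (2 * k) * fact k))"
    by (simp add: gck_c0_def Let_def q_def mult_ac)
  also have "Gamma (q / 2) / Gamma (real k + q / 2) = 1 / pochhammer (q / 2) k"
    using q by (intro Gamma_quotient) simp
  finally have "gck_c0 p m R k * (\<Prod>l<k. - (2 * real l + q)) =
      (1 / pochhammer (q / 2) k) * ((- 1) ^ k * R ^ (2 * k) / (2 ^ (2 * k) * fact k)) * ((- 1) ^ k * (2 ^ k * pochhammer (q / 2) k))"
    by (simp only: prod_uminus half_pochhammer)
  also have "\<dots> = ((- 1) ^ k * (- 1) ^ k) * R ^ (2 * k) * (2 ^ k / 2 ^ (2 * k)) / fact k"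
    using P by (simp add: field_simps)
  also have "(- 1) ^ k * (- 1) ^ k = (1::real)" by (simp flip: power_mult_distrib)
  also have "2 ^ k / 2 ^ (2 * k) = 1 / (2 ^ k :: real)" by (simp add: mult_2 power_add)
  finally show ?thesis by (simp add: q_def)
qed

text \<open>The Gamma quotient now has one more Pochhammer factor than in
  \<open>gck_c0_coeff\<close>. The isolated factor \<open>real (m - p)\<close> supplies it as the
  term with l = 0.\<close>

lemma gck_c1_coeff:
  assumes pm: "p < m"
  shows "gck_c1 p m R k * (real (m - p) * (\<Prod>l<k. - (2 * real l + real (m - p) + 2))) = R ^ (2 * k) / (2 ^ k * fact k)"
proof -
  define q where "q = real (m - p)"
  have q: "q > 0" using pm by (simp add: q_def)
  have P: "pochhammer (q / 2) (Suc k) > 0" using q by (intro pochhammer_pos) simp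
  have "gck_c1 p m R k = (Gamma (q / 2) / Gamma (real (Suc k) + q / 2)) * ((- 1) ^ k * R ^ (2 * k) / (2 ^ (2 * k + 1) * fact k))"
    by (simp add: gck_c1_def Let_def q_def add_ac mult_ac)
  also have "Gamma (q / 2) / Gamma (real (Suc k) + q / 2) = 1 / pochhammer (q / 2) (Suc k)"
    using q by (intro Gamma_quotient) simp
  finally have c: "gck_c1 p m R k = (1 / pochhammer (q / 2) (Suc k)) * ((- 1) ^ k * R ^ (2 * k) / (2 ^ (2 * k + 1) * fact k))" .
  have "q * (\<Prod>l<k. 2 * real l + q + 2) = (\<Prod>l<Suc k. 2 * real l + q)"
    unfolding prod.lessThan_Suc_shift by (simp add: algebra_simps)
  also have "\<dots> = 2 ^ Suc k * pochhammer (q / 2) (Suc k)" by (rule half_pochhammer[symmetric])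
  finally have qq: "q * (\<Prod>l<k. 2 * real l + q + 2) = 2 ^ Suc k * pochhammer (q / 2) (Suc k)" .
  have "q * (\<Prod>l<k. - (2 * real l + q + 2)) = (- 1) ^ k * (q * (\<Prod>l<k. 2 * real l + q + 2))"
    unfolding prod_uminus by (rule mult.left_commute)
  then have "q * (\<Prod>l<k. - (2 * real l + q + 2)) = (- 1) ^ k * (2 ^ Suc k * pochhammer (q / 2) (Suc k))"
    unfolding qq .
  then have "gck_c1 p m R k * (q * (\<Prod>l<k. - (2 * real l + q + 2))) =
      (1 / pochhammer (q / 2) (Suc k)) * ((- 1) ^ k * R ^ (2 * k) / (2 ^ (2 * k + 1) * fact k)) * ((- 1) ^ k * (2 ^ Suc k * pochhammer (q / 2) (Suc k)))"
    by (simp only: c)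
  also have "\<dots> = ((- 1) ^ k * (- 1) ^ k) * R ^ (2 * k) * (2 ^ Suc k / 2 ^ (2 * k + 1)) / fact k"
    using P by (simp add: field_simps del: pochhammer_Suc)
  also have "(- 1) ^ k * (- 1) ^ k = (1::real)" by (simp flip: power_mult_distrib)
  also have "2 ^ Suc k / 2 ^ (2 * k + 1) = 1 / (2 ^ k :: real)"
  proof -
    have e: "2 * k + 1 = Suc k + k" by simp
    show ?thesis unfolding e power_add by simp
  qed
  finally show ?thesis by (simp add: q_def)
qed

section \<open>Evaluation of the two series\<close>

context slice_fun
begin

text \<open>\<open>radial_sums\<close> for the sequence shifted by j. The shift turns k! into (j +
  k)!, which is absorbed by doubling L; since a is nonzero, summability of the scaled series passes
  to the unscaled one.\<close>

lemma series_aux: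
  fixes B :: "nat \<Rightarrow> 'a \<times> real \<Rightarrow> 'a"
  assumes sm: "\<And>i. smooth S (B i)" and pr: "\<And>i z. z \<in> S \<Longrightarrow> pr (B i) z = snd z *\<^sub>R B (Suc i) z"
    and z: "(y, R) \<in> S" and R: "R \<ge> 0"
    and L: "L > 0" and bnd: "\<And>k r. 0 \<le> r \<Longrightarrow> r \<le> R \<Longrightarrow> norm (B k (y, r)) \<le> C * L ^ k * fact k"
    and sum: "summable (\<lambda>k. (a * (R ^ (2 * k) / (2 ^ k * fact k))) *\<^sub>R B (j + k) (y, 0))" and a: "a \<noteq> 0"
  shows "(\<Sum>k. (a * (R ^ (2 * k) / (2 ^ k * fact k))) *\<^sub>R B (j + k) (y, 0)) = a *\<^sub>R B j (y, R)"
proof -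
  have s: "summable (\<lambda>k. (R ^ (2 * k) / (2 ^ k * fact k)) *\<^sub>R B (j + k) (y, 0))"
    using summable_scaleR_right[OF sum, of "1 / a"] a by simp
  have C0: "C \<ge> 0" using bnd[of 0 0] R order_trans[OF norm_ge_zero] by fastforce
  have "(\<lambda>k r. B (j + k) (y, r)) 0 R = (\<Sum>k. (R ^ (2 * k) / (2 ^ k * fact k)) *\<^sub>R (\<lambda>k r. B (j + k) (y, r)) k 0)"
  proof (rule radial_sums[OF R])
    show "continuous_on {0..R} (\<lambda>r. B (j + k) (y, r))" for k
      by (intro continuous_on_compose2[OF smooth_continuous[OF sm]] continuous_intros)
         (use segment_S[OF z] in auto)
    show "((\<lambda>r. B (j + k) (y, r)) has_vector_derivative r *\<^sub>R B (j + Suc k) (y, r)) (at r)" if r: "0 < r" "r < R" for k r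
    proof -
      have zr: "(y, r) \<in> S" using segment_S[OF z, of r] r by simp
      have "haspd (0, 1) (B (j + k)) (pr (B (j + k)) ((y, 0) + r *\<^sub>R (0, 1))) ((y, 0) + r *\<^sub>R (0, 1))"
        using zr by (intro smooth_haspd[OF sm]) auto
      from haspd_shift[OF this] show ?thesis using pr[OF zr] by simp
    qed
    show "norm (B (j + k) (y, r)) \<le> (C * (2 * L) ^ j * fact j) * (2 * L) ^ k * fact k" if r: "0 \<le> r" "r \<le> R" for k r
    proof -
      have "norm (B (j + k) (y, r)) \<le> C * L ^ (j + k) * fact (j + k)" by (rule bnd[OF r])
      also have "\<dots> \<le> C * L ^ (j + k) * (2 ^ (j + k) * fact j * fact k)"
        using C0 L by (intro mult_left_mono fact_add_le) auto
      also have "\<dots> = (C * (2 * L) ^ j * fact j) * (2 * L) ^ k * fact k"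
        by (simp add: power_add power_mult_distrib mult_ac)
      finally show ?thesis .
    qed
    show "summable (\<lambda>k. (R ^ (2 * k) / (2 ^ k * fact k)) *\<^sub>R B (j + k) (y, 0))" by (rule s)
    show "2 * L > 0" using L by simp
  qed
  then have "B j (y, R) = (\<Sum>k. (R ^ (2 * k) / (2 ^ k * fact k)) *\<^sub>R B (j + k) (y, 0))" by simp
  then have "a *\<^sub>R B j (y, R) = (\<Sum>k. a *\<^sub>R ((R ^ (2 * k) / (2 ^ k * fact k)) *\<^sub>R B (j + k) (y, 0)))"
    using suminf_scaleR_right[OF s, of a] by simp
  then show ?thesis by simp
qed

lemma E_series:
  assumes "(y, R) \<in> S" "R \<ge> 0" "a \<noteq> 0"
    "summable (\<lambda>k. (a * (R ^ (2 * k) / (2 ^ k * fact k))) *\<^sub>R E (j + k) (y, 0))"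
  shows "(\<Sum>k. (a * (R ^ (2 * k) / (2 ^ k * fact k))) *\<^sub>R E (j + k) (y, 0)) = a *\<^sub>R E j (y, R)"
proof -
  obtain C L where "L > 0" "\<And>k r. 0 \<le> r \<Longrightarrow> r \<le> R \<Longrightarrow> norm (E k (y, r)) \<le> C * L ^ k * fact k"
    using E_bound[OF assms(1)] by metis
  from series_aux[OF E_smooth pr_E assms(1,2) this assms(4,3)] show ?thesis by blast
qed

lemma A_series:
  assumes "(y, R) \<in> S" "R \<ge> 0" "a \<noteq> 0"
    "summable (\<lambda>k. (a * (R ^ (2 * k) / (2 ^ k * fact k))) *\<^sub>R A (j + k) (y, 0))"
  shows "(\<Sum>k. (a * (R ^ (2 * k) / (2 ^ k * fact k))) *\<^sub>R A (j + k) (y, 0)) = a *\<^sub>R A j (y, R)"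
proof -
  obtain C L where "L > 0" "\<And>k r. 0 \<le> r \<Longrightarrow> r \<le> R \<Longrightarrow> norm (A k (y, r)) \<le> C * L ^ k * fact k"
    using A_bound[OF assms(1)] by metis
  from series_aux[OF A_smooth pr_A assms(1,2) this assms(4,3)] show ?thesis by blast
qed

lemma xpart_W0:
  assumes c: "c \<in> W"
  obtains c0 where "c0 \<in> W0" "xpart v p c = pt v m c0" "io c0 = io c"
proof -
  define c0 where "c0 = (\<lambda>s. if s \<le> p then c s else 0)"
  have Q: "Q c0 = 0" by (simp add: rq_def c0_def)
  have io: "io c0 = io c" by (simp add: io_def c0_def)
  have "(io c, 0) \<in> S" using c zero_S by (auto simp: W_def)
  then have "c0 \<in> W0" using Q io by (auto simp: W0_def W_def c0_def)
  moreover have "X c0 = 0" by (simp add: xqpart_def c0_def)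
  then have "xpart v p c = pt v m c0" unfolding pt_split by (simp add: xpart_def c0_def)
  ultimately show ?thesis using that io by blast
qed

context
  fixes j :: nat
  assumes qj: "m - p = 2 * j + 3"
begin

definition A0 :: "'a \<Rightarrow> 'a" where "A0 = (Lapp v p ^^ j) (Dxp mul v p f)"

text \<open>Value (-1)^j (q - 2)!! of the factor relating the bracket \<open>A0\<close> to
  \<open>E j\<close> at r = 0.\<close>

definition \<kappa> :: real where "\<kappa> = (\<Prod>l<j. - (2 * real l + 3))"

lemma \<kappa>_nz: "\<kappa> \<noteq> 0" by (simp add: \<kappa>_def prod_zero_iff)

text \<open>Both sides equal -(q - 1)!!. The factor -2 on the right is 2j + 1 - q as it comes from
  \<open>Dxp_Rep\<close>, and the product is the one accumulated by the powers of the
  Laplacian.\<close>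

lemma gamma_kappa: "gamma_q (m - p) * \<kappa> = - 2 * (\<Prod>l<j. q - 2 * real l - 1)"
proof -
  have "(m - p - 1) div 2 = Suc j" "m - p - 1 = 2 * j + 2" "m - p - 2 = 2 * j + 1"
    using qj by auto
  then have g: "gamma_q (m - p) = (- 1) ^ Suc j * real (dfact (2 * j + 2)) / real (dfact (2 * j + 1))"
    unfolding gamma_q_def by (simp only:)
  have k: "\<kappa> = (- 1) ^ j * real (dfact (2 * j + 1))"
    unfolding \<kappa>_def prod_uminus dfact_odd ..
  have nz: "real (dfact (2 * j + 1)) \<noteq> 0" using \<kappa>_nz unfolding k mult_eq_0_iff by blast
  have "(s * D / d) * (s' * d) = (s * s') * D" if "d \<noteq> 0" for s s' D d :: real using that by simp
  from this[OF nz] have "gamma_q (m - p) * \<kappa> = ((- 1) ^ Suc j * (- 1) ^ j) * real (dfact (2 * j + 2))"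
    unfolding g k .
  also have "(- 1) ^ Suc j * (- 1) ^ j = (- 1 :: real)" by (simp flip: power_mult_distrib)
  also have "real (dfact (2 * j + 2)) = 2 * (\<Prod>l<j. q - 2 * real l - 1)"
    unfolding dfact_even by (simp add: qj algebra_simps)
  finally show ?thesis by simp
qed

lemma A0_W0: "c \<in> W0 \<Longrightarrow> A0 (pt v m c) = \<kappa> *\<^sub>R E j (io c, 0)"
  unfolding A0_def \<kappa>_def using Lapp_power_E0[OF Dxp_f0, of c j] by simp

lemma Dx_Lap_f:
  assumes c: "c \<in> W"
  shows "Dxp mul v m ((Lapp v m ^^ j) f) (pt v m c) = (gamma_q (m - p) * \<kappa>) *\<^sub>R ev (E j) c"
  using Dxp_Rep[OF Lapp_power_f c, of j] unfolding gamma_kappa by (simp add: qj mult.commute)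

lemma HGCK_identity:
  assumes c: "c \<in> W" and sum: "summable (gck_t0 v p m A0 c)"
  shows "Dxp mul v m ((Lapp v m ^^ j) f) (pt v m c) = gamma_q (m - p) *\<^sub>R HGCK mul v p m A0 (\<lambda>_. 0) c"
proof -
  have z: "(io c, Q c) \<in> S" using c by (simp add: W_def)
  obtain c0 where c0: "c0 \<in> W0" "xpart v p c = pt v m c0" "io c0 = io c" using xpart_W0[OF c] .
  have L: "(Lapp v p ^^ k) A0 (pt v m c0) = (\<kappa> * (\<Prod>l<k. - (2 * real (j + l) + 3))) *\<^sub>R E (j + k) (io c, 0)" for k
    using Lapp_power_E0[where h=A0, OF A0_W0 c0(1)] unfolding c0(3) .
  have t: "gck_t0 v p m A0 c = (\<lambda>k. (\<kappa> * (Q c ^ (2 * k) / (2 ^ k * fact k))) *\<^sub>R E (j + k) (io c, 0))"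
  proof
    fix k
    \<comment> \<open>With q = 2j + 3 the factor 2(j + l) + 3 is 2l + q, the form expected by
      \<open>gck_c0_coeff\<close>.\<close>
    have "gck_t0 v p m A0 c k = (\<kappa> * (gck_c0 p m (Q c) k * (\<Prod>l<k. - (2 * real l + real (m - p))))) *\<^sub>R E (j + k) (io c, 0)"
      unfolding gck_t0_def c0(2) L by (simp add: qj algebra_simps)
    then show "gck_t0 v p m A0 c k = (\<kappa> * (Q c ^ (2 * k) / (2 ^ k * fact k))) *\<^sub>R E (j + k) (io c, 0)"
      by (simp only: gck_c0_coeff[OF pm])
  qed
  have "(\<Sum>k. gck_t0 v p m A0 c k) = \<kappa> *\<^sub>R ev (E j) c"
    using E_series[OF z rq_nonneg \<kappa>_nz] sum unfolding t ev_def by blast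
  moreover have "(Lapp v p ^^ k) (\<lambda>_. 0) = (\<lambda>_. 0 :: 'a)" for k
    by (induction k) (auto simp: Lapp_def[abs_def] pd_const[abs_def])
  then have "(\<Sum>k. hgck_t1 v p m (\<lambda>_. 0 :: 'a) c k) = 0" by (simp add: hgck_t1_def)
  ultimately have "HGCK mul v p m A0 (\<lambda>_. 0) c = \<kappa> *\<^sub>R ev (E j) c"
    by (simp add: HGCK_def mul_simps)
  then show ?thesis using Dx_Lap_f[OF c] by simp
qed

lemma GCK_identity:
  assumes c: "c \<in> W" and sum0: "summable (gck_t0 v p m (Dxpbar mul v p A0) c)"
    and sum1: "summable (gck_t1 mul v p m (Dxpbar mul v p A0) c)"
  shows "Dxpbar mul v m (Dxp mul v m ((Lapp v m ^^ j) f)) (pt v m c) = gamma_q (m - p) *\<^sub>R GCK mul v p m (Dxpbar mul v p A0) c"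
proof -
  let ?g = "Dxpbar mul v p A0"
  have z: "(io c, Q c) \<in> S" using c by (simp add: W_def)
  obtain c0 where c0: "c0 \<in> W0" "xpart v p c = pt v m c0" "io c0 = io c" using xpart_W0[OF c] .
  have g: "?g (pt v m c) = (- \<kappa>) *\<^sub>R A (Suc j) (io c, 0)" if "c \<in> W0" for c
    by (rule Dxpbar_E0[OF A0_W0 that])
  have Dg: "Dxp mul v p ?g (pt v m c) = (- \<kappa> * (2 * real (Suc j) + 1)) *\<^sub>R E (Suc j) (io c, 0)" if "c \<in> W0" for c
    by (rule Dxp_A0[OF g that])
  have nz: "- \<kappa> \<noteq> 0" using \<kappa>_nz by simp
  have L0: "(Lapp v p ^^ k) ?g (pt v m c0) = (- \<kappa> * (\<Prod>l<k. - (2 * real (Suc j + l) + 1))) *\<^sub>R A (Suc j + k) (io c, 0)" for k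
    using Lapp_power_A0[where h="?g", OF g c0(1)] unfolding c0(3) .
  have L1: "(Lapp v p ^^ k) (Dxp mul v p ?g) (pt v m c0) =
      (- \<kappa> * (2 * real (Suc j) + 1) * (\<Prod>l<k. - (2 * real (Suc j + l) + 3))) *\<^sub>R E (Suc j + k) (io c, 0)" for k
    using Lapp_power_E0[where h="Dxp mul v p ?g", OF Dg c0(1)] unfolding c0(3) .
  have t0: "gck_t0 v p m ?g c = (\<lambda>k. (- \<kappa> * (Q c ^ (2 * k) / (2 ^ k * fact k))) *\<^sub>R A (Suc j + k) (io c, 0))"
  proof
    fix k
    \<comment> \<open>Here 2(j + 1 + l) + 1 is 2l + q.\<close>
    have "gck_t0 v p m ?g c k = (- \<kappa> * (gck_c0 p m (Q c) k * (\<Prod>l<k. - (2 * real l + real (m - p))))) *\<^sub>R A (Suc j + k) (io c, 0)"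
      unfolding gck_t0_def c0(2) L0 by (simp add: qj algebra_simps)
    then show "gck_t0 v p m ?g c k = (- \<kappa> * (Q c ^ (2 * k) / (2 ^ k * fact k))) *\<^sub>R A (Suc j + k) (io c, 0)"
      by (simp only: gck_c0_coeff[OF pm])
  qed
  have t1: "gck_t1 mul v p m ?g c = (\<lambda>k. (- \<kappa> * (Q c ^ (2 * k) / (2 ^ k * fact k))) *\<^sub>R E (Suc j + k) (io c, 0))"
  proof
    fix k
    \<comment> \<open>The factor 2(j + 1) + 1 left by \<open>Dxp_A0\<close> is q, and 2(j + 1 + l) +
      3 is 2l + q + 2.\<close>
    have "gck_t1 mul v p m ?g c k = (- \<kappa> * (gck_c1 p m (Q c) k * (real (m - p) * (\<Prod>l<k. - (2 * real l + real (m - p) + 2))))) *\<^sub>R E (Suc j + k) (io c, 0)"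
      unfolding gck_t1_def c0(2) L1 by (simp add: qj algebra_simps)
    then show "gck_t1 mul v p m ?g c k = (- \<kappa> * (Q c ^ (2 * k) / (2 ^ k * fact k))) *\<^sub>R E (Suc j + k) (io c, 0)"
      by (simp only: gck_c1_coeff[OF pm])
  qed
  have "(\<Sum>k. gck_t0 v p m ?g c k) = (- \<kappa>) *\<^sub>R ev (A (Suc j)) c"
    using A_series[OF z rq_nonneg nz] sum0 unfolding t0 ev_def by blast
  moreover have "(\<Sum>k. gck_t1 mul v p m ?g c k) = (- \<kappa>) *\<^sub>R ev (E (Suc j)) c"
    using E_series[OF z rq_nonneg nz] sum1 unfolding t1 ev_def by blast
  ultimately have "GCK mul v p m ?g c = (- \<kappa>) *\<^sub>R Rep (A (Suc j)) (E (Suc j)) c"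
    by (simp add: GCK_def Rep_def mul_simps algebra_simps)
  moreover have "Dxpbar mul v m (Dxp mul v m ((Lapp v m ^^ j) f)) (pt v m c) =
      (- (gamma_q (m - p) * \<kappa>)) *\<^sub>R Rep (A (Suc j)) (E (Suc j)) c"
    by (rule Dxpbar_Rep[OF Dx_Lap_f c])
  ultimately show ?thesis by simp
qed

end

end

section \<open>From the hypotheses of the theorem to a frame and a tube\<close>

lemma frame_exists:
  fixes mul :: "'a::euclidean_space \<Rightarrow> 'a \<Rightarrow> 'a"
  assumes alg: "alt_algebra_invol mul one cj" and basis: "adm_basis mul one cj v m" and pm: "p < m"
  obtains bs where "frame mul v m p bs"
proof -
  have bil: "bilinear mul" and one: "\<And>a. mul one a = a"
    and alt: "\<And>a w. mul a (mul a w) = mul (mul a a) w"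
    using alg unfolding alt_algebra_invol_def associator_def by auto
  have v0: "v 0 = one" and vS': "\<forall>s\<in>{1..m}. v s \<in> SA mul one cj"
    and anti': "\<forall>s\<in>{1..m}. \<forall>t\<in>{1..m}. s \<noteq> t \<longrightarrow> mul (v s) (v t) = - mul (v t) (v s)"
    and ind: "inj_on v {0..m}" "independent (v ` {0..m})"
    using basis unfolding adm_basis_def by blast+
  have vS: "v s \<in> SA mul one cj" if "1 \<le> s" "s \<le> m" for s
    using vS' that by simp
  have anti: "mul (v s) (v t) = - mul (v t) (v s)" if "1 \<le> s" "s \<le> m" "1 \<le> t" "t \<le> m" "s \<noteq> t" for s t
    using anti'[rule_format, of s t] that by simp
  note l = bilinear_ladd[OF bil] bilinear_radd[OF bil] bilinear_lneg[OF bil] bilinear_rneg[OF bil]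
  \<comment> \<open>Trace 0 means that conjugation changes the sign of \<open>v s\<close>, so norm 1
    says that its square is -1.\<close>
  have sq: "mul (v s) (v s) = - one" if "1 \<le> s" "s \<le> m" for s
  proof -
    have "v s + cj (v s) = 0" "mul (v s) (cj (v s)) = one"
      using vS[OF that] by (auto simp: SA_def trA_def nmA_def)
    then have "cj (v s) = - v s" by (simp add: add_eq_0_iff)
    with \<open>mul (v s) (cj (v s)) = one\<close> have "- mul (v s) (v s) = one" by (simp add: l)
    then show ?thesis by (metis minus_minus)
  qed
  \<comment> \<open>Independence of the m + 1 vectors \<open>v s\<close> bounds m + 1 by the
    dimension, leaving enough basis vectors to serve as axes.\<close>
  have "card {..p} \<le> card (Basis :: 'a set)"
  proof -
    have "card (v ` {0..m}) \<le> DIM('a)" using independent_bound[OF ind(2)] by simp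
    then show ?thesis using card_image[OF ind(1)] pm by simp
  qed
  then obtain bs where bs: "bs ` {..p} \<subseteq> (Basis :: 'a set)" "inj_on bs {..p}"
    using card_le_inj[of "{..p}" "Basis :: 'a set"] by auto
  have "frame mul v m p bs"
  proof (rule frame.intro)
    show "mul (v s) (mul (v s) w) = - w" if "1 \<le> s" "s \<le> m" for s w
      unfolding alt sq[OF that] by (simp add: l one)
    show "mul (v s) (mul (v t) w) = - mul (v t) (mul (v s) w)"
      if "1 \<le> s" "s \<le> m" "1 \<le> t" "t \<le> m" "s \<noteq> t" for s t w
    proof -
      \<comment> \<open>Polarization of the left alternative law: expand and remove the two pure
        squares.\<close>
      have "mul (v s + v t) (mul (v s + v t) w) = mul (mul (v s + v t) (v s + v t)) w" by (rule alt)
      then have "mul (v s) (mul (v t) w) + mul (v t) (mul (v s) w) = mul (mul (v s) (v t) + mul (v t) (v s)) w"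
        by (simp add: l alt algebra_simps)
      also have "\<dots> = 0" using anti[OF that] bilinear_lzero[OF bil] by simp
      finally show ?thesis by (simp add: eq_neg_iff_add_eq_0)
    qed
  qed (use bil one v0 pm bs in auto)
  then show ?thesis using that by blast
qed

text \<open>The segment from x_p to x and its mirror image are compact, so a thin product
  neighbourhood in one slice lies in \<Omega>; p-symmetry then transports it to every slice.\<close>

lemma (in frame) slice_fun_exists:
  assumes sdom: "slice_domain v p m \<Omega>" and psym: "p_symmetric v p m \<Omega>"
    and mono: "gen_ps_monogenic mul v p m \<Omega> f"
    and seg: "\<And>t. t \<in> {0..1::real} \<Longrightarrow> xpart v p c + t *\<^sub>R xqpart v p m c \<in> \<Omega>"
  obtains S \<eta> where "slice_fun mul v m p bs S f \<Omega> \<eta>" "((\<Sum>s\<le>p. c s *\<^sub>R bs s), rq p m c) \<in> S"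
proof -
  define R where "R = rq p m c"
  define y0 where "y0 = (\<Sum>s\<le>p. c s *\<^sub>R bs s)"
  have R0: "R \<ge> 0" by (simp add: R_def rq_def sum_nonneg)
  have Ty0: "T y0 = xpart v p c"
    unfolding y0_def xpart_def linear_sum[OF linear_T] by (simp add: T_scale T_bs)
  obtain \<eta> where eta: "\<eta> \<in> Ssph v p m" "xqpart v p m c = R *\<^sub>R \<eta>"
  proof (cases "R = 0")
    case True
    have "(\<Sum>s\<in>{p+1..m}. (c s)\<^sup>2) = 0" using True by (simp add: R_def rq_def)
    then have "\<And>s. s \<in> {p+1..m} \<Longrightarrow> c s = 0" by (subst (asm) sum_nonneg_eq_0_iff) auto
    then have "xqpart v p m c = 0" unfolding xqpart_def by (intro sum.neutral) auto
    \<comment> \<open>For x_q = 0 some unit is still needed, and \<open>v m\<close> is available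
      because p < m.\<close>
    moreover have "v m \<in> Ssph v p m"
      unfolding Ssph_def using pm
      by (intro CollectI exI[of _ "\<lambda>s. if s = m then 1 else 0"]) (auto simp: if_distrib if_distribR cong: if_cong)
    ultimately show ?thesis using that True by simp
  next
    case False
    then have Rp: "R > 0" using R0 by simp
    then have "(1 / R) *\<^sub>R xqpart v p m c \<in> Ssph v p m"
      unfolding R_def by (rule xq_unit)
    then show ?thesis using that Rp by simp
  qed
  have sym: "y + r *\<^sub>R \<omega> \<in> \<Omega>" if "y \<in> Rp1 v p" "y + r *\<^sub>R \<eta> \<in> \<Omega>" "r > 0" "\<omega> \<in> Ssph v p m" for y r \<omega>
    using psym that eta(1) unfolding p_symmetric_def by blast
  have seg_pos: "T y0 + t *\<^sub>R \<eta> \<in> \<Omega>" if "0 \<le> t" "t \<le> R" for t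
  proof (cases "R = 0")
    case True
    then show ?thesis using seg[of 0] that Ty0 by simp
  next
    case False
    then have "xpart v p c + (t / R) *\<^sub>R xqpart v p m c \<in> \<Omega>" using that R0 by (intro seg) auto
    then show ?thesis using False by (simp add: Ty0 eta(2))
  qed
  let ?\<Theta> = "\<lambda>z. T (fst z) + snd z *\<^sub>R \<eta>"
  have seg_all: "?\<Theta> (y0, t) \<in> \<Omega>" if "- R \<le> t" "t \<le> R" for t
  proof (cases "t \<ge> 0")
    case False
    then have "T y0 + (- t) *\<^sub>R (- \<eta>) \<in> \<Omega>"
      using seg_pos[of "- t"] that by (intro sym[OF T_span _ _ Ssph_neg[OF eta(1)]]) auto
    then show ?thesis by simp
  qed (use seg_pos that in auto)
  have "openin (top_of_set (Mspace v m)) \<Omega>"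
    using sdom unfolding slice_domain_def is_domain_in_def by (elim conjE)
  then obtain O' where O': "open O'" "\<Omega> = Mspace v m \<inter> O'"
    unfolding openin_open by blast
  have "\<eta> \<in> Mspace v m"
  proof -
    obtain c where c: "\<eta> = xqpart v p m c" using Ssph_xq[OF eta(1)] by blast
    show ?thesis unfolding c xqpart_def Mspace_def by (intro span_sum span_scale span_base) auto
  qed
  moreover have "T y \<in> Mspace v m" for y
  proof -
    have "v ` {0..p} \<subseteq> v ` {0..m}" using pm by auto
    from span_mono[OF this] show ?thesis using T_span[of y] unfolding Rp1_def Mspace_def by blast
  qed
  ultimately have \<Theta>M: "?\<Theta> z \<in> Mspace v m" for z
    unfolding Mspace_def by (intro span_add span_scale) auto
  have \<Theta>c: "continuous_on UNIV ?\<Theta>"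
    by (intro continuous_intros continuous_on_compose2[OF T_cont[of UNIV]]) auto
  have op: "open (?\<Theta> -` O')" using O'(1) \<Theta>c by (simp add: open_vimage)
  have cpt: "compact ({y0} \<times> {- R..R})" by (intro compact_Times) auto
  have sub: "{y0} \<times> {- R..R} \<subseteq> ?\<Theta> -` O'" using seg_all O'(2) by auto
  obtain e where e: "e > 0" "(\<Union>x\<in>{y0} \<times> {- R..R}. ball x e) \<subseteq> ?\<Theta> -` O'"
    by (rule compact_subset_open_imp_ball_epsilon_subset[OF cpt op sub])
  \<comment> \<open>A margin e/2 in each factor, because the distance in the product is at most the
    sum of the two.\<close>
  define S where "S = ball y0 (e/2) \<times> {- (R + e/2)<..<R + e/2}"
  have S_in: "?\<Theta> (y, t) \<in> \<Omega>" if "(y, t) \<in> S" for y t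
  proof -
    \<comment> \<open>The nearest point of [-R, R] to t.\<close>
    define t' where "t' = max (- R) (min R t)"
    have t': "t' \<in> {- R..R}" "\<bar>t - t'\<bar> < e/2"
      using that R0 e(1) unfolding t'_def S_def max_def min_def by (auto split: if_splits)
    have "dist (y0, t') (y, t) \<le> dist y0 y + dist t' t"
      by (simp add: dist_Pair_Pair sqrt_sum_squares_le_sum)
    also have "\<dots> < e" using that t' by (simp add: S_def dist_real_def abs_minus_commute)
    finally have "(y, t) \<in> (\<Union>x\<in>{y0} \<times> {- R..R}. ball x e)" using t'(1) by (intro UN_I[of "(y0, t')"]) auto
    then show ?thesis using e(2) O'(2) \<Theta>M by blast
  qed
  have "slice_fun mul v m p bs S f \<Omega> \<eta>"
  proof unfold_locales
    show "open S" unfolding S_def by (intro open_Times) auto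
    show star: "(y, t * r) \<in> S" if "(y, r) \<in> S" "\<bar>t\<bar> \<le> 1" for y r t
    proof -
      have "\<bar>t * r\<bar> \<le> 1 * \<bar>r\<bar>" unfolding abs_mult using that by (intro mult_right_mono) auto
      then show ?thesis using that(1) unfolding S_def by auto
    qed
    show "T y + r *\<^sub>R \<omega> \<in> \<Omega>" if om: "\<omega> \<in> Ssph v p m" and z: "(y, r) \<in> S" for \<omega> y r
    proof -
      consider "r = 0" | "r > 0" | "r < 0" by linarith
      then show ?thesis
      proof cases
        case 1
        then show ?thesis using S_in[OF z] by simp
      next
        case 2
        then show ?thesis using S_in[OF z] by (intro sym[OF T_span _ _ om]) auto
      next
        case 3
        have "T y + (- r) *\<^sub>R (- \<omega>) \<in> \<Omega>"
          using S_in[OF star[OF z, of "- 1"]] 3 by (intro sym[OF T_span _ _ Ssph_neg[OF om]]) auto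
        then show ?thesis by simp
      qed
    qed
  qed (use mono eta in auto)
  moreover have "(y0, R) \<in> S" using e(1) R0 by (simp add: S_def)
  ultimately show ?thesis using that unfolding y0_def R_def by blast
qed

theorem theorem5p4:
  fixes mul :: "'a::euclidean_space \<Rightarrow> 'a \<Rightarrow> 'a" and one :: 'a and cj :: "'a \<Rightarrow> 'a"
    and v :: "nat \<Rightarrow> 'a" and m p q :: nat and \<Omega> :: "'a set" and f :: "'a \<Rightarrow> 'a"
  assumes alg: "alt_algebra_invol mul one cj"
    and basis: "adm_basis mul one cj v m"
    and pm: "p < m" and qdef: "q = m - p"
    and qodd: "odd q" and q3: "q \<ge> 3"
    and sdom: "slice_domain v p m \<Omega>" and psym: "p_symmetric v p m \<Omega>"
    and mono: "gen_ps_monogenic mul v p m \<Omega> f"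
  shows
    "(\<forall>c. HGCK_defined v p m \<Omega> ((Lapp v p ^^ ((q - 3) div 2)) (Dxp mul v p f)) (\<lambda>_. 0) c \<longrightarrow>
        Dxp mul v m ((Lapp v m ^^ ((q - 3) div 2)) f) (pt v m c)
        = gamma_q q *\<^sub>R HGCK mul v p m ((Lapp v p ^^ ((q - 3) div 2)) (Dxp mul v p f)) (\<lambda>_. 0) c) \<and>
     (\<forall>c. GCK_defined mul v p m \<Omega> (Dxpbar mul v p ((Lapp v p ^^ ((q - 3) div 2)) (Dxp mul v p f))) c \<longrightarrow>
        Dxpbar mul v m (Dxp mul v m ((Lapp v m ^^ ((q - 3) div 2)) f)) (pt v m c)
        = gamma_q q *\<^sub>R GCK mul v p m (Dxpbar mul v p ((Lapp v p ^^ ((q - 3) div 2)) (Dxp mul v p f))) c)"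
proof -
  obtain bs where "frame mul v m p bs" using frame_exists[OF alg basis pm] .
  then interpret frame mul v m p bs .
  define j where "j = (q - 3) div 2"
  have qj: "m - p = 2 * j + 3" using qodd q3 unfolding qdef j_def by presburger
  show ?thesis
    unfolding j_def[symmetric]
  proof (intro conjI allI impI)
    fix c assume d: "HGCK_defined v p m \<Omega> ((Lapp v p ^^ j) (Dxp mul v p f)) (\<lambda>_. 0) c"
    obtain S \<eta> where S: "slice_fun mul v m p bs S f \<Omega> \<eta>" "((\<Sum>s\<le>p. c s *\<^sub>R bs s), rq p m c) \<in> S"
      by (rule slice_fun_exists[OF sdom psym mono, of c]) (use d in \<open>unfold HGCK_defined_def, blast\<close>)+
    \<comment> \<open>The tube depends on the point c, so the setting is instantiated anew for each
      c.\<close>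
    interpret slice_fun mul v m p bs S f \<Omega> \<eta> by (rule S(1))
    have "c \<in> W" using S(2) by (simp add: W_def io_def)
    from HGCK_identity[OF qj this] d
    show "Dxp mul v m ((Lapp v m ^^ j) f) (pt v m c) =
        gamma_q q *\<^sub>R HGCK mul v p m ((Lapp v p ^^ j) (Dxp mul v p f)) (\<lambda>_. 0) c"
      unfolding HGCK_defined_def A0_def[OF qj] qdef by blast
  next
    fix c assume d: "GCK_defined mul v p m \<Omega> (Dxpbar mul v p ((Lapp v p ^^ j) (Dxp mul v p f))) c"
    obtain S \<eta> where S: "slice_fun mul v m p bs S f \<Omega> \<eta>" "((\<Sum>s\<le>p. c s *\<^sub>R bs s), rq p m c) \<in> S"
      by (rule slice_fun_exists[OF sdom psym mono, of c]) (use d in \<open>unfold GCK_defined_def, blast\<close>)+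
    interpret slice_fun mul v m p bs S f \<Omega> \<eta> by (rule S(1))
    have "c \<in> W" using S(2) by (simp add: W_def io_def)
    from GCK_identity[OF qj this] d
    show "Dxpbar mul v m (Dxp mul v m ((Lapp v m ^^ j) f)) (pt v m c) =
        gamma_q q *\<^sub>R GCK mul v p m (Dxpbar mul v p ((Lapp v p ^^ j) (Dxp mul v p f))) c"
      unfolding GCK_defined_def A0_def[OF qj] qdef by blast
  qed
qed

end
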